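(* Let $p$ and $q$ be primes with $p\equiv 1\pmod 4$, $q\equiv 3\pmod 4$, $\left(\frac{2}{p}\right)=-1$, $\left(\frac{2}{q}\right)=1$ and $\left(\frac{p}{q}\right)=-1$. Let $\mathbb{K}=\mathbb{Q}(\sqrt2,\sqrt p,\sqrt q,\sqrt{-1})$ and $\mathbb{K}^+=\mathbb{Q}(\sqrt2,\sqrt p,\sqrt q)$. Then 1. $E_{\mathbb{K}^+}=\langle -1,\varepsilon_2,\varepsilon_p,\sqrt{\varepsilon_q},\sqrt{\varepsilon_{2q}},\sqrt{\varepsilon_{pq}},\sqrt{\varepsilon_2\varepsilon_p\varepsilon_{2p}},\sqrt[4]{\varepsilon_2^2\varepsilon_q\varepsilon_{pq}\varepsilon_{2pq}}\rangle$; 2. $E_{\mathbb{K}}=\langle \zeta_8,\varepsilon_2,\varepsilon_p,\sqrt{\varepsilon_q},\sqrt{\varepsilon_{pq}},\sqrt{\varepsilon_2\varepsilon_p\varepsilon_{2p}},\sqrt[4]{\varepsilon_2^2\varepsilon_q\varepsilon_{pq}\varepsilon_{2pq}},\sqrt[4]{\zeta_8^2\varepsilon_q\varepsilon_{2q}}\rangle$.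
   Context: $\left(\frac{\cdot}{\cdot}\right)$ is the Legendre symbol. $E_k$ is the unit group of a number field $k$. For square-free $d>1$, $\varepsilon_d$ is the fundamental unit of $\mathbb{Q}(\sqrt d)$. $\zeta_8$ is a primitive $8$-th root of unity. A radical $\sqrt{u}$ or $\sqrt[4]{u}$ of a unit $u$ denotes a root of $u$ lying in the field under consideration (its existence is part of the claim). *)

theory Defs
  imports "HOL-Analysis.Analysis" "HOL-Computational_Algebra.Polynomial" "HOL-Number_Theory.Number_Theory"
begin

definition is_subfield :: "complex set \<Rightarrow> bool" where
  "is_subfield F \<longleftrightarrow> 0 \<in> F \<and> 1 \<in> F \<and>
     (\<forall>x\<in>F. \<forall>y\<in>F. x + y \<in> F \<and> x * y \<in> F) \<and>
     (\<forall>x\<in>F. - x \<in> F \<and> inverse x \<in> F)"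

definition gen_field :: "complex set \<Rightarrow> complex set" where
  "gen_field S = \<Inter>{F. is_subfield F \<and> S \<subseteq> F}"

definition unit_group :: "complex set \<Rightarrow> complex set" where
  "unit_group k = {u \<in> k. u \<noteq> 0 \<and> algebraic_int u \<and> algebraic_int (inverse u)}"

(* fundamental unit eps_d of Q(sqrt d), d > 1 square-free: the smallest unit > 1
   (Q(sqrt d) is viewed inside R \<subseteq> C via the positive square root) *)
definition fund_unit :: "int \<Rightarrow> complex" where
  "fund_unit d = (THE e. e \<in> unit_group (gen_field {complex_of_real (sqrt (real_of_int d))}) \<and>
       e \<in> \<real> \<and> Re e > 1 \<and>
       (\<forall>u \<in> unit_group (gen_field {complex_of_real (sqrt (real_of_int d))}).
           u \<in> \<real> \<and> Re u > 1 \<longrightarrow> Re e \<le> Re u))"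

definition gen_group :: "complex list \<Rightarrow> complex set" where
  "gen_group gs = {(\<Prod>i<length gs. (gs ! i) powi (k i)) | k :: nat \<Rightarrow> int. True}"

definition zeta8 :: complex where
  "zeta8 = cis (pi / 4)"

end

(*
  Let s2, sp, sq be the automorphisms of K fixing i and negating sqrt 2, sqrt p, sqrt q respectively.
  A product of norms over the seven index-two subgroups they generate writes u^4, for a unit u of K+,
  as a signed product of the seven quadratic fundamental units.  If t has norm 1 in Q(sqrt d) then
  t (tr t + 2) = (1 + t)^2, so m t is a square for a squarefree rational integer m whose primes ramify;
  the residue symbols leave a single class of m for each d.  Hence eps_2, eps_p, eps_2p have norm -1,
  while A = sqrt eps_q, B = sqrt eps_2q, C = sqrt eps_pq, G = sqrt eps_2pq are explicit elements of K+
  whose conjugates are, up to sign, themselves or their inverses.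

  The same trace identity, used once per quadratic step, moves eps_2 eps_p eps_2p, eps_2 A C G and
  (2 + sqrt 2) A B into the square class of a positive rational number m.  These elements are units
  away from 2, so m may be taken squarefree with prime factors among 2, p, q, and all three are squares
  in K+.  Conversely, if u^2 is a monomial in the known units, then for every automorphism f of order two
  u f(u) is fixed by f and equals plus or minus an explicit monomial; comparing signs forces the
  exponents to be those of a product of squares and of a power of eps_2 A C G.

  For a unit u of K the quotient u / conj u is a root of unity, and no roots of unity other than powers of
  zeta_8 lie in K, because sqrt 3 and sqrt (2 + sqrt 2), sqrt (2 - sqrt 2) are not in K+.  The element
  H = (1 + zeta_8) sqrt ((2 + sqrt 2) A B) / (2 + sqrt 2) has H^2 = zeta_8 A B and H / conj H = zeta_8,
  so every unit of K is a power of zeta_8 times a unit of K+, possibly times H.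
*)
theory Submission
  imports Defs "Jordan_Normal_Form.Char_Poly" "HOL-Computational_Algebra.Squarefree"
begin

text \<open>Membership of D, E and S in K+ comes down to norms from Q(sqrt 2): there an element
  whose norm is a rational square agrees with a rational number up to squares. Modulo squares, the
  traces obtained from A, B, C G and eps_p eps_2p have norms q, 2 q, -q and -1. The factor eps_2, of
  norm -1, supplies the missing sign for D and E, and 2 + sqrt 2, of norm 2, supplies the missing 2
  for S. The number 2 + sqrt 2 itself comes from (1 + zeta_8)^2 = zeta_8 (2 + sqrt 2).

  Generation is two extractions of square roots starting from u^4; D enters at the first, E at the
  second. At the second one the signs of the conjugates of u^2 are too weak: positivity of the
  squares of s2 u, sp u and sq u says nothing about the parity of the exponent of B alone, or of the
  exponents of A and C together. The products u f(u) fill this gap, being known up to sign and fixed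
  by f.

  The order of roots of unity is bounded by the same product of seven norms, applied to an element
  of absolute value 1; its quadratic norms then have bounded integral traces.\<close>

section \<open>Integrality of sums and products\<close>

text \<open>The characteristic polynomial of an integer matrix is monic and integral, and it
  vanishes at every eigenvalue. Integrality thereby becomes stability of a finitely generated
  lattice.\<close>

lemma algebraic_int_of_eigenvector:
  fixes z :: complex and v :: "nat \<Rightarrow> complex" and A :: "nat \<Rightarrow> nat \<Rightarrow> int"
  assumes eq: "\<And>i. i < n \<Longrightarrow> z * v i = (\<Sum>j<n. of_int (A i j) * v j)"
    and i0: "i0 < n" "v i0 \<noteq> 0"
  shows "algebraic_int z"
proof -
  define M where "M = mat n n (\<lambda>(i,j). A i j)"
  define w where "w = vec n v"
  let ?M = "map_mat complex_of_int M"
  have M: "M \<in> carrier_mat n n" and M': "?M \<in> carrier_mat n n"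
    by (auto simp: M_def)
  have "eigenvector ?M w z"
    unfolding eigenvector_def
  proof (intro conjI)
    show "w \<in> carrier_vec (dim_row ?M)" by (simp add: w_def M_def)
    show "w \<noteq> 0\<^sub>v (dim_row ?M)"
    proof
      assume "w = 0\<^sub>v (dim_row ?M)"
      hence "Matrix.vec_index w i0 = 0" using i0 by (simp add: M_def)
      thus False using i0 by (simp add: w_def)
    qed
    show "?M *\<^sub>v w = z \<cdot>\<^sub>v w"
      by (rule eq_vecI)
        (auto simp: w_def M_def scalar_prod_def eq lessThan_atLeast0)
  qed
  hence "eigenvalue ?M z" by (auto simp: eigenvalue_def)
  hence "poly (char_poly ?M) z = 0" using eigenvalue_root_char_poly[OF M'] by blast
  moreover have "char_poly ?M = map_poly of_int (char_poly M)"
    by (rule of_int_hom.char_poly_hom[OF M])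
  moreover have "lead_coeff (char_poly M) = 1"
    using degree_monic_char_poly[OF M] by auto
  ultimately show ?thesis
    unfolding algebraic_int_altdef_ipoly by auto
qed

lemma algebraic_int_power_reduce:
  fixes x :: complex
  assumes "algebraic_int x"
  obtains n c where "n > 0" "x ^ n = (\<Sum>i<n. of_int (c i) * x ^ i)"
proof -
  obtain p where p: "poly (map_poly of_int p) x = 0" "lead_coeff p = (1::int)"
    using assms unfolding algebraic_int_altdef_ipoly by blast
  define n where "n = degree p"
  have "n > 0"
  proof (rule ccontr)
    assume "\<not> n > 0"
    hence "degree p = 0" by (simp add: n_def)
    then obtain a where "p = [:a:]" by (rule degree_eq_zeroE)
    thus False using p by simp
  qed
  have deg: "degree (map_poly complex_of_int p) = n" unfolding n_def by simp
  have "0 = (\<Sum>i\<le>n. of_int (Polynomial.coeff p i) * x ^ i)"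
    using p(1)[symmetric] unfolding poly_altdef deg by (simp only: coeff_map_poly of_int_0)
  also have "\<dots> = (\<Sum>i<n. of_int (Polynomial.coeff p i) * x ^ i) + x ^ n"
    using p(2) by (simp add: lessThan_Suc_atMost[symmetric] n_def)
  finally have "x ^ n = - (\<Sum>i<n. of_int (Polynomial.coeff p i) * x ^ i)"
    by (metis add.inverse_inverse add.inverse_unique)
  hence "x ^ n = (\<Sum>i<n. of_int (- Polynomial.coeff p i) * x ^ i)"
    by (simp only: of_int_minus mult_minus_left sum_negf)
  with \<open>n > 0\<close> show ?thesis by (rule that)
qed

text \<open>The monomials \<open>x\<^sup>i y\<^sup>j\<close> span a lattice that is stable under both \<open>x\<close> and \<open>y\<close>.\<close>

lemma algebraic_int_lattice:
  fixes x y :: complex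
  assumes "algebraic_int x" "algebraic_int y"
  obtains n :: nat and v where "n > 0" "v 0 = 1"
    "\<And>i. i < n \<Longrightarrow> \<exists>A. x * v i = (\<Sum>j<n. of_int (A j) * v j)"
    "\<And>i. i < n \<Longrightarrow> \<exists>A. y * v i = (\<Sum>j<n. of_int (A j) * v j)"
proof -
  obtain a c where a: "a > 0" "x ^ a = (\<Sum>i<a. of_int (c i) * x ^ i)"
    using algebraic_int_power_reduce[OF assms(1)] by blast
  obtain b d where b: "b > 0" "y ^ b = (\<Sum>i<b. of_int (d i) * y ^ i)"
    using algebraic_int_power_reduce[OF assms(2)] by blast
  define v where "v = (\<lambda>k. x ^ (k div b) * y ^ (k mod b))"
  define n where "n = a * b"
  have sumv: "(\<Sum>k<n. of_int (f (k div b) (k mod b)) * v k)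
      = (\<Sum>i<a. \<Sum>j<b. of_int (f i j) * x ^ i * y ^ j)" for f :: "nat \<Rightarrow> nat \<Rightarrow> int"
  proof -
    have bij: "bij_betw (\<lambda>(i,j). i * b + j) ({..<a} \<times> {..<b}) {..<n}"
    proof (rule bij_betwI[where g = "\<lambda>k. (k div b, k mod b)"])
      show "(\<lambda>(i, j). i * b + j) \<in> {..<a} \<times> {..<b} \<rightarrow> {..<n}"
      proof
        fix t assume "t \<in> {..<a} \<times> {..<b}"
        then obtain i j where t: "t = (i, j)" and ij: "i < a" "j < b" by auto
        hence "i * b + j < Suc i * b" by (simp add: add.commute)
        also have "\<dots> \<le> a * b" using ij mult_le_mono1[of "Suc i" a b] by (simp del: mult_Suc)
        finally show "(case t of (i, j) \<Rightarrow> i * b + j) \<in> {..<n}" by (simp add: n_def t)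
      qed
      show "(\<lambda>k. (k div b, k mod b)) \<in> {..<n} \<rightarrow> {..<a} \<times> {..<b}"
        using b(1) by (auto simp: n_def less_mult_imp_div_less)
    next
      fix ij assume "ij \<in> {..<a} \<times> {..<b}"
      thus "((case ij of (i, j) \<Rightarrow> i * b + j) div b, (case ij of (i, j) \<Rightarrow> i * b + j) mod b) = ij"
        by auto
    next
      fix k
      show "(case (k div b, k mod b) of (i, j) \<Rightarrow> i * b + j) = k" by simp
    qed
    have "(\<Sum>k<n. of_int (f (k div b) (k mod b)) * v k)
        = (\<Sum>ij\<in>{..<a} \<times> {..<b}. of_int (f (fst ij) (snd ij)) * x ^ fst ij * y ^ snd ij)"
    proof (subst sum.reindex_bij_betw[OF bij, of "\<lambda>k. of_int (f (k div b) (k mod b)) * v k", symmetric],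
        rule sum.cong[OF refl])
      fix ij assume "ij \<in> {..<a} \<times> {..<b}"
      then obtain i j where ij: "ij = (i, j)" "j < b" by auto
      hence "(i * b + j) div b = i" "(i * b + j) mod b = j" by auto
      thus "complex_of_int (f ((case ij of (i, j) \<Rightarrow> i * b + j) div b) ((case ij of (i, j) \<Rightarrow> i * b + j) mod b)) *
          v (case ij of (i, j) \<Rightarrow> i * b + j) = of_int (f (fst ij) (snd ij)) * x ^ fst ij * y ^ snd ij"
        by (simp add: v_def ij(1))
    qed
    also have "\<dots> = (\<Sum>i<a. \<Sum>j<b. of_int (f i j) * x ^ i * y ^ j)"
      by (simp add: sum.cartesian_product case_prod_unfold)
    finally show ?thesis .
  qed
  have comb: "\<exists>A. t = (\<Sum>k<n. of_int (A k) * v k)"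
    if "t = (\<Sum>i<a. \<Sum>j<b. of_int (f i j) * x ^ i * y ^ j)" for t and f :: "nat \<Rightarrow> nat \<Rightarrow> int"
    using sumv[of f] that by metis
  have row: "(\<Sum>i<a. \<Sum>j<b. of_int (if i = I then h j else 0) * x ^ i * y ^ j)
      = (\<Sum>j<b. of_int (h j) * x ^ I * y ^ j)" if "I < a" for I and h :: "nat \<Rightarrow> int"
  proof -
    have "(\<Sum>i<a. \<Sum>j<b. of_int (if i = I then h j else 0) * x ^ i * y ^ j)
        = (\<Sum>i<a. if i = I then \<Sum>j<b. of_int (h j) * x ^ i * y ^ j else 0)"
      by (rule sum.cong) auto
    thus ?thesis using that by simp
  qed
  have single: "(\<Sum>j<b. of_int (if j = J then m else 0) * t * y ^ j) = of_int m * t * y ^ J"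
    if "J < b" for J and m :: int and t
  proof -
    have "(\<Sum>j<b. of_int (if j = J then m else 0) * t * y ^ j)
        = (\<Sum>j<b. if j = J then of_int m * t * y ^ j else 0)"
      by (rule sum.cong) auto
    thus ?thesis using that by simp
  qed
  show ?thesis
  proof (rule that[of n v])
    show "n > 0" "v 0 = 1" using a(1) b(1) by (auto simp: n_def v_def)
    fix k assume "k < n"
    hence k: "k div b < a" "k mod b < b"
      using b(1) by (auto simp: n_def less_mult_imp_div_less)
    let ?i = "k div b" and ?j = "k mod b"
    show "\<exists>A. x * v k = (\<Sum>j<n. of_int (A j) * v j)"
    proof (cases "Suc ?i < a")
      case True
      show ?thesis
        by (rule comb[of _ "\<lambda>i j. if i = Suc ?i then (if j = ?j then 1 else 0) else 0"],
            subst row[OF True], subst single[OF k(2)]) (simp add: v_def)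
    next
      \<comment> \<open>The exponent of \<open>x\<close> would reach \<open>a\<close>; the monic
        relation for \<open>x ^ a\<close> brings it back below \<open>a\<close>.\<close>
      case False
      hence "Suc ?i = a" using k by simp
      moreover have "x * v k = x ^ Suc ?i * y ^ ?j" by (simp add: v_def)
      ultimately have "x * v k = (\<Sum>i<a. of_int (c i) * x ^ i) * y ^ ?j" using a by metis
      also have "\<dots> = (\<Sum>i<a. \<Sum>j<b. of_int (if j = ?j then c i else 0) * x ^ i * y ^ j)"
        by (subst single[OF k(2)]) (rule sum_distrib_right)
      finally show ?thesis by (rule comb)
    qed
    show "\<exists>A. y * v k = (\<Sum>j<n. of_int (A j) * v j)"
    proof (cases "Suc ?j < b")
      case True
      show ?thesis
        by (rule comb[of _ "\<lambda>i j. if i = ?i then (if j = Suc ?j then 1 else 0) else 0"],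
            subst row[OF k(1)], subst single[OF True]) (simp add: v_def)
    next
      case False
      hence "Suc ?j = b" using k by simp
      moreover have "y * v k = x ^ ?i * y ^ Suc ?j" by (simp add: v_def)
      ultimately have "y * v k = x ^ ?i * (\<Sum>j<b. of_int (d j) * y ^ j)" using b by metis
      also have "\<dots> = (\<Sum>j<b. of_int (d j) * x ^ ?i * y ^ j)"
        by (simp add: sum_distrib_left mult_ac)
      also have "\<dots> = (\<Sum>i<a. \<Sum>j<b. of_int (if i = ?i then d j else 0) * x ^ i * y ^ j)"
        by (rule row[OF k(1), symmetric])
      finally show ?thesis by (rule comb)
    qed
  qed
qed

text \<open>On the common lattice the sum acts by the sum of the two integer matrices, and
  \<open>v 0 = 1\<close> shows that the eigenvector is nonzero.\<close>

lemma algebraic_int_plus: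
  fixes x y :: complex
  assumes "algebraic_int x" "algebraic_int y"
  shows "algebraic_int (x + y)"
proof -
  obtain n :: nat and v where v: "n > 0" "v 0 = 1"
    "\<And>i. i < n \<Longrightarrow> \<exists>A. x * v i = (\<Sum>j<n. of_int (A j) * v j)"
    "\<And>i. i < n \<Longrightarrow> \<exists>A. y * v i = (\<Sum>j<n. of_int (A j) * v j)"
    by (rule algebraic_int_lattice[OF assms]) blast
  from v(3,4) obtain A B where "\<And>i. i < n \<Longrightarrow> x * v i = (\<Sum>j<n. of_int (A i j) * v j)"
    "\<And>i. i < n \<Longrightarrow> y * v i = (\<Sum>j<n. of_int (B i j) * v j)" by metis
  hence "(x + y) * v i = (\<Sum>j<n. of_int (A i j + B i j) * v j)" if "i < n" for i
    using that by (simp add: distrib_right sum.distrib)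
  from algebraic_int_of_eigenvector[OF this, of 0] v show ?thesis by simp
qed

text \<open>On the common lattice the product acts by the product of the two integer
  matrices.\<close>

lemma algebraic_int_times:
  fixes x y :: complex
  assumes "algebraic_int x" "algebraic_int y"
  shows "algebraic_int (x * y)"
proof -
  obtain n :: nat and v where v: "n > 0" "v 0 = 1"
    "\<And>i. i < n \<Longrightarrow> \<exists>A. x * v i = (\<Sum>j<n. of_int (A j) * v j)"
    "\<And>i. i < n \<Longrightarrow> \<exists>A. y * v i = (\<Sum>j<n. of_int (A j) * v j)"
    by (rule algebraic_int_lattice[OF assms]) blast
  from v(3,4) obtain A B where A: "\<And>i. i < n \<Longrightarrow> x * v i = (\<Sum>j<n. of_int (A i j) * v j)"
    and B: "\<And>i. i < n \<Longrightarrow> y * v i = (\<Sum>j<n. of_int (B i j) * v j)" by metis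
  have "(x * y) * v i = (\<Sum>j<n. of_int (\<Sum>k<n. B i k * A k j) * v j)" if "i < n" for i
  proof -
    have "(x * y) * v i = x * (\<Sum>k<n. of_int (B i k) * v k)" using B[OF that] by (simp add: mult_ac)
    also have "\<dots> = (\<Sum>k<n. of_int (B i k) * (x * v k))" by (simp add: sum_distrib_left mult_ac)
    also have "\<dots> = (\<Sum>k<n. \<Sum>j<n. of_int (B i k) * of_int (A k j) * v j)"
      by (simp add: A sum_distrib_left mult_ac)
    also have "\<dots> = (\<Sum>j<n. \<Sum>k<n. of_int (B i k) * of_int (A k j) * v j)" by (rule sum.swap)
    finally show ?thesis by (simp add: sum_distrib_right)
  qed
  from algebraic_int_of_eigenvector[OF this, of 0] v show ?thesis by simp
qed

lemma algebraic_int_power: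
  fixes x :: complex
  assumes "algebraic_int x"
  shows "algebraic_int (x ^ n)"
proof (induction n)
  case (Suc n)
  show ?case unfolding power_Suc by (rule algebraic_int_times[OF assms Suc])
qed simp

text \<open>Substituting X^n into a monic equation of \<open>x ^ n\<close> gives a monic equation of
  \<open>x\<close>. All radicals of units owe their integrality to this.\<close>

lemma algebraic_int_of_power:
  fixes x :: complex
  assumes "algebraic_int (x ^ n)" "n > 0"
  shows "algebraic_int x"
  by (rule algebraic_int_root[OF assms(1), where p = "Polynomial.monom 1 n"])
    (use assms(2) in \<open>auto simp: poly_monom degree_monom_eq\<close>)

section \<open>Quadratic extensions, homomorphisms and ramification\<close>

context
  fixes F :: "complex set"
  assumes F: "is_subfield F"
begin

lemma subfield_0: "0 \<in> F" and subfield_1: "1 \<in> F"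
  and subfield_add: "x \<in> F \<Longrightarrow> y \<in> F \<Longrightarrow> x + y \<in> F"
  and subfield_mult: "x \<in> F \<Longrightarrow> y \<in> F \<Longrightarrow> x * y \<in> F"
  and subfield_minus: "x \<in> F \<Longrightarrow> - x \<in> F"
  and subfield_inverse: "x \<in> F \<Longrightarrow> inverse x \<in> F"
  using F by (auto simp: is_subfield_def)

lemma subfield_diff: "x \<in> F \<Longrightarrow> y \<in> F \<Longrightarrow> x - y \<in> F"
  using subfield_add[of x "- y"] subfield_minus by simp

lemma subfield_divide: "x \<in> F \<Longrightarrow> y \<in> F \<Longrightarrow> x / y \<in> F"
  by (simp add: field_class.field_divide_inverse subfield_mult subfield_inverse)

lemma subfield_power: "x \<in> F \<Longrightarrow> x ^ n \<in> F"
  by (induction n) (auto intro: subfield_1 subfield_mult)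

lemma subfield_powi: "x \<in> F \<Longrightarrow> x powi k \<in> F"
  by (auto simp: power_int_def intro: subfield_power subfield_inverse)

lemma subfield_of_nat: "of_nat n \<in> F"
  by (induction n) (auto intro: subfield_0 subfield_1 subfield_add)

lemma subfield_of_int: "of_int n \<in> F"
  by (cases n rule: int_cases2) (auto intro: subfield_of_nat subfield_minus)

lemma subfield_numeral: "numeral n \<in> F"
  using subfield_of_nat[of "numeral n"] by simp

lemma subfield_Rats: "x \<in> \<rat> \<Longrightarrow> x \<in> F"
  by (auto elim!: Rats_cases' intro: subfield_divide subfield_of_int)

lemmas subfield_closed = subfield_0 subfield_1 subfield_add subfield_mult subfield_minus
  subfield_inverse subfield_diff subfield_divide subfield_power subfield_powi
  subfield_of_int subfield_numeral

end

lemma is_subfield_Rats: "is_subfield \<rat>"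
  by (auto simp: is_subfield_def)

lemma is_subfield_gen_field: "is_subfield (gen_field S)"
  unfolding gen_field_def is_subfield_def by auto

lemma gen_field_superset: "S \<subseteq> gen_field S"
  unfolding gen_field_def by auto

lemma gen_field_least: "is_subfield F \<Longrightarrow> S \<subseteq> F \<Longrightarrow> gen_field S \<subseteq> F"
  unfolding gen_field_def by auto

lemma gen_field_empty: "gen_field {} = \<rat>"
  using gen_field_least[OF is_subfield_Rats, of "{}"]
    subfield_Rats[OF is_subfield_gen_field, of _ "{}"] by auto

section \<open>Quadratic extensions and embeddings\<close>

definition qadj :: "complex set \<Rightarrow> complex \<Rightarrow> complex set" where
  "qadj F s = {a + b * s | a b. a \<in> F \<and> b \<in> F}"

lemma qadjI: "a \<in> F \<Longrightarrow> b \<in> F \<Longrightarrow> a + b * s \<in> qadj F s"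
  unfolding qadj_def by blast

lemma qadjE:
  assumes "x \<in> qadj F s"
  obtains a b where "a \<in> F" "b \<in> F" "x = a + b * s"
  using assms unfolding qadj_def by blast

text \<open>A field embedding is a total function about which nothing is said outside
  \<open>F\<close>; \<open>f 1 = 1\<close> excludes the zero map, and injectivity on
  \<open>F\<close> follows.\<close>

definition hom_on :: "complex set \<Rightarrow> (complex \<Rightarrow> complex) \<Rightarrow> bool" where
  "hom_on F f \<longleftrightarrow> f 1 = 1 \<and> (\<forall>x\<in>F. \<forall>y\<in>F. f (x + y) = f x + f y \<and> f (x * y) = f x * f y)"

lemma hom_on_id: "hom_on F (\<lambda>x. x)"
  by (simp add: hom_on_def)

lemma hom_on_cnj: "hom_on F cnj"
  by (simp add: hom_on_def)

lemma hom_on_comp: "hom_on F f \<Longrightarrow> hom_on F g \<Longrightarrow> f ` F \<subseteq> F \<Longrightarrow> hom_on F (\<lambda>x. g (f x))"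
  unfolding hom_on_def by (metis (no_types, lifting) image_subset_iff)

context
  fixes F :: "complex set" and f :: "complex \<Rightarrow> complex"
  assumes F: "is_subfield F" and f: "hom_on F f"
begin

lemma hom_1: "f 1 = 1"
  and hom_add: "x \<in> F \<Longrightarrow> y \<in> F \<Longrightarrow> f (x + y) = f x + f y"
  and hom_mult: "x \<in> F \<Longrightarrow> y \<in> F \<Longrightarrow> f (x * y) = f x * f y"
  using f by (auto simp: hom_on_def)

lemma hom_0: "f 0 = 0"
  using hom_add[of 0 0] subfield_0[OF F] by simp

lemma hom_minus: "x \<in> F \<Longrightarrow> f (- x) = - f x"
  using hom_add[of x "- x"] subfield_minus[OF F] hom_0 by (simp add: add_eq_0_iff)

lemma hom_diff: "x \<in> F \<Longrightarrow> y \<in> F \<Longrightarrow> f (x - y) = f x - f y"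
  using hom_add[of x "- y"] hom_minus[of y] subfield_minus[OF F] by simp

lemma hom_inverse: "x \<in> F \<Longrightarrow> f (inverse x) = inverse (f x)"
proof (cases "x = 0")
  case False
  assume "x \<in> F"
  hence "f x * f (inverse x) = 1"
    using hom_mult[of x "inverse x"] subfield_inverse[OF F] hom_1 False by simp
  thus ?thesis by (metis inverse_unique)
qed (simp add: hom_0)

lemma hom_divide: "x \<in> F \<Longrightarrow> y \<in> F \<Longrightarrow> f (x / y) = f x / f y"
  by (simp add: field_class.field_divide_inverse hom_mult hom_inverse subfield_inverse[OF F])

lemma hom_power: "x \<in> F \<Longrightarrow> f (x ^ n) = f x ^ n"
  by (induction n) (auto simp: hom_1 hom_mult subfield_power[OF F])

lemma hom_powi: "x \<in> F \<Longrightarrow> f (x powi k) = f x powi k"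
  by (auto simp: power_int_def hom_power hom_inverse subfield_power[OF F] subfield_inverse[OF F])

lemma hom_of_nat: "f (of_nat n) = of_nat n"
  by (induction n) (auto simp: hom_0 hom_1 hom_add subfield_1[OF F] subfield_of_nat[OF F])

lemma hom_of_int: "f (of_int n) = of_int n"
  by (cases n rule: int_cases2)
    (auto simp: hom_of_nat hom_minus subfield_of_nat[OF F])

lemma hom_numeral: "f (numeral n) = numeral n"
  using hom_of_nat[of "numeral n"] by simp

lemma hom_Rats: "x \<in> \<rat> \<Longrightarrow> f x = x"
  by (auto elim!: Rats_cases' simp: hom_divide hom_of_int subfield_of_int[OF F])

lemma hom_eq_0_iff: "x \<in> F \<Longrightarrow> f x = 0 \<longleftrightarrow> x = 0"
proof -
  assume x: "x \<in> F"
  have "f x \<noteq> 0" if "x \<noteq> 0"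
    using hom_mult[OF x subfield_inverse[OF F x]] hom_1 that by auto
  thus ?thesis using hom_0 by auto
qed

text \<open>Embeddings fix the integers, so they send a root of an integral polynomial to a root of
  the same polynomial.\<close>

lemma hom_algebraic_int:
  assumes x: "x \<in> F" "algebraic_int x"
  shows "algebraic_int (f x)"
proof -
  obtain p where p: "poly (map_poly of_int p) x = 0" "lead_coeff p = 1"
    using x(2) unfolding algebraic_int_altdef_ipoly by blast
  have "poly (map_poly of_int r) x \<in> F \<and>
      f (poly (map_poly of_int r) x) = poly (map_poly of_int r) (f x)" for r
    by (induction r)
      (auto simp: map_poly_pCons of_int_hom.map_poly_pCons_hom hom_0 hom_add hom_mult hom_of_int x
        subfield_0[OF F] subfield_add[OF F] subfield_mult[OF F] subfield_of_int[OF F])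
  from this[of p] p show ?thesis
    unfolding algebraic_int_altdef_ipoly by (metis hom_0)
qed

lemmas hom_simps = hom_0 hom_1 hom_add hom_mult hom_minus hom_diff hom_inverse hom_divide
  hom_power hom_powi hom_of_int hom_numeral

end

context
  fixes F :: "complex set" and s :: complex
  assumes F: "is_subfield F" and s: "s \<notin> F" "s ^ 2 \<in> F"
begin

lemma qadj_unique:
  assumes "a \<in> F" "b \<in> F" "c \<in> F" "d \<in> F" "a + b * s = c + d * s"
  shows "a = c \<and> b = d"
proof (rule ccontr)
  assume *: "\<not> (a = c \<and> b = d)"
  have eq: "(b - d) * s = c - a" using assms(5) by (simp add: algebra_simps)
  hence "b \<noteq> d" using * by auto
  hence "s = (c - a) / (b - d)" using eq by (simp add: field_simps)
  thus False using s(1) assms by (metis subfield_diff[OF F] subfield_divide[OF F])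
qed

lemma qadj_superset: "F \<subseteq> qadj F s"
  using qadjI[of _ F 0 s] subfield_0[OF F] by auto

lemma qadj_self: "s \<in> qadj F s"
  using qadjI[of 0 F 1 s] subfield_0[OF F] subfield_1[OF F] by auto

lemma is_subfield_qadj: "is_subfield (qadj F s)"
proof -
  note cl = subfield_closed[OF F]
  have mult: "x * y \<in> qadj F s" if "x \<in> qadj F s" "y \<in> qadj F s" for x y
  proof -
    from that obtain a b c d where *: "a \<in> F" "b \<in> F" "x = a + b * s" "c \<in> F" "d \<in> F" "y = c + d * s"
      by (auto elim!: qadjE)
    have "x * y = (a * c + b * d * s ^ 2) + (a * d + b * c) * s"
      unfolding * by (simp add: algebra_simps power2_eq_square)
    thus ?thesis using * s(2) by (metis cl(3,4) qadjI)
  qed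
  have inv: "inverse x \<in> qadj F s" if "x \<in> qadj F s" for x
  proof (cases "x = 0")
    case False
    from that obtain a b where *: "a \<in> F" "b \<in> F" "x = a + b * s" by (auto elim!: qadjE)
    \<comment> \<open>The inverse is found by rationalising with the conjugate, which cannot vanish
      because coordinates are unique.\<close>
    have "a - b * s \<noteq> 0"
    proof
      assume eq: "a - b * s = 0"
      hence "a + 0 * s = 0 + b * s" by simp
      from qadj_unique[OF *(1) cl(1) cl(1) *(2) this] False * show False by simp
    qed
    hence "inverse x = (a - b * s) / ((a + b * s) * (a - b * s))"
      using False by (simp add: *(3) inverse_eq_divide)
    also have "(a + b * s) * (a - b * s) = a ^ 2 - b ^ 2 * s ^ 2"
      by (simp add: algebra_simps power2_eq_square)
    also have "(a - b * s) / (a ^ 2 - b ^ 2 * s ^ 2)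
        = a / (a ^ 2 - b ^ 2 * s ^ 2) + (- b / (a ^ 2 - b ^ 2 * s ^ 2)) * s"
      by (simp add: diff_divide_distrib)
    finally have "inverse x = a / (a ^ 2 - b ^ 2 * s ^ 2) + (- b / (a ^ 2 - b ^ 2 * s ^ 2)) * s" .
    thus ?thesis using * s(2) by (metis qadjI cl(4,5,7,8,9))
  qed (use qadj_superset cl(1) in auto)
  have add: "x + y \<in> qadj F s" if "x \<in> qadj F s" "y \<in> qadj F s" for x y
  proof -
    from that obtain a b c d where *: "a \<in> F" "b \<in> F" "x = a + b * s" "c \<in> F" "d \<in> F" "y = c + d * s"
      by (auto elim!: qadjE)
    have "x + y = (a + c) + (b + d) * s"
      unfolding * by (simp add: algebra_simps)
    thus ?thesis using * by (metis cl(3) qadjI)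
  qed
  have minus: "- x \<in> qadj F s" if "x \<in> qadj F s" for x
  proof -
    from that obtain a b where *: "a \<in> F" "b \<in> F" "x = a + b * s" by (auto elim!: qadjE)
    hence "- x = (- a) + (- b) * s" by simp
    thus ?thesis using * by (metis cl(5) qadjI)
  qed
  have "0 \<in> qadj F s" "1 \<in> qadj F s"
    using qadj_superset cl(1,2) by auto
  thus ?thesis by (simp add: is_subfield_def mult inv add minus)
qed

lemma gen_field_insert:
  assumes "gen_field S = F"
  shows "gen_field (insert s S) = qadj F s"
proof
  show "gen_field (insert s S) \<subseteq> qadj F s"
    using gen_field_superset[of S] assms qadj_superset qadj_self
    by (intro gen_field_least is_subfield_qadj) auto
  have "F \<subseteq> gen_field (insert s S)"
    unfolding assms[symmetric] using gen_field_superset[of "insert s S"]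
    by (intro gen_field_least is_subfield_gen_field) auto
  thus "qadj F s \<subseteq> gen_field (insert s S)"
    using gen_field_superset[of "insert s S"]
    by (auto elim!: qadjE intro!: subfield_add[OF is_subfield_gen_field] subfield_mult[OF is_subfield_gen_field])
qed

text \<open>The map \<open>a + b * s\<close> to \<open>f a + f b * t\<close> respects products
  exactly because \<open>t ^ 2\<close> is the image of \<open>s ^ 2\<close>. Choosing
  \<open>t\<close> as \<open>s\<close> or \<open>- s\<close> produces all automorphisms used
  later.\<close>

lemma hom_extend:
  assumes f: "hom_on F f" and t: "t ^ 2 = f (s ^ 2)"
  obtains g where "hom_on (qadj F s) g" "\<And>x. x \<in> F \<Longrightarrow> g x = f x" "g s = t"
proof -
  note cl = subfield_closed[OF F]
  \<comment> \<open>The choice operator only reads off the coordinates, which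
    \<open>qadj_unique\<close> shows to be determined.\<close>
  define g where "g = (\<lambda>x. let ab = SOME ab. fst ab \<in> F \<and> snd ab \<in> F \<and> x = fst ab + snd ab * s
                          in f (fst ab) + f (snd ab) * t)"
  have g: "g (a + b * s) = f a + f b * t" if ab: "a \<in> F" "b \<in> F" for a b
  proof -
    let ?P = "\<lambda>ab. fst ab \<in> F \<and> snd ab \<in> F \<and> a + b * s = fst ab + snd ab * s"
    have "?P (SOME ab. ?P ab)" by (rule someI[of ?P "(a, b)"]) (use ab in simp)
    then obtain c d where cd: "(SOME ab. ?P ab) = (c, d)" "c \<in> F" "d \<in> F" "a + b * s = c + d * s"
      by (cases "SOME ab. ?P ab") auto
    with qadj_unique[OF ab cd(2,3,4)] show ?thesis by (simp add: g_def)
  qed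
  have f0: "f 0 = 0" and f1: "f 1 = 1" using hom_0[OF F f] hom_1[OF F f] by auto
  have "g x = f x" if "x \<in> F" for x using g[OF that cl(1)] f0 by simp
  moreover have "g s = t" using g[OF cl(1,2)] f0 f1 by simp
  moreover have "hom_on (qadj F s) g"
    unfolding hom_on_def
  proof (intro conjI ballI)
    show "g 1 = 1" using g[OF cl(2,1)] f0 f1 by simp
    fix x y assume "x \<in> qadj F s" "y \<in> qadj F s"
    then obtain a b c d where *: "a \<in> F" "b \<in> F" "x = a + b * s" "c \<in> F" "d \<in> F" "y = c + d * s"
      by (auto elim!: qadjE)
    have "x + y = (a + c) + (b + d) * s"
      unfolding * by (simp add: algebra_simps)
    moreover have "g ((a + c) + (b + d) * s) = f (a + c) + f (b + d) * t" using * by (intro g cl(3))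
    ultimately show "g (x + y) = g x + g y"
      using * by (simp add: g hom_add[OF F f] algebra_simps)
    have "x * y = (a * c + b * d * s ^ 2) + (a * d + b * c) * s"
      unfolding * by (simp add: algebra_simps power2_eq_square)
    moreover have "g ((a * c + b * d * s ^ 2) + (a * d + b * c) * s)
       = f (a * c + b * d * s ^ 2) + f (a * d + b * c) * t" using * s(2) by (intro g cl(3,4))
    moreover have "f (a * c + b * d * s ^ 2) = f a * f c + f b * f d * t ^ 2"
      "f (a * d + b * c) = f a * f d + f b * f c"
      using * s(2) by (simp_all add: t hom_add[OF F f] hom_mult[OF F f] cl)
    ultimately show "g (x * y) = g x * g y"
      using * by (simp add: g algebra_simps power2_eq_square)
  qed
  ultimately show ?thesis by (intro that)
qed

end

section \<open>Ramification expressed by bounded denominators\<close>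

text \<open>An integral element whose square is divisible by a prime \<open>l\<close> is itself divisible by \<open>l\<close>
  up to the bounded denominator \<open>N\<close>; this says that the primes not dividing \<open>N\<close> do not ramify.\<close>

definition unram_outside :: "complex set \<Rightarrow> int \<Rightarrow> bool" where
  "unram_outside F N \<longleftrightarrow> (\<forall>l w. prime l \<and> w \<in> F \<and> algebraic_int (w ^ 2 / of_int l)
      \<longrightarrow> algebraic_int (of_int N * w / of_int l))"

lemma unram_outside_Rats: "unram_outside \<rat> 1"
  unfolding unram_outside_def
proof clarify
  fix l :: int and w :: complex
  assume l: "prime l" and w: "w \<in> \<rat>" and a: "algebraic_int (w ^ 2 / of_int l)"
  have l0: "l \<noteq> 0" using l by auto
  have "w ^ 2 / of_int l \<in> \<int>"
    using w by (intro rational_algebraic_int_is_int[OF a]) auto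
  then obtain k where k: "w ^ 2 / of_int l = of_int k" by (auto elim: Ints_cases)
  hence w2: "w ^ 2 = of_int (l * k)" using l0 by (simp add: field_simps)
  hence "algebraic_int (w ^ 2)" by (simp only: algebraic_int_of_int)
  hence "algebraic_int w" by (rule algebraic_int_of_power) simp
  then obtain m where m: "w = of_int m" using rational_algebraic_int_is_int w by (auto elim!: Ints_cases)
  have "complex_of_int (m ^ 2) = of_int (l * k)" using w2 m by simp
  hence "m ^ 2 = l * k" by (simp only: of_int_eq_iff)
  hence "l dvd m" using l by (metis dvd_triv_left prime_dvd_power)
  then obtain n where "m = l * n" by auto
  hence "of_int 1 * w / of_int l = of_int n" using l0 m by simp
  thus "algebraic_int (of_int 1 * w / of_int l)" by (simp only: algebraic_int_of_int)
qed

text \<open>For w = a + b s with conjugate w', the elements 2 a = w + w' and 2 b d = (w - w') s lie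
  in \<open>F\<close> and satisfy the same hypothesis, so the bound for \<open>F\<close> applies to
  both; recombining them costs the factor \<open>2 * d\<close>.\<close>

lemma unram_outside_qadj:
  assumes F: "is_subfield F" "unram_outside F N" and s: "s \<notin> F" "s ^ 2 = of_int d"
  shows "unram_outside (qadj F s) (2 * d * N)"
  unfolding unram_outside_def
proof clarify
  fix l :: int and w :: complex
  assume l: "prime l" and w: "w \<in> qadj F s" and aw: "algebraic_int (w ^ 2 / of_int l)"
  have l0: "l \<noteq> 0" using l by auto
  have s2: "s ^ 2 \<in> F" using s subfield_of_int[OF F(1)] by simp
  note Q = is_subfield_qadj[OF F(1) s(1) s2]
  obtain a b where ab: "a \<in> F" "b \<in> F" "w = a + b * s" using w by (rule qadjE)
  obtain g where g: "hom_on (qadj F s) g" "\<And>x. x \<in> F \<Longrightarrow> g x = x" "g s = - s"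
    using hom_extend[OF F(1) s(1) s2 hom_on_id, of "- s"] by auto
  note inF = subsetD[OF qadj_superset[OF F(1) s(1) s2]] qadj_self[OF F(1) s(1) s2]
  define w' where "w' = a - b * s"
  have "g w = w'"
    using ab g by (simp add: w'_def hom_add[OF Q g(1)] hom_mult[OF Q g(1)] inF subfield_mult[OF Q])
  hence "g (w ^ 2 / of_int l) = w' ^ 2 / of_int l"
    using w by (simp add: hom_divide[OF Q g(1)] hom_power[OF Q g(1)] hom_of_int[OF Q g(1)]
        subfield_power[OF Q] subfield_of_int[OF Q])
  moreover have "algebraic_int (g (w ^ 2 / of_int l))"
    using w aw by (intro hom_algebraic_int[OF Q g(1)] subfield_divide[OF Q] subfield_power[OF Q] subfield_of_int[OF Q])
  ultimately have aw': "algebraic_int (w' ^ 2 / of_int l)" by simp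
  \<comment> \<open>Dividing by a square root of \<open>l\<close> turns the condition on
    \<open>w ^ 2\<close> into integrality of \<open>w / r\<close>, a condition that is stable under
    sums.\<close>
  define r where "r = csqrt (of_int l)"
  have r2: "r ^ 2 = of_int l" by (simp add: r_def)
  have r0: "r \<noteq> 0" using l0 by (simp add: r_def)
  have awr: "algebraic_int (w / r)" "algebraic_int (w' / r)"
    using aw aw' algebraic_int_of_power[of "w / r" 2] algebraic_int_of_power[of "w' / r" 2]
    by (simp_all add: r2 power_divide)
  have as: "algebraic_int s"
    using s algebraic_int_of_power[of s 2] by simp
  have "(2 * a) ^ 2 / of_int l = (w / r + w' / r) ^ 2"
    unfolding r2[symmetric] by (simp add: ab w'_def field_simps power2_eq_square r0)
  hence "algebraic_int ((2 * a) ^ 2 / of_int l)"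
    using awr by (simp only: algebraic_int_plus algebraic_int_power)
  hence 1: "algebraic_int (of_int N * (2 * a) / of_int l)"
    using F l ab subfield_mult[OF F(1) subfield_numeral[OF F(1)]] unfolding unram_outside_def by blast
  have bd: "2 * b * of_int d = (w - w') * s"
    unfolding s(2)[symmetric] by (simp add: ab w'_def field_simps power2_eq_square)
  have "(2 * b * of_int d) ^ 2 / of_int l = ((w / r + - (w' / r)) * s) ^ 2"
    unfolding bd r2[symmetric] using r0 by (simp add: field_simps power2_eq_square)
  hence "algebraic_int ((2 * b * of_int d) ^ 2 / of_int l)"
    using awr as by (simp only: algebraic_int_plus algebraic_int_power algebraic_int_times algebraic_int_minus)
  moreover have "2 * b * of_int d \<in> F" using ab by (intro subfield_closed[OF F(1)])
  ultimately have 2: "algebraic_int (of_int N * (2 * b * of_int d) / of_int l)"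
    using F l unfolding unram_outside_def by blast
  have "of_int (2 * d * N) * w / of_int l =
    of_int d * (of_int N * (2 * a) / of_int l) + of_int N * (2 * b * of_int d) / of_int l * s"
    using l0 by (simp add: ab field_simps)
  thus "algebraic_int (of_int (2 * d * N) * w / of_int l)"
    using 1 2 as by (simp only: algebraic_int_plus algebraic_int_times algebraic_int_of_int)
qed

text \<open>With m = l k, integrality of N w / l makes N^2 c k / l a rational integer, and
  \<open>l\<close> does not divide k because \<open>m\<close> is squarefree. The number
  \<open>c\<close> measures how far \<open>u\<close> is from a unit: it is 1 for units, and 2 when
  \<open>u\<close> is only known to divide 2.\<close>

lemma unram_outside_dvd:
  assumes F: "is_subfield F" "unram_outside F N" and l: "prime l" "l dvd m" "squarefree m"
    and w: "w \<in> F" "w ^ 2 = u * of_int m"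
    and u: "u \<noteq> 0" "algebraic_int u" "algebraic_int (of_int c / u)"
  shows "l dvd N * c"
proof -
  have l0: "l \<noteq> 0" using l by auto
  obtain k where k: "m = l * k" using l(2) by auto
  have "w ^ 2 / of_int l = u * of_int k" using w k l0 by simp
  hence "algebraic_int (w ^ 2 / of_int l)" using u by (simp only: algebraic_int_times algebraic_int_of_int)
  hence "algebraic_int (of_int N * w / of_int l)" using F(2) l(1) w(1) unfolding unram_outside_def by blast
  hence "algebraic_int ((of_int N * w / of_int l) ^ 2 * (of_int c / u))"
    using u by (intro algebraic_int_times algebraic_int_power)
  also have "(of_int N * w / of_int l) ^ 2 * (of_int c / u) = of_int (N ^ 2 * c * k) / of_int l"
    using l0 u(1) by (simp add: power_mult_distrib power_divide w(2) k field_simps power2_eq_square[of "of_int l"])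
  finally have "of_int (N ^ 2 * c * k) / complex_of_int l \<in> \<int>"
    by (rule rational_algebraic_int_is_int) auto
  then obtain j where "complex_of_int (N ^ 2 * c * k) / of_int l = of_int j" by (auto elim: Ints_cases)
  hence "complex_of_int (N ^ 2 * c * k) = of_int (l * j)" using l0 by (simp add: field_simps)
  hence "l dvd N ^ 2 * c * k" by (simp only: of_int_eq_iff) simp
  moreover have "\<not> l dvd k"
  proof
    assume "l dvd k"
    hence "l ^ 2 dvd m" by (auto simp: k power2_eq_square)
    thus False using l by (meson not_prime_unit squarefreeD)
  qed
  ultimately show ?thesis using l(1) by (metis dvd_mult dvd_mult2 prime_dvd_mult_iff prime_dvd_power)
qed

text \<open>This is the case u = c = 1: a square root of \<open>m\<close> would make
  \<open>l\<close> ramify. It separates the successive steps of the multiquadratic tower.\<close>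

lemma sqrt_notin:
  assumes "is_subfield F" "unram_outside F N" "prime l" "l dvd m" "squarefree m"
    "(w :: complex) ^ 2 = of_int m" "\<not> l dvd N"
  shows "w \<notin> F"
  using unram_outside_dvd[of F N l m w "1::complex" "1::int"] assms by auto

lemma sqrt_in_subfield:
  fixes m :: int
  assumes F: "is_subfield F" and "m > 0" "\<And>l. prime l \<Longrightarrow> l dvd m \<Longrightarrow> of_real (sqrt (of_int l)) \<in> F"
  shows "complex_of_real (sqrt (of_int m)) \<in> F"
  using assms(2,3)
proof (induction m rule: prime_divisors_induct)
  case (unit x)
  hence "x = 1" by (metis zdvd1_eq abs_of_pos)
  thus ?case by (simp add: subfield_1[OF F])
next
  case (factor l x)
  have l: "l > 0" using factor(1) by (rule prime_gt_0_int)
  hence "x > 0" using factor(3) by (simp add: zero_less_mult_iff)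
  hence x: "complex_of_real (sqrt (of_int x)) \<in> F"
    by (rule factor(2)) (rule factor(4), assumption, rule dvd_mult)
  have l: "complex_of_real (sqrt (of_int l)) \<in> F"
    by (rule factor(4)[OF factor(1)]) simp
  show ?case using subfield_mult[OF F l x] by (simp add: real_sqrt_mult)
qed simp

section \<open>Units of real quadratic fields\<close>

text \<open>Infinitely many good rational approximations h / k have bounded norms h^2 - d k^2. By
  the pigeonhole principle two of them share the norm n and the residues modulo n, and their
  quotient is integral of norm 1.\<close>

lemma pell_exists:
  fixes d :: int
  assumes irr: "sqrt (of_int d) \<notin> \<rat>" and d: "d > 0"
  obtains x y :: int where "y \<noteq> 0" "x ^ 2 - d * y ^ 2 = 1"
proof -
  define \<theta> where "\<theta> = sqrt (of_int d)"
  have \<theta>2: "\<theta> ^ 2 = of_int d" and \<theta>0: "\<theta> > 0" using d by (simp_all add: \<theta>_def)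
  define A where "A = approx_set \<theta>"
  have inf: "infinite A" using irr rational_iff_finite_approx_set by (auto simp: A_def \<theta>_def)
  define M where "M = \<lceil>2 * \<theta> + 1\<rceil>"
  \<comment> \<open>The pigeonhole key: the norm together with both coordinates modulo that
    norm.\<close>
  define f where "f = (\<lambda>(h, k). let n = h ^ 2 - d * k ^ 2 in (n, h mod n, k mod n))"
  have norm_bound: "\<bar>h ^ 2 - d * k ^ 2\<bar> \<le> M" and norm_nz: "h ^ 2 - d * k ^ 2 \<noteq> 0" if "(h, k) \<in> A" for h k
  proof -
    from that have k: "k > 0" and lt: "\<bar>\<theta> - of_int h / of_int k\<bar> < 1 / (of_int k) ^ 2"
      by (auto simp: A_def approx_set_def)
    define e where "e = \<theta> * of_int k - of_int h"
    have "\<bar>\<theta> - of_int h / of_int k\<bar> = \<bar>e\<bar> / of_int k"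
      using k by (simp add: e_def field_simps abs_divide)
    hence "\<bar>e\<bar> / of_int k < 1 / (of_int k) ^ 2" using lt by simp
    hence e: "\<bar>e\<bar> * of_int k < 1" using k by (simp add: field_simps power2_eq_square)
    have "1 * 1 \<le> real_of_int k * real_of_int k" using k by (intro mult_mono) auto
    have "\<bar>e\<bar> * 1 \<le> \<bar>e\<bar> * of_int k" using k by (intro mult_left_mono) auto
    hence e1: "\<bar>e\<bar> < 1" using e by simp
    have tri: "\<bar>e - 2 * \<theta> * of_int k\<bar> \<le> \<bar>e\<bar> + 2 * \<theta> * of_int k"
      using abs_triangle_ineq4[of e "2 * \<theta> * of_int k"] k \<theta>0 by (simp add: abs_mult)
    have "of_int (h ^ 2 - d * k ^ 2) = e * (e - 2 * \<theta> * of_int k)"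
      by (simp add: e_def \<theta>2[symmetric] algebra_simps power2_eq_square)
    hence "\<bar>of_int (h ^ 2 - d * k ^ 2)\<bar> = \<bar>e\<bar> * \<bar>e - 2 * \<theta> * of_int k\<bar>" by (simp add: abs_mult)
    also have "\<dots> \<le> \<bar>e\<bar> * (\<bar>e\<bar> + 2 * \<theta> * of_int k)" by (rule mult_left_mono[OF tri]) simp
    also have "\<dots> = \<bar>e\<bar> * \<bar>e\<bar> + 2 * \<theta> * (\<bar>e\<bar> * of_int k)" by (simp add: algebra_simps)
    also have "\<dots> \<le> 1 * 1 + 2 * \<theta> * 1"
      using e e1 \<theta>0 by (intro add_mono mult_mono mult_left_mono) auto
    finally have "of_int \<bar>h ^ 2 - d * k ^ 2\<bar> \<le> 2 * \<theta> + 1" by simp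
    thus "\<bar>h ^ 2 - d * k ^ 2\<bar> \<le> M" unfolding M_def by linarith
    show "h ^ 2 - d * k ^ 2 \<noteq> 0"
    proof
      assume "h ^ 2 - d * k ^ 2 = 0"
      hence "(of_int h) ^ 2 = (\<theta> * of_int k) ^ 2"
        unfolding power_mult_distrib \<theta>2 by (metis eq_iff_diff_eq_0 of_int_mult of_int_power)
      hence "of_int h = \<theta> * of_int k \<or> of_int h = - (\<theta> * of_int k)" by (simp add: power2_eq_iff)
      hence "\<theta> = of_int h / of_int k \<or> \<theta> = - (of_int h / of_int k)" using k by (auto simp: field_simps)
      thus False using irr unfolding \<theta>_def[symmetric] by auto
    qed
  qed
  have "f ` A \<subseteq> {-M..M} \<times> {-M..M} \<times> {-M..M}"
  proof (rule image_subsetI)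
    fix x assume "x \<in> A"
    then obtain h k where x: "x = (h, k)" and hk: "(h, k) \<in> A" by (cases x) auto
    let ?n = "h ^ 2 - d * k ^ 2"
    have "\<bar>h mod ?n\<bar> \<le> \<bar>?n\<bar>" "\<bar>k mod ?n\<bar> \<le> \<bar>?n\<bar>"
      using norm_nz[OF hk] by (simp_all add: abs_mod_less order_less_imp_le)
    thus "f x \<in> {-M..M} \<times> {-M..M} \<times> {-M..M}"
      using norm_bound[OF hk] by (auto simp: f_def Let_def x)
  qed
  hence "finite (f ` A)" by (rule finite_subset) auto
  then obtain a where a: "a \<in> A" "infinite {b \<in> A. f b = f a}"
    using pigeonhole_infinite[OF inf] by blast
  have "infinite ({b \<in> A. f b = f a} - {a})" using a(2) by simp
  then obtain b where "b \<in> {b \<in> A. f b = f a} - {a}" using infinite_imp_nonempty by blast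
  hence b: "b \<in> A" "f b = f a" "b \<noteq> a" by auto
  obtain h1 k1 h2 k2 where hk: "a = (h1, k1)" "b = (h2, k2)" by (metis surj_pair)
  define n where "n = h1 ^ 2 - d * k1 ^ 2"
  have n0: "n \<noteq> 0" using norm_nz[of h1 k1] a(1) by (simp add: hk n_def)
  have n2: "h2 ^ 2 - d * k2 ^ 2 = n" and cong: "h1 mod n = h2 mod n" "k1 mod n = k2 mod n"
    using b(2) by (auto simp: f_def Let_def hk n_def)
  have cong': "[h1 = h2] (mod n)" "[k1 = k2] (mod n)" using cong by (auto simp: cong_def)
  \<comment> \<open>The solution consists of the coordinates of (h1 - k1 \<theta>) (h2 + k2
    \<theta>) / n; the congruences modulo n make them integers.\<close>
  have "[h1 * h2 - d * (k1 * k2) = h1 * h1 - d * (k1 * k1)] (mod n)"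
    using cong' by (intro cong_diff cong_mult cong_refl) (auto intro: cong_sym)
  moreover have "h1 * h1 - d * (k1 * k1) = n" by (simp add: n_def power2_eq_square)
  ultimately have "n dvd h1 * h2 - d * (k1 * k2)" by (simp add: cong_def dvd_eq_mod_eq_0)
  then obtain x where x: "h1 * h2 - d * (k1 * k2) = n * x" by auto
  have "[h1 * k2 - h2 * k1 = h2 * k1 - h2 * k1] (mod n)"
    using cong' by (intro cong_diff cong_mult cong_refl) (auto intro: cong_sym)
  hence "n dvd h1 * k2 - h2 * k1" by (simp add: cong_0_iff)
  then obtain y where y: "h1 * k2 - h2 * k1 = n * y" by auto
  have "n ^ 2 * (x ^ 2 - d * y ^ 2) = (n * x) ^ 2 - d * (n * y) ^ 2" by (simp add: algebra_simps)
  also have "\<dots> = (h1 ^ 2 - d * k1 ^ 2) * (h2 ^ 2 - d * k2 ^ 2)"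
    unfolding x[symmetric] y[symmetric] by (simp add: algebra_simps power2_eq_square)
  also have "\<dots> = n ^ 2 * 1" unfolding n2 n_def[symmetric] by (simp add: power2_eq_square)
  finally have 1: "x ^ 2 - d * y ^ 2 = 1" using n0 by simp
  \<comment> \<open>For y = 0 the two approximations would be the same fraction in lowest
    terms.\<close>
  have "y \<noteq> 0"
  proof
    assume "y = 0"
    hence eq: "h1 * k2 = h2 * k1" using y by simp
    have pos: "k1 > 0" "k2 > 0" and cop: "coprime h1 k1" "coprime h2 k2"
      using a(1) b(1) by (auto simp: hk A_def approx_set_def)
    have "k1 dvd k2" using eq cop(1) by (metis coprime_commute coprime_dvd_mult_right_iff dvd_triv_right)
    moreover have "k2 dvd k1" using eq cop(2) by (metis coprime_commute coprime_dvd_mult_right_iff dvd_triv_right)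
    ultimately have "k1 = k2" using pos by (simp add: zdvd_antisym_nonneg)
    thus False using eq pos b(3) hk by simp
  qed
  with 1 that show ?thesis by blast
qed

lemma squarefree_dvdI:
  fixes m n :: int
  assumes "squarefree m" "n \<noteq> 0" "\<And>l. prime l \<Longrightarrow> l dvd m \<Longrightarrow> l dvd n"
  shows "m dvd n"
proof (rule multiplicity_le_imp_dvd)
  show "m \<noteq> 0" using assms(1) by auto
  fix l :: int assume l: "prime l"
  show "multiplicity l m \<le> multiplicity l n"
  proof (cases "l dvd m")
    case True
    have "multiplicity l m \<le> 1" using assms(1) l squarefree_factorial_semiring''[OF \<open>m \<noteq> 0\<close>] by auto
    also have "1 \<le> multiplicity l n"
      using assms(2) assms(3)[OF l True] l by (intro multiplicity_geI) auto
    finally show ?thesis .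
  qed (simp add: not_dvd_imp_multiplicity_0)
qed

locale real_quadratic =
  fixes d :: int
  assumes d: "d > 1" "squarefree d"
begin

definition s :: complex where "s = of_real (sqrt (of_int d))"
definition Q :: "complex set" where "Q = gen_field {s}"

lemma s2: "s ^ 2 = of_int d"
  using d(1) by (simp add: s_def flip: of_real_power)

lemma s_irrat: "s \<notin> \<rat>"
proof -
  obtain l where "prime l" "l dvd d" using d(1) prime_divisor_exists[of d] by auto
  thus ?thesis
    using sqrt_notin[OF is_subfield_Rats unram_outside_Rats _ _ d(2) s2, of l] not_prime_unit by blast
qed

lemma s_ne_0: "s \<noteq> 0"
  using s_irrat by auto

lemma s2_Rats: "s ^ 2 \<in> \<rat>"
  by (simp add: s2)

lemma Q_eq: "Q = qadj \<rat> s"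
  unfolding Q_def by (rule gen_field_insert[OF is_subfield_Rats s_irrat s2_Rats gen_field_empty])

lemma Q: "is_subfield Q"
  unfolding Q_def by (rule is_subfield_gen_field)

lemma unram_Q: "unram_outside Q (2 * d)"
  using unram_outside_qadj[OF is_subfield_Rats unram_outside_Rats s_irrat s2] by (simp add: Q_eq)

lemma s_in: "s \<in> Q"
  unfolding Q_def using gen_field_superset by blast

text \<open>The nontrivial automorphism of Q(sqrt d); \<open>hom_extend\<close> provides only its
  existence, hence the choice.\<close>

definition cj :: "complex \<Rightarrow> complex" where
  "cj = (SOME g. hom_on Q g \<and> g s = - s)"

lemma hom_cj: "hom_on Q cj" and cj_s: "cj s = - s"
proof -
  have "\<exists>g. hom_on Q g \<and> g s = - s"
    using hom_extend[OF is_subfield_Rats s_irrat s2_Rats hom_on_id, of "- s"] unfolding Q_eq by auto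
  from someI_ex[OF this] show "hom_on Q cj" "cj s = - s" by (auto simp: cj_def)
qed

lemma cj_eq: "a \<in> \<rat> \<Longrightarrow> b \<in> \<rat> \<Longrightarrow> cj (a + b * s) = a - b * s"
  by (simp add: hom_add[OF Q hom_cj] hom_mult[OF Q hom_cj] hom_Rats[OF Q hom_cj] cj_s s_in
      subfield_Rats[OF Q] subfield_mult[OF Q])

text \<open>Trace a and norm n are rational integers, so d (2 t)^2 = a^2 - 4 n is one too. The
  squared denominator of 2 t then divides the squarefree \<open>d\<close>, so 2 t is an integer. The
  half-integral form covers all \<open>d\<close> at once; residues modulo 4 enter only through
  \<open>even_coeffs\<close>.\<close>

lemma integral_form:
  assumes "x \<in> Q" "algebraic_int x"
  obtains a b n :: int where "x = (of_int a + of_int b * s) / 2" "cj x = (of_int a - of_int b * s) / 2"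
    "a ^ 2 - d * b ^ 2 = 4 * n" "x * cj x = of_int n"
proof -
  obtain r t where rt: "r \<in> \<rat>" "t \<in> \<rat>" "x = r + t * s" using assms(1) unfolding Q_eq by (rule qadjE)
  have cx: "cj x = r - t * s" using rt cj_eq by simp
  have acx: "algebraic_int (cj x)" by (rule hom_algebraic_int[OF Q hom_cj assms])
  have "algebraic_int (x + cj x)" using assms(2) acx by (rule algebraic_int_plus)
  moreover have "x + cj x = 2 * r" unfolding cx unfolding rt(3) by simp
  moreover have "2 * r \<in> \<rat>" using rt by simp
  ultimately obtain a where a: "2 * r = of_int a"
    using rational_algebraic_int_is_int by (metis Ints_cases)
  have "algebraic_int (x * cj x)" using assms(2) acx by (rule algebraic_int_times)
  moreover have n': "x * cj x = r ^ 2 - t ^ 2 * of_int d"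
    unfolding s2[symmetric] cx unfolding rt(3) by (simp add: algebra_simps power2_eq_square)
  moreover have "r ^ 2 - t ^ 2 * of_int d \<in> \<rat>" using rt by simp
  ultimately obtain n where n: "x * cj x = of_int n"
    using rational_algebraic_int_is_int by (metis Ints_cases)
  obtain b0 c0 where bc: "c0 > 0" "coprime b0 c0" "2 * t = of_int b0 / of_int c0"
    using rt(2) by (metis Rats_cases' Rats_mult Rats_number_of)
  have "(2 * r) ^ 2 - (2 * t) ^ 2 * of_int d = 4 * of_int n"
    using n n' by (simp add: algebra_simps)
  hence "of_int d * (complex_of_int b0 / of_int c0) ^ 2 = of_int a ^ 2 - 4 * of_int n"
    unfolding a bc(3) by (simp add: algebra_simps)
  hence "of_int d * (complex_of_int b0) ^ 2 = (of_int a ^ 2 - 4 * of_int n) * of_int c0 ^ 2"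
    using bc(1) by (simp add: power_divide field_simps)
  hence "complex_of_int (d * b0 ^ 2) = of_int ((a ^ 2 - 4 * n) * c0 ^ 2)" by simp
  hence eq: "d * b0 ^ 2 = (a ^ 2 - 4 * n) * c0 ^ 2" by (simp only: of_int_eq_iff)
  hence "c0 ^ 2 dvd d * b0 ^ 2" by simp
  moreover have "coprime (c0 ^ 2) (b0 ^ 2)" using bc(2) by (simp add: coprime_commute)
  ultimately have "c0 ^ 2 dvd d" by (simp add: coprime_dvd_mult_left_iff)
  hence "c0 dvd 1" using d(2) squarefreeD by blast
  hence "c0 = 1" using bc(1) by auto
  hence t: "2 * t = of_int b0" and e: "a ^ 2 - d * b0 ^ 2 = 4 * n" using bc(3) eq by auto
  have "x = (2 * r + 2 * t * s) / 2" "cj x = (2 * r - 2 * t * s) / 2" unfolding cx unfolding rt(3) by simp_all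
  hence "x = (of_int a + of_int b0 * s) / 2" "cj x = (of_int a - of_int b0 * s) / 2"
    unfolding a t .
  with e n that show ?thesis by blast
qed

lemma in_Q: "(of_int a + of_int b * s) / 2 \<in> Q"
  by (intro subfield_closed[OF Q] s_in)

lemma algebraic_int_half:
  assumes "a ^ 2 - d * b ^ 2 = 4 * n"
  shows "algebraic_int ((of_int a + of_int b * s) / 2)"
proof
  have "complex_of_int a ^ 2 - of_int d * of_int b ^ 2 = 4 * of_int n"
    by (metis assms of_int_diff of_int_mult of_int_numeral of_int_power)
  thus "poly [:of_int n, - of_int a, 1:] ((of_int a + of_int b * s) / 2) = 0"
    unfolding s2[symmetric] by (simp add: field_simps power2_eq_square)
qed (auto simp: coeff_pCons split: nat.splits)

text \<open>The integral norms of \<open>u\<close> and of its inverse multiply to 1.\<close>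

lemma unit_form:
  assumes "u \<in> unit_group Q"
  obtains a b n :: int where "u = (of_int a + of_int b * s) / 2" "cj u = (of_int a - of_int b * s) / 2"
    "a ^ 2 - d * b ^ 2 = 4 * n" "u * cj u = of_int n" "n = 1 \<or> n = - 1"
proof -
  have u: "u \<in> Q" "u \<noteq> 0" "algebraic_int u" "algebraic_int (inverse u)"
    using assms by (auto simp: unit_group_def)
  obtain a b n where n: "u = (of_int a + of_int b * s) / 2" "cj u = (of_int a - of_int b * s) / 2"
    "a ^ 2 - d * b ^ 2 = 4 * n" "u * cj u = of_int n"
    using integral_form[OF u(1,3)] by metis
  obtain n' where n': "inverse u * cj (inverse u) = of_int n'"
    using integral_form[OF subfield_inverse[OF Q u(1)] u(4)] by metis
  have ne: "u * cj u \<noteq> 0" using u(1,2) hom_eq_0_iff[OF Q hom_cj u(1)] by simp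
  have "of_int n' = inverse (u * cj u)"
    unfolding n'[symmetric] hom_inverse[OF Q hom_cj u(1)] by simp
  hence "of_int n * of_int n' = (1 :: complex)"
    unfolding n(4)[symmetric] by (simp only: right_inverse[OF ne])
  hence "of_int (n * n') = (1 :: complex)" by simp
  hence "n * n' = 1" by (simp only: of_int_eq_1_iff)
  hence "n = 1 \<or> n = - 1" by (auto simp: zmult_eq_1_iff)
  with n that show ?thesis by blast
qed

lemma unit_I:
  assumes n: "a ^ 2 - d * b ^ 2 = 4 * n" "n = 1 \<or> n = - 1"
  shows "(of_int a + of_int b * s) / 2 \<in> unit_group Q"
proof -
  let ?u = "(of_int a + of_int b * s) / 2" and ?v = "(of_int a + of_int (- b) * s) / 2"
  have "complex_of_int a ^ 2 - of_int d * of_int b ^ 2 = 4 * of_int n"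
    by (metis n(1) of_int_diff of_int_mult of_int_numeral of_int_power)
  hence uv: "?u * ?v = of_int n"
    unfolding s2[symmetric] by (simp add: field_simps power2_eq_square)
  have 1: "?u * (of_int n * ?v) = 1"
    unfolding mult.left_commute[of ?u] uv using n(2) by auto
  hence "?u \<noteq> 0" by auto
  moreover have inv: "inverse ?u = of_int n * ?v" by (rule inverse_unique[OF 1])
  have "algebraic_int ?v" using algebraic_int_half[of a "- b" n] n by simp
  hence "algebraic_int (inverse ?u)" unfolding inv by (rule algebraic_int_times[OF algebraic_int_of_int])
  ultimately show ?thesis
    using algebraic_int_half[OF n(1)] in_Q unfolding unit_group_def by blast
qed

lemma unit_real: "u \<in> Q \<Longrightarrow> u \<in> \<real>"
  unfolding Q_eq s_def by (auto elim!: qadjE Rats_cases')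

lemma real_complex: "u \<in> \<real> \<Longrightarrow> of_real (Re u) = u"
  by (auto elim!: Reals_cases)

end

lemma unit_group_mult:
  assumes "is_subfield F" "u \<in> unit_group F" "v \<in> unit_group F"
  shows "u * v \<in> unit_group F"
  using assms by (auto simp: unit_group_def algebraic_int_times subfield_mult)

lemma unit_group_inverse: "is_subfield F \<Longrightarrow> u \<in> unit_group F \<Longrightarrow> inverse u \<in> unit_group F"
  by (auto simp: unit_group_def subfield_inverse)

lemma unit_group_1: "is_subfield F \<Longrightarrow> 1 \<in> unit_group F"
  by (auto simp: unit_group_def subfield_1)

lemma unit_group_power: "is_subfield F \<Longrightarrow> u \<in> unit_group F \<Longrightarrow> u ^ n \<in> unit_group F"
  by (induction n) (auto simp: unit_group_1 unit_group_mult)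

lemma unit_group_powi: "is_subfield F \<Longrightarrow> u \<in> unit_group F \<Longrightarrow> u powi k \<in> unit_group F"
  by (auto simp: power_int_def unit_group_power unit_group_inverse)

lemma unit_group_minus: "is_subfield F \<Longrightarrow> u \<in> unit_group F \<Longrightarrow> - u \<in> unit_group F"
  by (auto simp: unit_group_def subfield_minus)

text \<open>Both \<open>u\<close> and its inverse inherit integrality from their powers. The two
  fields may differ: with exponent 1 this carries a unit of a quadratic field into a larger
  field.\<close>

lemma unit_group_of_power:
  assumes "u ^ n \<in> unit_group F" "n > 0" "u \<in> F'"
  shows "u \<in> unit_group F'"
proof -
  have "algebraic_int u" using assms(1,2) by (intro algebraic_int_of_power[of u n]) (auto simp: unit_group_def)
  moreover have "algebraic_int (inverse u)"
    using assms(1,2) by (intro algebraic_int_of_power[of "inverse u" n]) (auto simp: unit_group_def power_inverse)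
  ultimately show ?thesis using assms by (auto simp: unit_group_def power_0_left)
qed

context real_quadratic
begin

lemma exists_unit_gt_1: "\<exists>u \<in> unit_group Q. u \<in> \<real> \<and> Re u > 1"
proof -
  have irr: "sqrt (of_int d) \<notin> \<rat>"
  proof
    assume "sqrt (of_int d) \<in> \<rat>"
    hence "s \<in> \<rat>" unfolding s_def by (auto elim!: Rats_cases')
    thus False using s_irrat by simp
  qed
  obtain x y where xy: "y \<noteq> 0" "x ^ 2 - d * y ^ 2 = 1"
    by (rule pell_exists[OF irr]) (use d(1) in auto)
  \<comment> \<open>Absolute values make both summands positive, which puts the unit above 1; the
    doubling fits the half-integral form of \<open>unit_I\<close>.\<close>
  let ?u = "(of_int (2 * \<bar>x\<bar>) + of_int (2 * \<bar>y\<bar>) * s) / 2"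
  have "(2 * \<bar>x\<bar>) ^ 2 - d * (2 * \<bar>y\<bar>) ^ 2 = 4 * 1" using xy(2) by (simp add: power_mult_distrib)
  from unit_I[OF this] have u: "?u \<in> unit_group Q" by simp
  have "x \<noteq> 0"
  proof
    assume "x = 0"
    hence "d * y ^ 2 = - 1" using xy(2) by simp
    moreover have "d * y ^ 2 \<ge> 0" using d(1) by simp
    ultimately show False by linarith
  qed
  hence "1 \<le> \<bar>x\<bar>" "1 \<le> \<bar>y\<bar>" using xy(1) by auto
  moreover have "Re ?u = of_int \<bar>x\<bar> + of_int \<bar>y\<bar> * sqrt (of_int d)" by (simp add: s_def add_divide_distrib)
  moreover have "of_int \<bar>y\<bar> * sqrt (of_int d) > 0" using xy(1) d(1) by simp
  ultimately have "Re ?u > 1" by linarith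
  moreover have "?u \<in> \<real>" using u unit_real by (auto simp: unit_group_def)
  ultimately show ?thesis using u by blast
qed

text \<open>A unit above 1 has a conjugate of absolute value below 1, so trace and difference of the
  two are bounded by B + 1, which bounds both integer coordinates.\<close>

lemma finite_units_le: "finite {u \<in> unit_group Q. 1 < Re u \<and> Re u \<le> B}"
proof -
  define M where "M = \<lceil>B + 1\<rceil>"
  have "{u \<in> unit_group Q. 1 < Re u \<and> Re u \<le> B} \<subseteq> (\<lambda>(a, b). (of_int a + of_int b * s) / 2) ` ({-M..M} \<times> {-M..M})"
  proof clarify
    fix u assume u: "u \<in> unit_group Q" "1 < Re u" "Re u \<le> B"
    obtain a b n where *: "u = (of_int a + of_int b * s) / 2" "cj u = (of_int a - of_int b * s) / 2"
      "a ^ 2 - d * b ^ 2 = 4 * n" "u * cj u = of_int n" "n = 1 \<or> n = - 1"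
      using unit_form[OF u(1)] by metis
    have ru: "of_real (Re u) = u" using u(1) by (intro real_complex unit_real) (auto simp: unit_group_def)
    have "cmod (u * cj u) = 1" using *(5) unfolding *(4) by auto
    moreover have cu: "cmod u = Re u" using norm_of_real[of "Re u", where 'a = complex] u(2) unfolding ru by simp
    ultimately have 1: "Re u * cmod (cj u) = 1" by (simp add: norm_mult)
    have "cmod (cj u) < 1"
    proof (rule ccontr)
      assume "\<not> cmod (cj u) < 1"
      hence "Re u * 1 \<le> Re u * cmod (cj u)" using u(2) by (intro mult_left_mono) auto
      thus False using 1 u(2) by linarith
    qed
    have "of_int a = u + cj u" "of_int b * s = u - cj u"
      unfolding *(2) by (subst *(1), simp add: field_simps)+
    hence "cmod (of_int a) \<le> B + 1" "cmod (of_int b * s) \<le> B + 1"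
      using norm_triangle_ineq[of u "cj u"] norm_triangle_ineq4[of u "cj u"] cu u(3) \<open>cmod (cj u) < 1\<close> by auto
    moreover have "cmod (of_int b) * 1 \<le> cmod (of_int b) * cmod s"
      using d(1) by (intro mult_left_mono) (auto simp: s_def)
    ultimately have "\<bar>real_of_int a\<bar> \<le> B + 1" "\<bar>real_of_int b\<bar> \<le> B + 1" by (auto simp: norm_mult)
    hence "\<bar>a\<bar> \<le> M" "\<bar>b\<bar> \<le> M" unfolding M_def by linarith+
    thus "u \<in> (\<lambda>(a, b). (of_int a + of_int b * s) / 2) ` ({-M..M} \<times> {-M..M})"
      by (intro image_eqI[where x = "(a, b)"]) (auto simp: *(1))
  qed
  thus ?thesis by (rule finite_subset) simp
qed

abbreviation e :: complex where "e \<equiv> fund_unit d"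

text \<open>The least element among the finitely many units in (1, u0] is least among all units
  above 1; being real, it is determined by its real part, which justifies the definite
  description.\<close>

lemma fund_unit: "e \<in> unit_group Q" "e \<in> \<real>" "Re e > 1"
  and fund_unit_least: "u \<in> unit_group Q \<Longrightarrow> Re u > 1 \<Longrightarrow> Re e \<le> Re u"
proof -
  let ?P = "\<lambda>e. e \<in> unit_group Q \<and> e \<in> \<real> \<and> Re e > 1 \<and>
       (\<forall>u \<in> unit_group Q. u \<in> \<real> \<and> Re u > 1 \<longrightarrow> Re e \<le> Re u)"
  obtain u0 where u0: "u0 \<in> unit_group Q" "Re u0 > 1" using exists_unit_gt_1 by blast
  let ?S = "{u \<in> unit_group Q. 1 < Re u \<and> Re u \<le> Re u0}"
  have S: "finite ?S" "?S \<noteq> {}" using finite_units_le u0 by auto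
  define e0 where "e0 = arg_min_on Re ?S"
  have e0: "e0 \<in> ?S" and min: "\<And>u. u \<in> ?S \<Longrightarrow> Re e0 \<le> Re u"
    using arg_min_if_finite(1)[OF S, of Re] arg_min_least[OF S, of _ Re] by (auto simp: e0_def)
  have "?P e0"
  proof (intro conjI ballI impI)
    fix u assume "u \<in> unit_group Q" "u \<in> \<real> \<and> Re u > 1"
    thus "Re e0 \<le> Re u" using min[of u] e0 by (cases "Re u \<le> Re u0") auto
  qed (use e0 unit_real in \<open>auto simp: unit_group_def\<close>)
  moreover have "x = e0" if "?P x" for x
    using that \<open>?P e0\<close> real_complex by (metis order_antisym)
  ultimately have "?P (THE e. ?P e)" by (rule theI)
  hence P: "?P e" unfolding fund_unit_def Q_def s_def .
  thus "e \<in> unit_group Q" "e \<in> \<real>" "Re e > 1" by auto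
  show "u \<in> unit_group Q \<Longrightarrow> Re u > 1 \<Longrightarrow> Re e \<le> Re u"
    using P unit_real by (auto simp: unit_group_def)
qed

lemma fund_unit_of_real: "of_real (Re e) = e"
  using fund_unit(2) by (rule real_complex)

text \<open>Dividing \<open>u\<close> by the power of \<open>e\<close> with exponent floor(log_e u)
  leaves a unit in [1, e), which is 1 by minimality.\<close>

lemma fund_unit_generates:
  assumes "u \<in> unit_group Q"
  shows "\<exists>k. u = e powi k \<or> u = - (e powi k)"
proof -
  have *: "\<exists>k. u = e powi k" if u: "u \<in> unit_group Q" "Re u > 0" for u
  proof -
    define r where "r = Re e"
    define k where "k = \<lfloor>log r (Re u)\<rfloor>"
    have r: "r > 1" using fund_unit by (simp add: r_def)
    have ru: "of_real (Re u) = u" using u by (intro real_complex unit_real) (auto simp: unit_group_def)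
    have ek: "e powi j = of_real (r powi j)" for j
      unfolding r_def using fund_unit_of_real by (metis of_real_power_int)
    define v where "v = u * e powi (- k)"
    have v: "v \<in> unit_group Q" unfolding v_def
      by (intro unit_group_mult unit_group_powi Q u fund_unit)
    have vr: "v = of_real (Re u * r powi (- k))" unfolding v_def ek using ru by simp
    have pw: "r powi j = r powr (of_int j)" for j using r by (simp add: powr_real_of_int')
    have "r powr (of_int k) \<le> Re u" "Re u < r powr (of_int k + 1)"
      using r u(2) unfolding k_def by (auto simp: le_log_iff[symmetric] log_less_iff[symmetric])
    hence "1 \<le> Re u * r powi (- k)" "Re u * r powi (- k) < r"
      using r by (auto simp: pw powr_minus powr_add field_simps)
    moreover have "Re v = Re u * r powi (- k)" unfolding vr by (rule Re_complex_of_real)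
    ultimately have "1 \<le> Re v" "Re v < Re e" by (simp_all only: r_def)
    hence "Re v = 1" using fund_unit_least[OF v] by force
    moreover have "of_real (Re v) = v" using v by (intro real_complex unit_real) (auto simp: unit_group_def)
    ultimately have "v = 1" by (metis of_real_1)
    moreover have "e \<noteq> 0" using fund_unit(1) by (auto simp: unit_group_def)
    ultimately have "u = e powi k" by (simp add: v_def power_int_minus field_simps)
    thus ?thesis by blast
  qed
  show ?thesis
  proof (cases "Re u > 0")
    case False
    have "u \<in> \<real>" "u \<noteq> 0" using assms unit_real by (auto simp: unit_group_def)
    hence "Re u \<noteq> 0" using real_complex by fastforce
    hence "Re (- u) > 0" using False by simp
    from *[OF unit_group_minus[OF Q assms] this] show ?thesis by (metis minus_minus)
  qed (use * assms in blast)
qed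

section \<open>The square class of a fundamental unit\<close>

text \<open>For nonzero \<open>m\<close> this says that \<open>e\<close> and \<open>m\<close> have
  the same class modulo squares of Q(sqrt d).\<close>

definition sqm :: "int \<Rightarrow> bool" where
  "sqm m \<longleftrightarrow> (\<exists>t \<in> Q. t ^ 2 = of_int m * e)"

text \<open>A square root of \<open>e\<close>, up to sign, would be a unit strictly between 1 and
  \<open>e\<close>.\<close>

lemma not_sqm_1: "\<not> sqm 1"
proof
  assume "sqm 1"
  then obtain t where t: "t \<in> Q" "t ^ 2 = e" by (auto simp: sqm_def)
  have tu: "t \<in> unit_group Q" by (rule unit_group_of_power[of t 2 Q]) (use t fund_unit in auto)
  have rt: "of_real (Re t) = t" using t(1) by (intro real_complex unit_real)
  have "e = of_real ((Re t) ^ 2)" unfolding of_real_power rt t(2) ..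
  from arg_cong[OF this, of Re] have sq: "\<bar>Re t\<bar> ^ 2 = Re e"
    by (simp only: Re_complex_of_real power2_abs)
  have gt: "\<bar>Re t\<bar> > 1"
  proof (rule ccontr)
    assume "\<not> \<bar>Re t\<bar> > 1"
    hence "\<bar>Re t\<bar> \<le> 1" by simp
    hence "\<bar>Re t\<bar> ^ 2 \<le> 1" by (rule power_le_one[OF abs_ge_zero])
    thus False using sq fund_unit(3) by linarith
  qed
  have "\<bar>Re t\<bar> * 1 < \<bar>Re t\<bar> * \<bar>Re t\<bar>" using gt by (intro mult_strict_left_mono) auto
  hence lt: "\<bar>Re t\<bar> < Re e" unfolding sq[symmetric] power2_eq_square by simp
  have "Re e \<le> \<bar>Re t\<bar>"
  proof (cases "Re t > 0")
    case True thus ?thesis using fund_unit_least[OF tu] gt by simp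
  next
    case False thus ?thesis using fund_unit_least[OF unit_group_minus[OF Q tu]] gt by simp
  qed
  thus False using lt by simp
qed

text \<open>Since \<open>d\<close> is a square in Q(sqrt d), \<open>m\<close> and d / m represent
  the same class; this halves the list of candidates.\<close>

lemma sqm_dual:
  assumes "sqm m" "m * m' = d * k ^ 2" "m \<noteq> 0"
  shows "sqm m'"
proof -
  obtain t where t: "t \<in> Q" "t ^ 2 = of_int m * e" using assms(1) by (auto simp: sqm_def)
  let ?t = "t * s * of_int k / of_int m"
  have "complex_of_int m * of_int m' = of_int d * of_int k ^ 2"
    using assms(2) by (metis of_int_mult of_int_power)
  note eq = this
  have "?t ^ 2 = of_int m * e * (of_int d * of_int k ^ 2) / of_int m ^ 2"
    by (simp add: power_mult_distrib power_divide t(2) s2)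
  also have "\<dots> = of_int m' * e"
    unfolding eq[symmetric] using assms(3) by (simp add: power2_eq_square)
  finally have "?t ^ 2 = of_int m' * e" .
  moreover have "?t \<in> Q" using t(1) s_in by (intro subfield_closed[OF Q])
  ultimately show ?thesis by (auto simp: sqm_def)
qed

lemma sqm_square:
  assumes "sqm (m * k ^ 2)" "k \<noteq> 0"
  shows "sqm m"
proof -
  obtain t where t: "t \<in> Q" "t ^ 2 = of_int (m * k ^ 2) * e" using assms(1) by (auto simp: sqm_def)
  have "(t / of_int k) ^ 2 = of_int m * e"
    unfolding power_divide t(2) using assms(2) by simp
  moreover have "t / of_int k \<in> Q" using t(1) by (intro subfield_closed[OF Q])
  ultimately show ?thesis by (auto simp: sqm_def)
qed

lemma norm_dichotomy:
  "e * cj e = - 1 \<or> (\<exists>m > 0. m dvd 2 * d \<and> sqm m)"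
proof -
  obtain a b n where *: "e = (of_int a + of_int b * s) / 2" "cj e = (of_int a - of_int b * s) / 2"
      "a ^ 2 - d * b ^ 2 = 4 * n" "e * cj e = of_int n" "n = 1 \<or> n = - 1"
    using unit_form[OF fund_unit(1)] by metis
  show ?thesis
  proof (cases "n = 1")
    case True
    have e0: "e \<noteq> 0" using fund_unit by (auto simp: unit_group_def)
    have sum: "e + cj e = of_int a" unfolding *(2) by (subst *(1)) (simp add: field_simps)
    have "cj e = 1 / e" using *(4) True e0 by (simp add: field_simps)
    hence "complex_of_int a = of_real (Re e) + 1 / of_real (Re e)"
      unfolding fund_unit_of_real using sum by simp
    hence "complex_of_real (of_int a) = of_real (Re e + 1 / Re e)" by simp
    hence "real_of_int a = Re e + 1 / Re e" by (simp only: of_real_eq_iff)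
    moreover have "1 / Re e > 0" using fund_unit(3) by simp
    ultimately have "real_of_int a > 0" using fund_unit(3) by linarith
    hence a0: "a > 0" by simp
    \<comment> \<open>The trace is positive because \<open>e\<close> and its conjugate 1 / e are, so
      the squarefree part of trace + 2 is positive; it is the required class by e (trace + 2) = (1 +
      e)^2.\<close>
    define m where "m = squarefree_part (a + 2)"
    define k where "k = square_part (a + 2)"
    have mk: "a + 2 = m * k ^ 2" unfolding m_def k_def by (rule squarefree_decompose)
    have "m * k ^ 2 > 0" using a0 mk by linarith
    hence m: "m > 0" by (auto simp: zero_less_mult_iff)
    have k0: "k \<noteq> 0" using mk a0 by auto
    define w where "w = (1 + e) / of_int k"
    have wQ: "w \<in> Q" unfolding w_def using fund_unit by (intro subfield_closed[OF Q]) (auto simp: unit_group_def)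
    have "complex_of_int m * of_int k ^ 2 = of_int (a + 2)" unfolding mk by simp
    also have "\<dots> = of_int a + 2" by simp
    also have "\<dots> = e + cj e + 2" by (simp only: sum)
    finally have mke: "complex_of_int m * of_int k ^ 2 = e + cj e + 2" .
    have "e * (of_int m * of_int k ^ 2) = e * e + e * cj e + 2 * e"
      unfolding mke by (simp add: algebra_simps)
    also have "\<dots> = (1 + e) ^ 2"
      unfolding *(4) True by (simp add: algebra_simps power2_eq_square)
    finally have w2: "w ^ 2 = e * of_int m"
      using k0 unfolding w_def power_divide by (simp add: field_simps)
    have sf: "squarefree m" by (simp add: m_def)
    have "m dvd 2 * d"
    proof (rule squarefree_dvdI[OF sf])
      fix l :: int assume "prime l" "l dvd m"
      thus "l dvd 2 * d"
        using unram_outside_dvd[OF Q unram_Q _ _ sf wQ w2 e0, of l 1] fund_unit(1)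
        by (auto simp: unit_group_def inverse_eq_divide)
    qed (use d in auto)
    moreover have "sqm m" using wQ w2 by (auto simp: sqm_def mult.commute)
    ultimately show ?thesis using m by blast
  qed (use * in auto)
qed

text \<open>Taking norms in t^2 = m e gives N(t)^2 = m^2 N(e), which is a square only for N(e) = 1.
  A candidate \<open>m\<close> thus becomes a norm equation that residue symbols can refute.\<close>

lemma sqm_form:
  assumes "sqm m" "m \<noteq> 0"
  obtains a b :: int where "((of_int a + of_int b * s) / 2) ^ 2 = of_int m * e"
    "a ^ 2 - d * b ^ 2 = 4 * m \<or> a ^ 2 - d * b ^ 2 = - 4 * m"
proof -
  obtain t where t: "t \<in> Q" "t ^ 2 = of_int m * e" using assms(1) by (auto simp: sqm_def)
  have "algebraic_int (of_int m * e)" using fund_unit by (intro algebraic_int_times) (auto simp: unit_group_def)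
  hence "algebraic_int t" using algebraic_int_of_power[of t 2] t(2) by simp
  then obtain a b n where *: "t = (of_int a + of_int b * s) / 2" "cj t = (of_int a - of_int b * s) / 2"
      "a ^ 2 - d * b ^ 2 = 4 * n" "t * cj t = of_int n"
    using integral_form[OF t(1)] by metis
  obtain n' where n': "e * cj e = of_int n'" "n' = 1 \<or> n' = - 1"
    using unit_form[OF fund_unit(1)] by metis
  have eQ: "e \<in> Q" using fund_unit by (auto simp: unit_group_def)
  have "(t * cj t) ^ 2 = t ^ 2 * cj (t ^ 2)"
    by (simp add: hom_power[OF Q hom_cj t(1)] power_mult_distrib)
  also have "\<dots> = of_int m ^ 2 * (e * cj e)"
    unfolding t(2) by (simp add: hom_mult[OF Q hom_cj _ eQ] subfield_of_int[OF Q] hom_of_int[OF Q hom_cj] power2_eq_square)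
  finally have "complex_of_int (n ^ 2) = of_int (m ^ 2 * n')" by (simp add: *(4) n'(1))
  hence nm: "n ^ 2 = m ^ 2 * n'" by (simp only: of_int_eq_iff)
  have "n' = 1"
  proof (rule ccontr)
    assume "n' \<noteq> 1"
    hence "n ^ 2 + m ^ 2 = 0" using nm n' by auto
    thus False using assms(2) by (simp add: sum_power2_eq_zero_iff)
  qed
  hence "n = m \<or> n = - m" using nm by (simp add: power2_eq_iff)
  thus ?thesis using that[of a b] t(2) *(1,3) by auto
qed

end

text \<open>Squares are 0 or 1 modulo 4. For \<open>d\<close> congruent to 2 or 3 this removes the
  denominator 2 from integral elements.\<close>

lemma even_coeffs:
  fixes a b d n :: int
  assumes "a ^ 2 - d * b ^ 2 = 4 * n" "d mod 4 = 2 \<or> d mod 4 = 3"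
  shows "even a \<and> even b"
proof -
  have sq: "(\<exists>k. x ^ 2 = 4 * k) \<and> even x \<or> (\<exists>k. x ^ 2 = 4 * k + 1) \<and> odd x" for x :: int
  proof (cases "even x")
    case True
    then obtain y where "x = 2 * y" by (rule evenE)
    hence "x ^ 2 = 4 * y ^ 2" by (simp add: power_mult_distrib)
    thus ?thesis using True by blast
  next
    case False
    then obtain y where "x = 2 * y + 1" by (rule oddE)
    hence "x ^ 2 = 4 * (y ^ 2 + y) + 1" by (simp add: algebra_simps power2_eq_square)
    thus ?thesis using False by blast
  qed
  define k where "k = d div 4"
  have "d = 4 * k + 2 \<or> d = 4 * k + 3" using assms(2) unfolding k_def by presburger
  hence "d * b ^ 2 = 4 * (k * b ^ 2) + 2 * b ^ 2 \<or> d * b ^ 2 = 4 * (k * b ^ 2) + 3 * b ^ 2"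
    by (auto simp: algebra_simps)
  thus ?thesis using sq[of a] sq[of b] assms(1) by presburger
qed

context real_quadratic
begin

lemma sqm_form_int:
  assumes "sqm m" "m \<noteq> 0" "d mod 4 = 2 \<or> d mod 4 = 3"
  obtains x y :: int where "(of_int x + of_int y * s) ^ 2 = of_int m * e"
    "x ^ 2 - d * y ^ 2 = m \<or> x ^ 2 - d * y ^ 2 = - m"
proof -
  obtain a b where ab: "((of_int a + of_int b * s) / 2) ^ 2 = of_int m * e"
    "a ^ 2 - d * b ^ 2 = 4 * m \<or> a ^ 2 - d * b ^ 2 = - 4 * m"
    by (rule sqm_form[OF assms(1,2)])
  have "even a \<and> even b" using even_coeffs[of a d b m] even_coeffs[of a d b "- m"] ab(2) assms(3) by auto
  then obtain x y where "a = 2 * x" "b = 2 * y" by (auto elim!: evenE)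
  with ab that[of x y] show ?thesis by (auto simp: add_divide_distrib power_mult_distrib)
qed

lemma norm_eq_m1_form:
  assumes "e * cj e = - 1"
  obtains a b :: int where "e = (of_int a + of_int b * s) / 2" "a ^ 2 - d * b ^ 2 = - 4"
proof -
  obtain a b n where *: "e = (of_int a + of_int b * s) / 2" "a ^ 2 - d * b ^ 2 = 4 * n" "e * cj e = of_int n"
    using unit_form[OF fund_unit(1)] by metis
  hence "complex_of_int n = of_int (- 1)" using assms by simp
  hence "n = - 1" by (simp only: of_int_eq_iff)
  thus ?thesis using * that by simp
qed

lemma norm_eq_m1_form_int:
  assumes "e * cj e = - 1" "d mod 4 = 2 \<or> d mod 4 = 3"
  obtains x y :: int where "e = of_int x + of_int y * s" "x ^ 2 - d * y ^ 2 = - 1"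
proof -
  obtain a b where ab: "e = (of_int a + of_int b * s) / 2" "a ^ 2 - d * b ^ 2 = - 4"
    by (rule norm_eq_m1_form[OF assms(1)])
  have "even a \<and> even b" using even_coeffs[of a d b "- 1"] ab(2) assms(2) by auto
  then obtain x y where "a = 2 * x" "b = 2 * y" by (auto elim!: evenE)
  with ab that[of x y] show ?thesis by (auto simp: add_divide_distrib power_mult_distrib)
qed

end

section \<open>The seven fundamental units\<close>

lemma dvd_prime_mult:
  fixes m l n :: int
  assumes "prime l" "m dvd l * n" "m > 0"
  shows "m dvd n \<or> (\<exists>b>0. b dvd n \<and> m = l * b)"
proof (cases "l dvd m")
  case True
  then obtain b where b: "m = l * b" by auto
  have "l > 0" using assms(1) by (rule prime_gt_0_int)
  hence "b dvd n" "b > 0" using assms(2,3) b by (auto simp: zero_less_mult_iff)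
  thus ?thesis using b by blast
next
  case False
  hence "coprime m l" using assms(1) by (metis coprime_commute prime_imp_coprime)
  hence "m dvd n" using assms(2) by (simp add: coprime_dvd_mult_right_iff)
  thus ?thesis by simp
qed

lemma dvd_prime_cases:
  fixes m l :: int
  assumes "prime l" "m dvd l" "m > 0"
  shows "m = 1 \<or> m = l"
  using dvd_prime_mult[of l m 1] assms by auto

lemma dvd_prime_prime_cases:
  fixes m l r :: int
  assumes "prime l" "prime r" "m dvd l * r" "m > 0"
  shows "m = 1 \<or> m = r \<or> m = l \<or> m = l * r"
proof -
  from dvd_prime_mult[OF assms(1,3,4)] consider "m dvd r" | b where "b > 0" "b dvd r" "m = l * b"
    by blast
  thus ?thesis
  proof cases
    case 1
    thus ?thesis using dvd_prime_cases[OF assms(2) _ assms(4)] by blast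
  next
    case 2
    hence "b = 1 \<or> b = r" using dvd_prime_cases[OF assms(2)] by blast
    thus ?thesis using 2 by auto
  qed
qed

lemma dvd_2_mult:
  fixes m n :: int
  assumes "m dvd 2 * n" "m > 0"
  obtains b where "b > 0" "b dvd n" "m = b \<or> m = 2 * b"
  using dvd_prime_mult[of 2 m n] assms by auto

section \<open>Residue symbols and unsolvable norm equations\<close>

lemma Euler_int:
  fixes l :: int
  assumes "prime l" "l > 2"
  shows "[Legendre a l = a ^ nat ((l - 1) div 2)] (mod l)"
proof -
  have "prime (nat l)" using assms(1) prime_int_nat_transfer[of l] by blast
  from euler_criterion[OF this, of a] assms(2)
  have "[Legendre a (int (nat l)) = a ^ ((nat l - 1) div 2)] (mod int (nat l))" by simp
  moreover have "(nat l - 1) div 2 = nat ((l - 1) div 2)" using assms(2) by linarith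
  ultimately show ?thesis using assms(2) by simp
qed

text \<open>The power in Euler's criterion is multiplicative in \<open>a\<close>, so nonresidues
  such as -2, 8 or 2 p can be computed from the three given symbols.\<close>

lemma not_QuadRes_if_power:
  fixes l :: int
  assumes "prime l" "l > 2" "[a ^ nat ((l - 1) div 2) = - 1] (mod l)"
  shows "\<not> QuadRes l a"
proof
  assume "QuadRes l a"
  hence "Legendre a l = 0 \<or> Legendre a l = 1" by (simp add: Legendre_def)
  moreover have "[Legendre a l = - 1] (mod l)" using Euler_int[OF assms(1,2)] assms(3) by (rule cong_trans)
  ultimately have "l dvd 1 \<or> l dvd 2" by (auto simp: cong_iff_dvd_diff)
  thus False using assms(2) by (auto dest: zdvd_imp_le)
qed

lemma QuadResI: "l dvd y ^ 2 - a \<Longrightarrow> QuadRes l a"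
  unfolding QuadRes_def by (auto simp: cong_iff_dvd_diff)

lemma Legendre_m1: "Legendre a l = - 1 \<Longrightarrow> \<not> QuadRes l a"
  by (auto simp: Legendre_def split: if_splits)

locale pq_primes =
  fixes p q :: int
  assumes prime_p: "prime p" and prime_q: "prime q"
    and p_mod_4: "p mod 4 = 1" and q_mod_4: "q mod 4 = 3"
    and Legendre_2_p: "Legendre 2 p = - 1" and Legendre_2_q: "Legendre 2 q = 1"
    and Legendre_p_q: "Legendre p q = - 1"
begin

lemma p_gt_2: "p > 2" and q_gt_2: "q > 2"
proof -
  have "p > 0" "q > 0" "p \<noteq> 1" "p \<noteq> 2" "q \<noteq> 1" "q \<noteq> 2"
    using prime_gt_0_int[OF prime_p] prime_gt_0_int[OF prime_q] prime_p prime_q p_mod_4 q_mod_4 by auto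
  thus "p > 2" "q > 2" by linarith+
qed

lemma p_ne_q: "p \<noteq> q"
  using p_mod_4 q_mod_4 by auto

lemma even_half_p: "even (nat ((p - 1) div 2))"
proof -
  have "even ((p - 1) div 2)" using p_mod_4 by presburger
  thus ?thesis using p_gt_2 by (simp add: even_nat_iff)
qed

lemma odd_half_q: "odd (nat ((q - 1) div 2))"
proof -
  have "odd ((q - 1) div 2)" using q_mod_4 by presburger
  thus ?thesis using q_gt_2 by (simp add: even_nat_iff)
qed

lemma power_2_p: "[2 ^ nat ((p - 1) div 2) = - 1] (mod p)"
  and power_p_q: "[p ^ nat ((q - 1) div 2) = - 1] (mod q)"
  and power_2_q: "[2 ^ nat ((q - 1) div 2) = 1] (mod q)"
  using Euler_int[OF prime_p p_gt_2, of 2] Euler_int[OF prime_q q_gt_2, of p]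
    Euler_int[OF prime_q q_gt_2, of 2] Legendre_2_p Legendre_2_q Legendre_p_q
  by (simp_all add: cong_sym)

text \<open>Here -1 is a residue because p = 1 mod 4, and 8 is a cube of 2. The values 8 and -8 are
  needed for \<open>eps_p\<close>, whose coordinates may be half-integral.\<close>

lemma nonresidues_p: "\<not> QuadRes p 2" "\<not> QuadRes p (- 2)" "\<not> QuadRes p 8" "\<not> QuadRes p (- 8)"
proof -
  let ?k = "nat ((p - 1) div 2)"
  have "(8 :: int) ^ ?k = (2 ^ 3) ^ ?k" by simp
  also have "\<dots> = (2 ^ ?k) ^ 3" by (simp only: mult.commute flip: power_mult)
  finally have eq: "(8 :: int) ^ ?k = (2 ^ ?k) ^ 3" .
  have 8: "[8 ^ ?k = - 1] (mod p)" unfolding eq using cong_pow[OF power_2_p, of 3] by simp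
  have neg: "(- 2 :: int) ^ ?k = 2 ^ ?k" "(- 8 :: int) ^ ?k = 8 ^ ?k" using even_half_p by simp_all
  note * = not_QuadRes_if_power[OF prime_p p_gt_2]
  show "\<not> QuadRes p 2" by (rule *[OF power_2_p])
  show "\<not> QuadRes p (- 2)" by (rule *) (simp only: neg power_2_p)
  show "\<not> QuadRes p 8" by (rule *[OF 8])
  show "\<not> QuadRes p (- 8)" by (rule *) (simp only: neg 8)
qed

text \<open>Reciprocity carries no sign since p = 1 mod 4.\<close>

lemma nonresidue_p_q: "\<not> QuadRes p q"
proof -
  have "prime (nat p)" "prime (nat q)" using prime_p prime_q prime_int_nat_transfer[of p] prime_int_nat_transfer[of q] by blast+
  hence "Legendre p q * Legendre q p = (- 1) ^ nat ((p - 1) div 2 * ((q - 1) div 2))"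
    using Quadratic_Reciprocity_int[of p q] p_gt_2 q_gt_2 p_ne_q by simp
  also have "nat ((p - 1) div 2 * ((q - 1) div 2)) = nat ((p - 1) div 2) * nat ((q - 1) div 2)"
    using p_gt_2 by (simp add: nat_mult_distrib)
  finally have "Legendre q p = - 1" using even_half_p Legendre_p_q by simp
  thus ?thesis by (rule Legendre_m1)
qed

lemma nonresidues_q: "\<not> QuadRes q (- 1)" "\<not> QuadRes q (- 2)" "\<not> QuadRes q p" "\<not> QuadRes q (2 * p)"
proof -
  let ?k = "nat ((q - 1) div 2)"
  have 1: "(- 1 :: int) ^ ?k = - 1" "(- 2 :: int) ^ ?k = - (2 ^ ?k)" using odd_half_q by simp_all
  have 2: "[- (2 ^ ?k) = - 1] (mod q)" using power_2_q by (simp add: cong_minus_minus_iff)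
  have 3: "[(2 * p) ^ ?k = - 1] (mod q)"
    using cong_mult[OF power_2_q power_p_q] by (simp add: power_mult_distrib)
  note * = not_QuadRes_if_power[OF prime_q q_gt_2]
  show "\<not> QuadRes q (- 1)" by (rule *) (simp add: 1)
  show "\<not> QuadRes q (- 2)" by (rule *) (use 1 2 in simp)
  show "\<not> QuadRes q p" by (rule *[OF power_p_q])
  show "\<not> QuadRes q (2 * p)" by (rule *[OF 3])
qed

lemma coprime_facts: "coprime p q" "coprime 2 p" "coprime 2 q" "coprime (2 * p) q"
proof -
  show 1: "coprime p q" using primes_coprime[OF prime_p prime_q p_ne_q] .
  show 2: "coprime 2 p" using primes_coprime[of 2 p] prime_p p_gt_2 by simp
  show 3: "coprime 2 q" using primes_coprime[of 2 q] prime_q q_gt_2 by simp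
  show "coprime (2 * p) q" using 1 3 by simp
qed

lemma squarefree_facts: "squarefree (2 :: int)" "squarefree p" "squarefree q" "squarefree (2 * p)"
  "squarefree (2 * q)" "squarefree (p * q)" "squarefree (2 * p * q)"
proof -
  show 2: "squarefree (2 :: int)" and p: "squarefree p" and q: "squarefree q"
    using prime_p prime_q by (auto intro!: squarefree_prime)
  show 3: "squarefree (2 * p)" by (rule squarefree_mult_coprime[OF coprime_facts(2) 2 p])
  show "squarefree (2 * q)" by (rule squarefree_mult_coprime[OF coprime_facts(3) 2 q])
  show "squarefree (p * q)" by (rule squarefree_mult_coprime[OF coprime_facts(1) p q])
  show "squarefree (2 * p * q)" by (rule squarefree_mult_coprime[OF coprime_facts(4) 3 q])
qed

definition r2 :: complex where "r2 = of_real (sqrt 2)"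
definition rp :: complex where "rp = of_real (sqrt (of_int p))"
definition rq :: complex where "rq = of_real (sqrt (of_int q))"

lemma r2_sq: "r2 ^ 2 = 2" and rp_sq: "rp ^ 2 = of_int p" and rq_sq: "rq ^ 2 = of_int q"
  using p_gt_2 q_gt_2 by (simp_all add: r2_def rp_def rq_def flip: of_real_power)

lemma real_quadratics: "real_quadratic 2" "real_quadratic p" "real_quadratic q" "real_quadratic (2 * p)"
  "real_quadratic (2 * q)" "real_quadratic (p * q)" "real_quadratic (2 * p * q)"
proof -
  have "1 * 1 < p * q" using p_gt_2 q_gt_2 by (intro mult_strict_mono) auto
  thus "real_quadratic 2" "real_quadratic p" "real_quadratic q" "real_quadratic (2 * p)"
    "real_quadratic (2 * q)" "real_quadratic (p * q)" "real_quadratic (2 * p * q)"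
    unfolding real_quadratic_def using squarefree_facts p_gt_2 q_gt_2 by auto
qed

text \<open>Reducing the equation modulo a prime divisor of \<open>d\<close> leaves a quadratic
  residue condition; the two lemmas that follow do the same modulo \<open>q\<close>.\<close>

lemma no_norm_pm2:
  assumes "x ^ 2 - d * y ^ 2 = 2 \<or> x ^ 2 - d * y ^ 2 = - 2" "p dvd d"
  shows False
proof -
  obtain c where c: "d = p * c" using assms(2) by auto
  have "x ^ 2 - 2 = p * (c * y ^ 2) \<or> x ^ 2 - (- 2) = p * (c * y ^ 2)"
    using assms(1) unfolding c by (auto simp: algebra_simps)
  hence "p dvd x ^ 2 - 2 \<or> p dvd x ^ 2 - (- 2)" by (metis dvd_triv_left)
  thus False using QuadResI nonresidues_p by blast
qed

lemma no_norm_m1: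
  assumes "x ^ 2 - d * y ^ 2 = - 1" "q dvd d"
  shows False
proof -
  obtain c where c: "d = q * c" using assms(2) by auto
  have "x ^ 2 - (- 1) = q * (c * y ^ 2)" using assms(1) unfolding c by (simp add: algebra_simps)
  hence "q dvd x ^ 2 - (- 1)" by (metis dvd_triv_left)
  thus False using QuadResI nonresidues_q by blast
qed

lemma no_norm_m2:
  assumes "x ^ 2 - d * y ^ 2 = - 2" "q dvd d"
  shows False
proof -
  obtain c where c: "d = q * c" using assms(2) by auto
  have "x ^ 2 - (- 2) = q * (c * y ^ 2)" using assms(1) unfolding c by (simp add: algebra_simps)
  hence "q dvd x ^ 2 - (- 2)" by (metis dvd_triv_left)
  thus False using QuadResI nonresidues_q by blast
qed

section \<open>The shape of each of the seven fundamental units\<close>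

text \<open>The only candidates 1, 2 and 4 all reduce to the class of 1, so norm 1 is
  impossible.\<close>

lemma fund_unit_2:
  obtains x y :: int where "fund_unit 2 = of_int x + of_int y * r2" "x ^ 2 - 2 * y ^ 2 = - 1"
proof -
  interpret Q: real_quadratic 2 by (rule real_quadratics)
  have s: "Q.s = r2" by (simp add: Q.s_def r2_def)
  have "\<not> Q.sqm m" if m: "m > 0" "m dvd 2 * 2" for m
  proof -
    have "m = 1 \<or> m = 2 \<or> m = 1 * 2 ^ 2"
      using dvd_prime_prime_cases[of 2 2 m] m by auto
    thus ?thesis using Q.not_sqm_1 Q.sqm_square[of 1 2] Q.sqm_dual[of 2 1 1] by auto
  qed
  hence "Q.e * Q.cj Q.e = - 1" using Q.norm_dichotomy by blast
  from Q.norm_eq_m1_form_int[OF this] s that show ?thesis by auto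
qed

text \<open>All candidates reduce to the class 1 or 2, and the latter would make 8 or -8 a square
  modulo \<open>p\<close>.\<close>

lemma fund_unit_p:
  obtains x y :: int where "fund_unit p = (of_int x + of_int y * rp) / 2" "x ^ 2 - p * y ^ 2 = - 4"
proof -
  interpret Q: real_quadratic p by (rule real_quadratics)
  have s: "Q.s = rp" by (simp add: Q.s_def rp_def)
  have "\<not> Q.sqm m" if m: "m > 0" "m dvd 2 * p" for m
  proof
    assume sq: "Q.sqm m"
    have "m = 1 \<or> m = p \<or> m = 2 \<or> m = 2 * p"
      using dvd_prime_prime_cases[of 2 p m] prime_p m by auto
    hence "Q.sqm 2" using sq Q.not_sqm_1 Q.sqm_dual[of p 1 1] Q.sqm_dual[of "2 * p" 2 2] p_gt_2 by auto
    then obtain x y where "x ^ 2 - p * y ^ 2 = 4 * 2 \<or> x ^ 2 - p * y ^ 2 = - 4 * 2"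
      by (rule Q.sqm_form) auto
    hence "x ^ 2 - 8 = p * y ^ 2 \<or> x ^ 2 - (- 8) = p * y ^ 2" by auto
    hence "p dvd x ^ 2 - 8 \<or> p dvd x ^ 2 - (- 8)" by (metis dvd_triv_left)
    thus False using QuadResI nonresidues_p by blast
  qed
  hence "Q.e * Q.cj Q.e = - 1" using Q.norm_dichotomy by blast
  from Q.norm_eq_m1_form[OF this] s that show ?thesis by auto
qed

lemma fund_unit_2p:
  obtains x y :: int where "fund_unit (2 * p) = of_int x + of_int y * (r2 * rp)" "x ^ 2 - 2 * p * y ^ 2 = - 1"
proof -
  interpret Q: real_quadratic "2 * p" by (rule real_quadratics)
  have s: "Q.s = r2 * rp" by (simp add: Q.s_def r2_def rp_def real_sqrt_mult)
  have d4: "2 * p mod 4 = 2" using p_mod_4 by presburger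
  have "\<not> Q.sqm m" if m: "m > 0" "m dvd 2 * (2 * p)" for m
  proof
    assume sq: "Q.sqm m"
    obtain b where b: "b > 0" "b dvd 2 * p" "m = b \<or> m = 2 * b" using dvd_2_mult[OF m(2,1)] by metis
    have "b = 1 \<or> b = p \<or> b = 2 \<or> b = 2 * p"
      using dvd_prime_prime_cases[of 2 p b] prime_p b by auto
    hence "m = 1 \<or> m = p \<or> m = 2 \<or> m = 2 * p \<or> m = 1 * 2 ^ 2 \<or> m = p * 2 ^ 2"
      using b(3) by auto
    hence "Q.sqm 2" using sq Q.not_sqm_1 Q.sqm_dual[of p 2 1] Q.sqm_dual[of "2 * p" 1 1]
      Q.sqm_square[of 1 2] Q.sqm_square[of p 2] p_gt_2 by auto
    then obtain x y where "x ^ 2 - 2 * p * y ^ 2 = 2 \<or> x ^ 2 - 2 * p * y ^ 2 = - 2"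
      by (rule Q.sqm_form_int) (use d4 in auto)
    thus False by (rule no_norm_pm2) simp
  qed
  hence "Q.e * Q.cj Q.e = - 1" using Q.norm_dichotomy by blast
  from Q.norm_eq_m1_form_int[OF this] s d4 that show ?thesis by auto
qed

text \<open>Norm -1 fails because -1 is a nonresidue modulo \<open>q\<close>. Of the classes only 2
  survives, and its sign is fixed because -2 is a nonresidue modulo \<open>q\<close>.\<close>

lemma fund_unit_q:
  obtains x y :: int where "(of_int x + of_int y * rq) ^ 2 = 2 * fund_unit q" "x ^ 2 - q * y ^ 2 = 2"
proof -
  interpret Q: real_quadratic q by (rule real_quadratics)
  have s: "Q.s = rq" by (simp add: Q.s_def rq_def)
  have "Q.e * Q.cj Q.e \<noteq> - 1"
    using Q.norm_eq_m1_form_int q_mod_4 no_norm_m1 by (metis dvd_refl)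
  then obtain m where m: "m > 0" "m dvd 2 * q" "Q.sqm m" using Q.norm_dichotomy by blast
  have "m = 1 \<or> m = q \<or> m = 2 \<or> m = 2 * q"
    using dvd_prime_prime_cases[of 2 q m] prime_q m by auto
  hence "Q.sqm 2" using m(3) Q.not_sqm_1 Q.sqm_dual[of q 1 1] Q.sqm_dual[of "2 * q" 2 2] q_gt_2 by auto
  then obtain x y where xy: "(of_int x + of_int y * Q.s) ^ 2 = of_int 2 * Q.e"
    "x ^ 2 - q * y ^ 2 = 2 \<or> x ^ 2 - q * y ^ 2 = - 2"
    by (rule Q.sqm_form_int) (use q_mod_4 in auto)
  hence "x ^ 2 - q * y ^ 2 = 2" using no_norm_m2[of x q y] by auto
  with xy s that show ?thesis by auto
qed

lemma fund_unit_2q: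
  obtains x y :: int where "(of_int x + of_int y * (r2 * rq)) ^ 2 = 2 * fund_unit (2 * q)" "x ^ 2 - 2 * q * y ^ 2 = 2"
proof -
  interpret Q: real_quadratic "2 * q" by (rule real_quadratics)
  have s: "Q.s = r2 * rq" by (simp add: Q.s_def r2_def rq_def real_sqrt_mult)
  have d4: "2 * q mod 4 = 2" using q_mod_4 by presburger
  have "Q.e * Q.cj Q.e \<noteq> - 1"
    using Q.norm_eq_m1_form_int d4 no_norm_m1 by (metis dvd_triv_right)
  then obtain m where m: "m > 0" "m dvd 2 * (2 * q)" "Q.sqm m" using Q.norm_dichotomy by blast
  obtain b where b: "b > 0" "b dvd 2 * q" "m = b \<or> m = 2 * b" using dvd_2_mult[OF m(2,1)] by metis
  have "b = 1 \<or> b = q \<or> b = 2 \<or> b = 2 * q"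
    using dvd_prime_prime_cases[of 2 q b] prime_q b by auto
  hence "m = 1 \<or> m = q \<or> m = 2 \<or> m = 2 * q \<or> m = 1 * 2 ^ 2 \<or> m = q * 2 ^ 2"
    using b(3) by auto
  hence "Q.sqm 2" using m(3) Q.not_sqm_1 Q.sqm_dual[of q 2 1] Q.sqm_dual[of "2 * q" 1 1]
    Q.sqm_square[of 1 2] Q.sqm_square[of q 2] q_gt_2 by auto
  then obtain x y where xy: "(of_int x + of_int y * Q.s) ^ 2 = of_int 2 * Q.e"
    "x ^ 2 - 2 * q * y ^ 2 = 2 \<or> x ^ 2 - 2 * q * y ^ 2 = - 2"
    by (rule Q.sqm_form_int) (use d4 in auto)
  hence "x ^ 2 - 2 * q * y ^ 2 = 2" using no_norm_m2[of x "2 * q" y] by auto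
  with xy s that show ?thesis by auto
qed

text \<open>Up to duality and squares the class is 1, 2, p or 2 p. Minimality excludes 1, and
  reduction modulo \<open>p\<close> excludes 2. For p the equation p z^2 - q y^2 = 1 fails modulo
  \<open>q\<close>, and with -1 it fails modulo \<open>p\<close>. There remains 2 p, where the sign
  +2 fails modulo \<open>q\<close>.\<close>

lemma fund_unit_pq:
  obtains x y :: int where "(of_int x * rp + of_int y * rq) ^ 2 = 2 * fund_unit (p * q)" "q * y ^ 2 - p * x ^ 2 = 2"
proof -
  interpret Q: real_quadratic "p * q" by (rule real_quadratics)
  have s: "Q.s = rp * rq" by (simp add: Q.s_def rp_def rq_def real_sqrt_mult)
  have p0: "p \<noteq> 0" using p_gt_2 by simp
  have d4: "p * q mod 4 = 3" using p_mod_4 q_mod_4 by (simp add: mod_mult_eq[of p 4 q, symmetric])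
  have "Q.e * Q.cj Q.e \<noteq> - 1"
    using Q.norm_eq_m1_form_int d4 no_norm_m1 by (metis dvd_triv_right)
  then obtain m where m: "m > 0" "m dvd 2 * (p * q)" "Q.sqm m" using Q.norm_dichotomy by blast
  obtain b where b: "b > 0" "b dvd p * q" "m = b \<or> m = 2 * b" using dvd_2_mult[OF m(2,1)] by metis
  have c: "b = 1 \<or> b = q \<or> b = p \<or> b = p * q"
    by (rule dvd_prime_prime_cases[OF prime_p prime_q b(2,1)])
  have "m = 1 \<or> m = q \<or> m = p \<or> m = p * q \<or> m = 2 \<or> m = 2 * q \<or> m = 2 * p \<or> m = 2 * (p * q)"
    using c b(3) by auto
  hence "Q.sqm p \<or> Q.sqm 2 \<or> Q.sqm (2 * p)"
    using m(3) Q.not_sqm_1 Q.sqm_dual[of "p * q" 1 1] Q.sqm_dual[of q p 1] Q.sqm_dual[of "2 * q" "2 * p" 2]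
      Q.sqm_dual[of "2 * (p * q)" 2 2] p_gt_2 q_gt_2 by auto
  moreover have "\<not> Q.sqm 2"
  proof
    assume "Q.sqm 2"
    then obtain x y where "x ^ 2 - p * q * y ^ 2 = 2 \<or> x ^ 2 - p * q * y ^ 2 = - 2"
      by (rule Q.sqm_form_int) (use d4 in auto)
    thus False by (rule no_norm_pm2) simp
  qed
  moreover have "\<not> Q.sqm p"
  proof
    assume "Q.sqm p"
    then obtain x y where xy: "x ^ 2 - p * q * y ^ 2 = p \<or> x ^ 2 - p * q * y ^ 2 = - p"
      by (rule Q.sqm_form_int) (use d4 p0 in auto)
    hence "p dvd x ^ 2" by (metis diff_add_cancel dvd_add dvd_minus_iff dvd_mult2 dvd_refl)
    hence "p dvd x" using prime_p by (metis prime_dvd_power)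
    then obtain z where z: "x = p * z" by auto
    have "p * (p * z ^ 2 - q * y ^ 2) = p * 1 \<or> p * (p * z ^ 2 - q * y ^ 2) = p * (- 1)"
      using xy unfolding z by (auto simp: algebra_simps power2_eq_square)
    hence "p * z ^ 2 - q * y ^ 2 = 1 \<or> p * z ^ 2 - q * y ^ 2 = - 1" using p0 by (simp only: mult_cancel_left) auto
    thus False
    proof
      assume *: "p * z ^ 2 - q * y ^ 2 = 1"
      have "(p * z) ^ 2 - p = p * (p * z ^ 2 - q * y ^ 2) + p * q * y ^ 2 - p" by (simp add: algebra_simps power2_eq_square)
      also have "\<dots> = q * (p * y ^ 2)" unfolding * by simp
      finally have "q dvd (p * z) ^ 2 - p" by simp
      thus False using QuadResI nonresidues_q by blast
    next
      assume *: "p * z ^ 2 - q * y ^ 2 = - 1"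
      have "(q * y) ^ 2 - q = - q * (p * z ^ 2 - q * y ^ 2) + p * q * z ^ 2 - q" by (simp add: algebra_simps power2_eq_square)
      also have "\<dots> = p * (q * z ^ 2)" unfolding * by simp
      finally have "p dvd (q * y) ^ 2 - q" by simp
      thus False using QuadResI nonresidue_p_q by blast
    qed
  qed
  ultimately have "Q.sqm (2 * p)" by blast
  then obtain x y where xy: "(of_int x + of_int y * Q.s) ^ 2 = of_int (2 * p) * Q.e"
    "x ^ 2 - p * q * y ^ 2 = 2 * p \<or> x ^ 2 - p * q * y ^ 2 = - (2 * p)"
    by (rule Q.sqm_form_int) (use d4 p0 in auto)
  hence "p dvd x ^ 2" by (metis diff_add_cancel dvd_add dvd_minus_iff dvd_mult dvd_mult2 dvd_refl)
  hence "p dvd x" using prime_p by (metis prime_dvd_power)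
  then obtain z where z: "x = p * z" by auto
  have "p * (p * z ^ 2 - q * y ^ 2) = p * 2 \<or> p * (p * z ^ 2 - q * y ^ 2) = p * (- 2)"
    using xy(2) unfolding z by (auto simp: algebra_simps power2_eq_square)
  hence "p * z ^ 2 - q * y ^ 2 = 2 \<or> p * z ^ 2 - q * y ^ 2 = - 2" using p0 by (simp only: mult_cancel_left) auto
  moreover have False if *: "p * z ^ 2 - q * y ^ 2 = 2"
  proof -
    have "(p * z) ^ 2 - 2 * p = p * (p * z ^ 2 - q * y ^ 2) + p * q * y ^ 2 - 2 * p" by (simp add: algebra_simps power2_eq_square)
    also have "\<dots> = q * (p * y ^ 2)" unfolding * by simp
    finally have "q dvd (p * z) ^ 2 - 2 * p" by simp
    thus False using QuadResI nonresidues_q by blast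
  qed
  ultimately have 2: "q * y ^ 2 - p * z ^ 2 = 2" by auto
  \<comment> \<open>Taking out the factor \<open>rp\<close> replaces the root of 2 p eps by a root
    of 2 eps, which no longer lies in the quadratic field but in the multiquadratic one.\<close>
  have "of_int x + of_int y * Q.s = rp * (of_int z * rp + of_int y * rq)"
    by (simp add: s z algebra_simps power2_eq_square flip: rp_sq)
  hence "of_int p * (of_int z * rp + of_int y * rq) ^ 2 = of_int p * (2 * Q.e)"
    using xy(1) by (simp add: power_mult_distrib rp_sq)
  hence "(of_int z * rp + of_int y * rq) ^ 2 = 2 * Q.e" using p0 by simp
  with 2 that show ?thesis by blast
qed

text \<open>Up to duality and squares the class is 1, 2, q or p. Class 2 fails modulo
  \<open>p\<close>; for q, the sign +1 fails modulo \<open>p\<close> and -1 modulo \<open>q\<close>;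
  for p the sign +1 fails modulo \<open>q\<close>. Since no factor 2 is left in the class, G needs
  no denominator \<open>r2\<close>, unlike A, B and C.\<close>

lemma fund_unit_2pq:
  obtains x y :: int where "(of_int x * rp + of_int y * (r2 * rq)) ^ 2 = fund_unit (2 * p * q)" "2 * q * y ^ 2 - p * x ^ 2 = 1"
proof -
  interpret Q: real_quadratic "2 * p * q" by (rule real_quadratics)
  have s: "Q.s = r2 * rp * rq" by (simp add: Q.s_def r2_def rp_def rq_def real_sqrt_mult)
  have p0: "p \<noteq> 0" "q \<noteq> 0" using p_gt_2 q_gt_2 by simp_all
  have "odd p" "odd q" using p_mod_4 q_mod_4 by presburger+
  hence "odd (p * q)" by simp
  then obtain k where "p * q = 2 * k + 1" by (rule oddE)
  hence "2 * p * q = 4 * k + 2" by simp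
  hence d4: "2 * p * q mod 4 = 2" by presburger
  have "Q.e * Q.cj Q.e \<noteq> - 1"
    using Q.norm_eq_m1_form_int d4 no_norm_m1 by (metis dvd_triv_right)
  then obtain m where m: "m > 0" "m dvd 2 * (2 * (p * q))" "Q.sqm m"
    using Q.norm_dichotomy unfolding mult.assoc by blast
  obtain b where b: "b > 0" "b dvd 2 * (p * q)" "m = b \<or> m = 2 * b" using dvd_2_mult[OF m(2,1)] by metis
  obtain n where n: "n > 0" "n dvd p * q" "b = n \<or> b = 2 * n" using dvd_2_mult[OF b(2,1)] by metis
  have "m = n \<or> m = 2 * n \<or> m = n * 2 ^ 2" using b(3) n(3) by auto
  hence "Q.sqm n \<or> Q.sqm (2 * n)" using m(3) Q.sqm_square[of n 2] by auto
  moreover have "n = 1 \<or> n = q \<or> n = p \<or> n = p * q"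
    by (rule dvd_prime_prime_cases[OF prime_p prime_q n(2,1)])
  ultimately have "Q.sqm q \<or> Q.sqm p \<or> Q.sqm 2"
    using Q.not_sqm_1 Q.sqm_dual[of "p * q" 2 1] Q.sqm_dual[of "2 * q" p 1] Q.sqm_dual[of "2 * p" q 1]
      Q.sqm_dual[of "2 * (p * q)" 1 1] p0 by auto
  moreover have "\<not> Q.sqm 2"
  proof
    assume "Q.sqm 2"
    then obtain x y where "x ^ 2 - 2 * p * q * y ^ 2 = 2 \<or> x ^ 2 - 2 * p * q * y ^ 2 = - 2"
      by (rule Q.sqm_form_int) (use d4 in auto)
    thus False by (rule no_norm_pm2) simp
  qed
  moreover have "\<not> Q.sqm q"
  proof
    assume "Q.sqm q"
    then obtain x y where xy: "x ^ 2 - 2 * p * q * y ^ 2 = q \<or> x ^ 2 - 2 * p * q * y ^ 2 = - q"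
      by (rule Q.sqm_form_int) (use d4 p0 in auto)
    hence "x ^ 2 = q * (1 + 2 * p * y ^ 2) \<or> x ^ 2 = q * (2 * p * y ^ 2 - 1)" by (auto simp: algebra_simps)
    hence "q dvd x ^ 2" by auto
    hence "q dvd x" using prime_q by (metis prime_dvd_power)
    then obtain z where z: "x = q * z" by auto
    have "q * (q * z ^ 2 - 2 * p * y ^ 2) = q * 1 \<or> q * (q * z ^ 2 - 2 * p * y ^ 2) = q * (- 1)"
      using xy unfolding z by (auto simp: algebra_simps power2_eq_square)
    hence "q * z ^ 2 - 2 * p * y ^ 2 = 1 \<or> q * z ^ 2 - 2 * p * y ^ 2 = - 1" using p0 by (simp only: mult_cancel_left) auto
    thus False
    proof
      assume *: "q * z ^ 2 - 2 * p * y ^ 2 = 1"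
      have "(q * z) ^ 2 - q = q * (q * z ^ 2 - 2 * p * y ^ 2) + 2 * p * q * y ^ 2 - q" by (simp add: algebra_simps power2_eq_square)
      also have "\<dots> = p * (2 * q * y ^ 2)" unfolding * by simp
      finally have "p dvd (q * z) ^ 2 - q" by simp
      thus False using QuadResI nonresidue_p_q by blast
    next
      assume *: "q * z ^ 2 - 2 * p * y ^ 2 = - 1"
      have "(2 * p * y) ^ 2 - 2 * p = - 2 * p * (q * z ^ 2 - 2 * p * y ^ 2) + 2 * p * q * z ^ 2 - 2 * p" by (simp add: algebra_simps power2_eq_square)
      also have "\<dots> = q * (2 * p * z ^ 2)" unfolding * by simp
      finally have "q dvd (2 * p * y) ^ 2 - 2 * p" by simp
      thus False using QuadResI nonresidues_q by blast
    qed
  qed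
  ultimately have "Q.sqm p" by blast
  then obtain x y where xy: "(of_int x + of_int y * Q.s) ^ 2 = of_int p * Q.e"
    "x ^ 2 - 2 * p * q * y ^ 2 = p \<or> x ^ 2 - 2 * p * q * y ^ 2 = - p"
    by (rule Q.sqm_form_int) (use d4 p0 in auto)
  hence "x ^ 2 = p * (1 + 2 * q * y ^ 2) \<or> x ^ 2 = p * (2 * q * y ^ 2 - 1)" by (auto simp: algebra_simps)
  hence "p dvd x ^ 2" by auto
  hence "p dvd x" using prime_p by (metis prime_dvd_power)
  then obtain z where z: "x = p * z" by auto
  have "p * (p * z ^ 2 - 2 * q * y ^ 2) = p * 1 \<or> p * (p * z ^ 2 - 2 * q * y ^ 2) = p * (- 1)"
    using xy(2) unfolding z by (auto simp: algebra_simps power2_eq_square)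
  hence "p * z ^ 2 - 2 * q * y ^ 2 = 1 \<or> p * z ^ 2 - 2 * q * y ^ 2 = - 1" using p0 by (simp only: mult_cancel_left) auto
  moreover have False if *: "p * z ^ 2 - 2 * q * y ^ 2 = 1"
  proof -
    have "(p * z) ^ 2 - p = p * (p * z ^ 2 - 2 * q * y ^ 2) + 2 * p * q * y ^ 2 - p" by (simp add: algebra_simps power2_eq_square)
    also have "\<dots> = q * (2 * p * y ^ 2)" unfolding * by simp
    finally have "q dvd (p * z) ^ 2 - p" by simp
    thus False using QuadResI nonresidues_q by blast
  qed
  ultimately have 2: "2 * q * y ^ 2 - p * z ^ 2 = 1" by auto
  have "of_int x + of_int y * Q.s = rp * (of_int z * rp + of_int y * (r2 * rq))"
    unfolding s by (simp add: z algebra_simps power2_eq_square flip: rp_sq)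
  hence "of_int p * (of_int z * rp + of_int y * (r2 * rq)) ^ 2 = of_int p * Q.e"
    using xy(1) by (simp add: power_mult_distrib rp_sq)
  hence "(of_int z * rp + of_int y * (r2 * rq)) ^ 2 = Q.e" using p0 by simp
  with 2 that show ?thesis by blast
qed

end

section \<open>The multiquadratic fields and their automorphisms\<close>

lemma diff_eq_add_imp_0:
  fixes a y :: complex
  assumes "a - y = a + y"
  shows "y = 0"
proof -
  have "2 * y = (a + y) - (a - y)" by simp
  also have "\<dots> = 0" using assms by simp
  finally show ?thesis by simp
qed

text \<open>Together with \<open>gen_field_least\<close> this reduces identities between
  automorphisms, and invariance under them, to a check on generators.\<close>

lemma is_subfield_equalizer:
  assumes F: "is_subfield F" and f: "hom_on F f" and g: "hom_on F g"
  shows "is_subfield {x \<in> F. f x = g x}"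
proof -
  note cl = subfield_0[OF F] subfield_1[OF F] subfield_add[OF F] subfield_mult[OF F]
    subfield_minus[OF F] subfield_inverse[OF F]
  note h = hom_0[OF F] hom_1[OF F] hom_add[OF F] hom_mult[OF F] hom_minus[OF F] hom_inverse[OF F]
  show ?thesis
    unfolding is_subfield_def
  proof (intro conjI ballI)
    show "0 \<in> {x \<in> F. f x = g x}" "1 \<in> {x \<in> F. f x = g x}"
      using cl(1,2) h(1,2)[OF f] h(1,2)[OF g] by simp_all
    fix x assume x: "x \<in> {x \<in> F. f x = g x}"
    show "- x \<in> {x \<in> F. f x = g x}" "inverse x \<in> {x \<in> F. f x = g x}"
      using x h(5,6)[OF f, of x] h(5,6)[OF g, of x] cl(5,6)[of x] by simp_all
    fix y assume y: "y \<in> {x \<in> F. f x = g x}"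
    show "x + y \<in> {x \<in> F. f x = g x}" "x * y \<in> {x \<in> F. f x = g x}"
      using x y h(3,4)[OF f, of x y] h(3,4)[OF g, of x y] cl(3,4)[of x y] by simp_all
  qed
qed

lemma is_subfield_preimage:
  assumes F: "is_subfield F" and f: "hom_on F f" and E: "is_subfield E"
  shows "is_subfield {x \<in> F. f x \<in> E}"
proof -
  note cl = subfield_0 subfield_1 subfield_add subfield_mult subfield_minus subfield_inverse
  note h = hom_0[OF F f] hom_1[OF F f] hom_add[OF F f] hom_mult[OF F f] hom_minus[OF F f] hom_inverse[OF F f]
  show ?thesis
    unfolding is_subfield_def
  proof (intro conjI ballI)
    show "0 \<in> {x \<in> F. f x \<in> E}" "1 \<in> {x \<in> F. f x \<in> E}"
      using cl(1,2)[OF F] cl(1,2)[OF E] h(1,2) by simp_all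
    fix x assume x: "x \<in> {x \<in> F. f x \<in> E}"
    show "- x \<in> {x \<in> F. f x \<in> E}" "inverse x \<in> {x \<in> F. f x \<in> E}"
      using x h(5,6)[of x] cl(5,6)[OF F, of x] cl(5,6)[OF E, of "f x"] by simp_all
    fix y assume y: "y \<in> {x \<in> F. f x \<in> E}"
    show "x + y \<in> {x \<in> F. f x \<in> E}" "x * y \<in> {x \<in> F. f x \<in> E}"
      using x y h(3,4)[of x y] cl(3,4)[OF F, of x y] cl(3,4)[OF E, of "f x" "f y"] by simp_all
  qed
qed

context pq_primes
begin

definition F1 :: "complex set" where "F1 = qadj \<rat> r2"
definition F2 :: "complex set" where "F2 = qadj F1 rp"
definition Kp :: "complex set" where "Kp = qadj F2 rq"
definition K :: "complex set" where "K = qadj Kp \<i>"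

lemma rr_real: "r2 \<in> \<real>" "rp \<in> \<real>" "rq \<in> \<real>"
  by (simp_all add: r2_def rp_def rq_def)

lemma is_subfield_Reals: "is_subfield \<real>"
  by (auto simp: is_subfield_def)

lemma not_dvd: "\<not> p dvd 4" "\<not> q dvd 8 * p"
proof -
  have 1: "\<not> p dvd 2" "\<not> q dvd 2" using p_gt_2 q_gt_2 by (auto dest!: zdvd_imp_le)
  have 2: "\<not> q dvd p" using primes_dvd_imp_eq[OF prime_q prime_p] p_ne_q by blast
  show "\<not> p dvd 4" using 1(1) prime_dvd_power[OF prime_p, of 2 2] by auto
  have "\<not> q dvd 2 ^ 3" using 1(2) prime_dvd_power[OF prime_q, of 2 3] by blast
  thus "\<not> q dvd 8 * p" using 2 prime_dvd_mult_iff[OF prime_q, of 8 p] by simp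
qed

text \<open>The generators are adjoined in an order in which each new odd prime is unramified so
  far: the bounds 4, 8 p and 16 p q arise by multiplying with 2 d at each step. The last step is
  nontrivial because the field below it is real.\<close>

lemma tower:
  shows F1: "is_subfield F1" "r2 \<notin> \<rat>" "r2 ^ 2 \<in> \<rat>" "unram_outside F1 4" "gen_field {r2} = F1"
    and F2: "is_subfield F2" "rp \<notin> F1" "rp ^ 2 \<in> F1" "unram_outside F2 (8 * p)" "gen_field {rp, r2} = F2"
    and Kp: "is_subfield Kp" "rq \<notin> F2" "rq ^ 2 \<in> F2" "unram_outside Kp (16 * p * q)" "gen_field {rq, rp, r2} = Kp"
    and Kp_real: "Kp \<subseteq> \<real>"
    and K: "is_subfield K" "\<i> \<notin> Kp" "\<i> ^ 2 \<in> Kp" "gen_field {\<i>, rq, rp, r2} = K"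
proof -
  have r2: "r2 ^ 2 = of_int 2" by (simp add: r2_sq)
  show 1: "r2 \<notin> \<rat>"
    by (rule sqrt_notin[OF is_subfield_Rats unram_outside_Rats _ _ squarefree_facts(1) r2, of 2]) auto
  show 2: "r2 ^ 2 \<in> \<rat>" by (simp add: r2)
  show 3: "is_subfield F1" unfolding F1_def by (rule is_subfield_qadj[OF is_subfield_Rats 1 2])
  show 4: "unram_outside F1 4" unfolding F1_def
    using unram_outside_qadj[OF is_subfield_Rats unram_outside_Rats 1 r2] by simp
  show 5: "gen_field {r2} = F1" unfolding F1_def
    by (rule gen_field_insert[OF is_subfield_Rats 1 2 gen_field_empty])
  show 6: "rp \<notin> F1"
    by (rule sqrt_notin[OF 3 4 prime_p dvd_refl squarefree_facts(2) rp_sq not_dvd(1)])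
  show 7: "rp ^ 2 \<in> F1" unfolding rp_sq by (rule subfield_of_int[OF 3])
  show 8: "is_subfield F2" unfolding F2_def by (rule is_subfield_qadj[OF 3 6 7])
  show 9: "unram_outside F2 (8 * p)" unfolding F2_def
    using unram_outside_qadj[OF 3 4 6 rp_sq] by (simp add: mult_ac)
  show 10: "gen_field {rp, r2} = F2" unfolding F2_def
    by (rule gen_field_insert[OF 3 6 7 5])
  show 11: "rq \<notin> F2"
    by (rule sqrt_notin[OF 8 9 prime_q dvd_refl squarefree_facts(3) rq_sq not_dvd(2)])
  show 12: "rq ^ 2 \<in> F2" unfolding rq_sq by (rule subfield_of_int[OF 8])
  show 13: "is_subfield Kp" unfolding Kp_def by (rule is_subfield_qadj[OF 8 11 12])
  show 14: "unram_outside Kp (16 * p * q)" unfolding Kp_def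
    using unram_outside_qadj[OF 8 9 11 rq_sq] by (simp add: mult_ac)
  show 15: "gen_field {rq, rp, r2} = Kp" unfolding Kp_def
    by (rule gen_field_insert[OF 8 11 12 10])
  show 16: "Kp \<subseteq> \<real>"
    unfolding 15[symmetric] using rr_real by (intro gen_field_least is_subfield_Reals) auto
  show 17: "\<i> \<notin> Kp" using 16 by (auto simp: complex_is_Real_iff)
  show 18: "\<i> ^ 2 \<in> Kp" using subfield_minus[OF 13 subfield_1[OF 13]] by simp
  show 19: "is_subfield K" unfolding K_def by (rule is_subfield_qadj[OF 13 17 18])
  show 20: "gen_field {\<i>, rq, rp, r2} = K" unfolding K_def
    by (rule gen_field_insert[OF 13 17 18 15])
qed

lemma F1_subset: "F1 \<subseteq> F2"
  unfolding F2_def by (rule qadj_superset[OF F1(1) F2(2,3)])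

lemma F2_subset: "F2 \<subseteq> Kp"
  unfolding Kp_def by (rule qadj_superset[OF F2(1) Kp(2,3)])

lemma Kp_subset: "Kp \<subseteq> K"
  unfolding K_def by (rule qadj_superset[OF Kp(1) K(2,3)])

lemma gens_Kp: "r2 \<in> Kp" "rp \<in> Kp" "rq \<in> Kp"
  using gen_field_superset[of "{rq, rp, r2}"] unfolding Kp(5) by simp_all

lemma gens_K: "r2 \<in> K" "rp \<in> K" "rq \<in> K" "\<i> \<in> K"
  using gen_field_superset[of "{\<i>, rq, rp, r2}"] unfolding K(4) by simp_all

lemmas clKp = subfield_closed[OF Kp(1)]
lemmas clK = subfield_closed[OF K(1)]

lemma hom_eqI:
  assumes f: "hom_on K f" and g: "hom_on K g"
    and eq: "f r2 = g r2" "f rp = g rp" "f rq = g rq" "f \<i> = g \<i>" and x: "x \<in> K"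
  shows "f x = g x"
proof -
  let ?S = "{x \<in> K. f x = g x}"
  have "is_subfield ?S" by (rule is_subfield_equalizer[OF K(1) f g])
  hence "gen_field {\<i>, rq, rp, r2} \<subseteq> ?S"
    by (rule gen_field_least) (use eq gens_K in simp_all)
  thus ?thesis using x unfolding K(4) by auto
qed

lemma hom_image:
  assumes f: "hom_on K f" and "f r2 \<in> E" "f rp \<in> E" "f rq \<in> E" and E: "is_subfield E" and x: "x \<in> Kp"
  shows "f x \<in> E"
proof -
  let ?S = "{x \<in> K. f x \<in> E}"
  have "is_subfield ?S" by (rule is_subfield_preimage[OF K(1) f E])
  hence "Kp \<subseteq> ?S" unfolding Kp(5)[symmetric]
    by (rule gen_field_least) (use assms gens_K in simp_all)
  thus ?thesis using x by auto
qed

lemma hom_image_K: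
  assumes f: "hom_on K f" and "f r2 \<in> K" "f rp \<in> K" "f rq \<in> K" "f \<i> \<in> K" and x: "x \<in> K"
  shows "f x \<in> K"
proof -
  let ?S = "{x \<in> K. f x \<in> K}"
  have "is_subfield ?S" by (rule is_subfield_preimage[OF K(1) f K(1)])
  hence "gen_field {\<i>, rq, rp, r2} \<subseteq> ?S"
    by (rule gen_field_least) (use assms gens_K in simp_all)
  thus ?thesis using x unfolding K(4) by auto
qed

text \<open>Each layer of the tower permits an independent choice of sign, by
  \<open>hom_extend\<close>; the choice at the last layer is to fix the imaginary unit.\<close>

lemma galois_exists:
  assumes "a ^ 2 = 1" "b ^ 2 = 1" "c ^ 2 = (1 :: complex)"
  shows "\<exists>f. hom_on K f \<and> f r2 = a * r2 \<and> f rp = b * rp \<and> f rq = c * rq \<and> f \<i> = \<i>"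
proof -
  obtain f1 where f1: "hom_on F1 f1" "f1 r2 = a * r2"
    unfolding F1_def
    by (rule hom_extend[OF is_subfield_Rats F1(2,3) hom_on_id, of "a * r2"])
      (auto simp: power_mult_distrib assms)
  obtain f2 where f2: "hom_on F2 f2" "\<And>x. x \<in> F1 \<Longrightarrow> f2 x = f1 x" "f2 rp = b * rp"
    unfolding F2_def
    by (rule hom_extend[OF F1(1) F2(2,3) f1(1), of "b * rp"])
      (auto simp: power_mult_distrib assms rp_sq hom_of_int[OF F1(1) f1(1)])
  obtain f3 where f3: "hom_on Kp f3" "\<And>x. x \<in> F2 \<Longrightarrow> f3 x = f2 x" "f3 rq = c * rq"
    unfolding Kp_def
    by (rule hom_extend[OF F2(1) Kp(2,3) f2(1), of "c * rq"])
      (auto simp: power_mult_distrib assms rq_sq hom_of_int[OF F2(1) f2(1)])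
  have "\<i> ^ 2 = f3 (\<i> ^ 2)"
    using hom_minus[OF Kp(1) f3(1) subfield_1[OF Kp(1)]] hom_1[OF Kp(1) f3(1)] by simp
  then obtain f4 where f4: "hom_on K f4" "\<And>x. x \<in> Kp \<Longrightarrow> f4 x = f3 x" "f4 \<i> = \<i>"
    unfolding K_def
    by (rule hom_extend[OF Kp(1) K(2,3) f3(1), of \<i>]) auto
  have in1: "r2 \<in> F1" "rp \<in> F2"
    using gen_field_superset[of "{r2}"] gen_field_superset[of "{rp, r2}"] unfolding F1(5) F2(5) by simp_all
  have in2: "r2 \<in> F2" using in1 F1_subset by auto
  have "f4 r2 = a * r2" "f4 rp = b * rp" "f4 rq = c * rq"
    using f4(2)[OF gens_Kp(1)] f4(2)[OF gens_Kp(2)] f4(2)[OF gens_Kp(3)]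
      f3(2)[OF in2] f3(2)[OF in1(2)] f2(2)[OF in1(1)] f1(2) f2(3) f3(3) by simp_all
  thus ?thesis using f4(1,3) by (intro exI[of _ f4] conjI)
qed

section \<open>The Galois action on K\<close>

definition is_gal :: "(complex \<Rightarrow> complex) \<Rightarrow> complex \<Rightarrow> complex \<Rightarrow> complex \<Rightarrow> bool" where
  "is_gal f a b c \<longleftrightarrow> hom_on K f \<and> f r2 = a * r2 \<and> f rp = b * rp \<and> f rq = c * rq \<and> f \<i> = \<i>"

definition s2 :: "complex \<Rightarrow> complex" where "s2 = (SOME f. is_gal f (- 1) 1 1)"
definition sp :: "complex \<Rightarrow> complex" where "sp = (SOME f. is_gal f 1 (- 1) 1)"
definition sq :: "complex \<Rightarrow> complex" where "sq = (SOME f. is_gal f 1 1 (- 1))"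

lemma is_gal_exists:
  assumes "a ^ 2 = 1" "b ^ 2 = 1" "c ^ 2 = 1"
  shows "is_gal (SOME f. is_gal f a b c) a b c"
proof -
  have "\<exists>f. is_gal f a b c" unfolding is_gal_def by (rule galois_exists[OF assms])
  thus ?thesis by (rule someI_ex)
qed

lemma gal: "is_gal s2 (- 1) 1 1" "is_gal sp 1 (- 1) 1" "is_gal sq 1 1 (- 1)"
  unfolding s2_def sp_def sq_def by (rule is_gal_exists; simp)+

lemma hom_s2: "hom_on K s2" and s2_gens: "s2 r2 = - r2" "s2 rp = rp" "s2 rq = rq" "s2 \<i> = \<i>"
  using gal(1) by (simp_all add: is_gal_def)

lemma hom_sp: "hom_on K sp" and sp_gens: "sp r2 = r2" "sp rp = - rp" "sp rq = rq" "sp \<i> = \<i>"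
  using gal(2) by (simp_all add: is_gal_def)

lemma hom_sq: "hom_on K sq" and sq_gens: "sq r2 = r2" "sq rp = rp" "sq rq = - rq" "sq \<i> = \<i>"
  using gal(3) by (simp_all add: is_gal_def)

lemma cnj_gens: "cnj r2 = r2" "cnj rp = rp" "cnj rq = rq"
  by (simp_all add: r2_def rp_def rq_def)

lemma minus_gens: "- r2 \<in> K" "- rp \<in> K" "- rq \<in> K" "- \<i> \<in> K"
  by (rule clK(5), rule gens_K)+

lemma gal_K:
  assumes x: "x \<in> K"
  shows "s2 x \<in> K" "sp x \<in> K" "sq x \<in> K" "cnj x \<in> K"
proof -
  note simps = s2_gens sp_gens sq_gens cnj_gens gens_K minus_gens
  show "s2 x \<in> K" by (rule hom_image_K[OF hom_s2 _ _ _ _ x]) (simp_all add: simps)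
  show "sp x \<in> K" by (rule hom_image_K[OF hom_sp _ _ _ _ x]) (simp_all add: simps)
  show "sq x \<in> K" by (rule hom_image_K[OF hom_sq _ _ _ _ x]) (simp_all add: simps)
  show "cnj x \<in> K" by (rule hom_image_K[OF hom_on_cnj _ _ _ _ x]) (simp_all add: simps)
qed

lemma gal_Kp:
  assumes x: "x \<in> Kp"
  shows "s2 x \<in> Kp" "sp x \<in> Kp" "sq x \<in> Kp"
proof -
  note simps = s2_gens sp_gens sq_gens gens_Kp clKp(5)
  show "s2 x \<in> Kp" by (rule hom_image[OF hom_s2 _ _ _ Kp(1) x]) (simp_all add: simps)
  show "sp x \<in> Kp" by (rule hom_image[OF hom_sp _ _ _ Kp(1) x]) (simp_all add: simps)
  show "sq x \<in> Kp" by (rule hom_image[OF hom_sq _ _ _ Kp(1) x]) (simp_all add: simps)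
qed

lemma comp_hom:
  assumes "hom_on K f" "hom_on K g" "\<And>x. x \<in> K \<Longrightarrow> f x \<in> K"
  shows "hom_on K (\<lambda>x. g (f x))"
  by (rule hom_on_comp[OF assms(1,2)]) (use assms(3) in blast)

lemmas homs2 = hom_simps[OF K(1) hom_s2]
lemmas homsp = hom_simps[OF K(1) hom_sp]
lemmas homsq = hom_simps[OF K(1) hom_sq]

lemma gal_invol: "x \<in> K \<Longrightarrow> s2 (s2 x) = x" "x \<in> K \<Longrightarrow> sp (sp x) = x" "x \<in> K \<Longrightarrow> sq (sq x) = x"
proof -
  show "s2 (s2 x) = x" if "x \<in> K"
    by (rule hom_eqI[OF comp_hom[OF hom_s2 hom_s2] hom_on_id])
      (simp_all add: that gal_K s2_gens hom_minus[OF K(1) hom_s2] gens_K)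
  show "sp (sp x) = x" if "x \<in> K"
    by (rule hom_eqI[OF comp_hom[OF hom_sp hom_sp] hom_on_id])
      (simp_all add: that gal_K sp_gens hom_minus[OF K(1) hom_sp] gens_K)
  show "sq (sq x) = x" if "x \<in> K"
    by (rule hom_eqI[OF comp_hom[OF hom_sq hom_sq] hom_on_id])
      (simp_all add: that gal_K sq_gens hom_minus[OF K(1) hom_sq] gens_K)
qed

lemma gal_commute:
  assumes x: "x \<in> K"
  shows "sp (s2 x) = s2 (sp x)" "sq (s2 x) = s2 (sq x)" "sq (sp x) = sp (sq x)"
    "cnj (s2 x) = s2 (cnj x)" "cnj (sp x) = sp (cnj x)" "cnj (sq x) = sq (cnj x)"
proof -
  note simps = gal_K s2_gens sp_gens sq_gens hom_minus[OF K(1) hom_s2] hom_minus[OF K(1) hom_sp]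
    hom_minus[OF K(1) hom_sq] gens_K cnj_gens x
  show "sp (s2 x) = s2 (sp x)"
    by (rule hom_eqI[OF comp_hom[OF hom_s2 hom_sp] comp_hom[OF hom_sp hom_s2]]) (simp_all add: simps)
  show "sq (s2 x) = s2 (sq x)"
    by (rule hom_eqI[OF comp_hom[OF hom_s2 hom_sq] comp_hom[OF hom_sq hom_s2]]) (simp_all add: simps)
  show "sq (sp x) = sp (sq x)"
    by (rule hom_eqI[OF comp_hom[OF hom_sp hom_sq] comp_hom[OF hom_sq hom_sp]]) (simp_all add: simps)
  show "cnj (s2 x) = s2 (cnj x)"
    by (rule hom_eqI[OF comp_hom[OF hom_s2 hom_on_cnj] comp_hom[OF hom_on_cnj hom_s2]]) (simp_all add: simps)
  show "cnj (sp x) = sp (cnj x)"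
    by (rule hom_eqI[OF comp_hom[OF hom_sp hom_on_cnj] comp_hom[OF hom_on_cnj hom_sp]]) (simp_all add: simps)
  show "cnj (sq x) = sq (cnj x)"
    by (rule hom_eqI[OF comp_hom[OF hom_sq hom_on_cnj] comp_hom[OF hom_on_cnj hom_sq]]) (simp_all add: simps)
qed

lemma K_real: "x \<in> K \<Longrightarrow> cnj x = x \<Longrightarrow> x \<in> Kp"
proof -
  assume "x \<in> K" "cnj x = x"
  then obtain a b where ab: "a \<in> Kp" "b \<in> Kp" "x = a + b * \<i>" unfolding K_def by (elim qadjE)
  have "cnj a = a" "cnj b = b" using ab(1,2) Kp_real Reals_cnj_iff by blast+
  hence "cnj x = a - b * \<i>" unfolding ab(3) by simp
  hence "a - b * \<i> = a + b * \<i>" using ab(3) \<open>cnj x = x\<close> by metis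
  hence "b * \<i> = 0" by (rule diff_eq_add_imp_0)
  thus "x \<in> Kp" using ab by simp
qed

lemma Kp_cnj: "x \<in> Kp \<Longrightarrow> cnj x = x"
  using Kp_real Reals_cnj_iff by blast

text \<open>Each of the three automorphisms negates one generator and fixes the field below it, so
  invariance removes one coordinate per layer on the way down the tower.\<close>

lemma fixed_Rats:
  assumes x: "x \<in> Kp" and fixd: "s2 x = x" "sp x = x" "sq x = x"
  shows "x \<in> \<rat>"
proof -
  have id: "f y = y" if f: "hom_on K f" and S: "gen_field S = E" "S \<subseteq> K" "\<And>s. s \<in> S \<Longrightarrow> f s = s" and y: "y \<in> E"
    for f S E y
  proof -
    let ?S = "{x \<in> K. f x = x}"
    have "is_subfield ?S" by (rule is_subfield_equalizer[OF K(1) f hom_on_id])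
    hence "E \<subseteq> ?S" unfolding S(1)[symmetric] by (rule gen_field_least) (use S in auto)
    thus ?thesis using y by auto
  qed
  have id_sq: "sq y = y" if "y \<in> F2" for y
  proof (rule id[OF hom_sq F2(5) _ _ that])
    show "{rp, r2} \<subseteq> K" using gens_K by simp
    show "sq s = s" if "s \<in> {rp, r2}" for s using that sq_gens by blast
  qed
  have id_sp: "sp y = y" if "y \<in> F1" for y
  proof (rule id[OF hom_sp F1(5) _ _ that])
    show "{r2} \<subseteq> K" using gens_K by simp
    show "sp s = s" if "s \<in> {r2}" for s using that sp_gens by blast
  qed
  have sub: "F2 \<subseteq> K" "F1 \<subseteq> K" using F1_subset F2_subset Kp_subset by auto
  obtain a b where ab: "a \<in> F2" "b \<in> F2" "x = a + b * rq" using x unfolding Kp_def by (rule qadjE)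
  have "sq a = a" "sq b = b"
    using id_sq ab by simp_all
  moreover have "a \<in> K" "b \<in> K" using ab sub by auto
  ultimately have "sq x = a - b * rq"
    unfolding ab(3) by (simp add: hom_add[OF K(1) hom_sq] hom_mult[OF K(1) hom_sq] gens_K clK(4) sq_gens)
  hence "a - b * rq = a + b * rq" using fixd(3) ab(3) by metis
  hence "b * rq = 0" by (rule diff_eq_add_imp_0)
  hence x: "x \<in> F2" using ab Kp(2) subfield_0[OF F2(1)] by auto
  obtain a b where ab: "a \<in> F1" "b \<in> F1" "x = a + b * rp" using x unfolding F2_def by (rule qadjE)
  have "sp a = a" "sp b = b"
    using id_sp ab by simp_all
  moreover have "a \<in> K" "b \<in> K" using ab sub by auto
  ultimately have "sp x = a - b * rp"
    unfolding ab(3) by (simp add: hom_add[OF K(1) hom_sp] hom_mult[OF K(1) hom_sp] gens_K clK(4) sp_gens)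
  hence "a - b * rp = a + b * rp" using fixd(2) ab(3) by metis
  hence "b * rp = 0" by (rule diff_eq_add_imp_0)
  hence x: "x \<in> F1" using ab F2(2) subfield_0[OF F1(1)] by auto
  obtain a b where ab: "a \<in> \<rat>" "b \<in> \<rat>" "x = a + b * r2" using x unfolding F1_def by (rule qadjE)
  have "s2 a = a" "s2 b = b"
    using hom_Rats[OF K(1) hom_s2] ab by auto
  moreover have "a \<in> K" "b \<in> K" using ab subfield_Rats[OF K(1)] by auto
  ultimately have "s2 x = a - b * r2"
    unfolding ab(3) by (simp add: hom_add[OF K(1) hom_s2] hom_mult[OF K(1) hom_s2] gens_K clK(4) s2_gens)
  hence "a - b * r2 = a + b * r2" using fixd(1) ab(3) by metis
  hence "b * r2 = 0" by (rule diff_eq_add_imp_0)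
  thus "x \<in> \<rat>" using ab F1(2) by auto
qed


end

section \<open>Square classes\<close>

context pq_primes
begin

text \<open>For nonzero elements this is equality modulo squares of the multiplicative group of
  K+.\<close>

definition sqc :: "complex \<Rightarrow> complex \<Rightarrow> bool" where
  "sqc x y \<longleftrightarrow> (\<exists>t \<in> Kp. t \<noteq> 0 \<and> x = y * t ^ 2)"

lemma sqc_trans:
  assumes "sqc x y" "sqc y z"
  shows "sqc x z"
proof -
  obtain t u where "t \<in> Kp" "t \<noteq> 0" "x = y * t ^ 2" "u \<in> Kp" "u \<noteq> 0" "y = z * u ^ 2"
    using assms unfolding sqc_def by blast
  thus ?thesis unfolding sqc_def
    by (intro bexI[of _ "t * u"]) (simp_all add: power_mult_distrib clKp(4))
qed

lemma sqc_mult: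
  assumes "sqc x y" "sqc z w"
  shows "sqc (x * z) (y * w)"
proof -
  obtain t u where "t \<in> Kp" "t \<noteq> 0" "x = y * t ^ 2" "u \<in> Kp" "u \<noteq> 0" "z = w * u ^ 2"
    using assms unfolding sqc_def by blast
  thus ?thesis unfolding sqc_def
    by (intro bexI[of _ "t * u"]) (simp_all add: power_mult_distrib clKp(4))
qed

lemma sqc_refl: "sqc x x"
  unfolding sqc_def by (intro bexI[of _ 1]) (simp_all add: clKp(2))

text \<open>With t t' = n^2 and k = n or -n, the identity t (t + t' + 2 k) = (t + k)^2 moves the
  class of \<open>t\<close> into the field that contains the trace t + t' and
  \<open>n\<close>.\<close>

lemma sqc_trace:
  assumes "t \<in> Kp" "n \<in> Kp" "t' = n ^ 2 / t" "t \<noteq> 0"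
  obtains k where "k = n \<or> k = - n" "sqc t (t + t' + 2 * k)"
proof -
  \<comment> \<open>The sign of \<open>k\<close> must keep t + k nonzero; the two candidates add up
    to 2 t, so they do not both vanish.\<close>
  have "t + n \<noteq> 0 \<or> t + - n \<noteq> 0"
  proof (rule ccontr)
    assume "\<not> ?thesis"
    hence z: "t + n = 0" "t + - n = 0" by blast+
    have "(t + n) + (t + - n) = 0" unfolding z by simp
    thus False using assms(4) by simp
  qed
  then obtain k where k: "k = n \<or> k = - n" "t + k \<noteq> 0" by blast
  have eq: "t * (t + t' + 2 * k) = (t + k) ^ 2"
    using assms(3,4) k(1) by (auto simp: field_simps power2_eq_square)
  have "(t + t' + 2 * k) * (t / (t + k)) ^ 2 = t * (t + t' + 2 * k) * t / (t + k) ^ 2"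
    by (simp add: power_divide power2_eq_square)
  also have "\<dots> = t" unfolding eq using k(2) by simp
  finally have "t = (t + t' + 2 * k) * (t / (t + k)) ^ 2" ..
  moreover have "t / (t + k) \<in> Kp" using k(1) assms clKp(3,5,8) by metis
  ultimately have "sqc t (t + t' + 2 * k)" unfolding sqc_def
    using k(2) assms(4) by (intro bexI[of _ "t / (t + k)"]) auto
  thus ?thesis using k(1) that by blast
qed

definition psqrt :: "complex \<Rightarrow> complex" where
  "psqrt u = of_real (sqrt (Re u))"

definition pos :: "complex \<Rightarrow> bool" where
  "pos u \<longleftrightarrow> (\<exists>a>0. u = of_real a)"

lemma psqrt_sq:
  assumes "pos u"
  shows "psqrt u ^ 2 = u"
proof -
  obtain a where a: "a > 0" "u = of_real a" using assms unfolding pos_def by blast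
  have "psqrt u ^ 2 = of_real (sqrt a ^ 2)" unfolding psqrt_def a(2) of_real_power by simp
  also have "sqrt a ^ 2 = a" using a(1) by simp
  finally show ?thesis by (simp only: a(2))
qed

lemma pos_psqrt:
  assumes "pos u"
  shows "pos (psqrt u)"
proof -
  obtain a where a: "a > 0" "u = of_real a" using assms unfolding pos_def by blast
  have "psqrt u = of_real (sqrt a)" unfolding psqrt_def a(2) by simp
  thus ?thesis unfolding pos_def using a(1) real_sqrt_gt_zero by blast
qed

lemma pos_ne_0: "pos u \<Longrightarrow> u \<noteq> 0"
  unfolding pos_def by force

lemma pos_mult:
  assumes "pos u" "pos v"
  shows "pos (u * v)"
proof -
  obtain a b where "a > 0" "u = of_real a" "b > 0" "v = of_real b" using assms unfolding pos_def by blast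
  hence "a * b > 0" "u * v = of_real (a * b)" by simp_all
  thus ?thesis unfolding pos_def by blast
qed

lemma pos_square:
  assumes "u \<in> \<real>" "u \<noteq> 0"
  shows "pos (u ^ 2)"
proof -
  obtain a where a: "u = of_real a" using assms(1) by (rule Reals_cases)
  hence "a ^ 2 > 0" "u ^ 2 = of_real (a ^ 2)" using assms(2) by simp_all
  thus ?thesis unfolding pos_def by blast
qed

lemma pos_Re: "pos u \<Longrightarrow> Re u > 0"
  unfolding pos_def by force

lemma psqrt_cases: "pos u \<Longrightarrow> w ^ 2 = u \<Longrightarrow> psqrt u = w \<or> psqrt u = - w"
  using psqrt_sq[of u] power2_eq_iff[of "psqrt u" w] by simp

lemma psqrt_in: "pos u \<Longrightarrow> w ^ 2 = u \<Longrightarrow> w \<in> Kp \<Longrightarrow> psqrt u \<in> Kp"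
  using psqrt_cases[of u w] clKp(5)[of w] by auto

text \<open>The rational class is represented by a positive squarefree \<open>m\<close> with u m a
  square in K+. Integrality of 2 / u lets only primes dividing 16 p q times 2 occur in
  \<open>m\<close>, and their square roots lie in K+.\<close>

lemma sqc_rational:
  assumes u: "u \<in> Kp" "pos u" "algebraic_int u" "algebraic_int (2 / u)"
    and r: "sqc u r" "r \<in> \<rat>"
  shows "psqrt u \<in> Kp"
proof -
  obtain t where t: "t \<in> Kp" "t \<noteq> 0" "u = r * t ^ 2" using r(1) by (auto simp: sqc_def)
  obtain a b where ab: "b > 0" "r = of_int a / of_int b" using r(2) by (metis Rats_cases')
  have tr: "t \<in> \<real>" using t Kp_real by auto
  have pt: "pos (t ^ 2)" by (rule pos_square[OF tr t(2)])
  have "Re u = real_of_int a / of_int b * Re (t ^ 2)"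
  proof -
    have Re_mult: "Re (of_real c * z) = c * Re z" for c z by simp
    have "u = of_real (real_of_int a / of_int b) * t ^ 2" unfolding t(3) ab(2) by simp
    thus ?thesis by (simp only: Re_mult)
  qed
  hence "real_of_int a / of_int b * Re (t ^ 2) > 0" using pos_Re[OF u(2)] by simp
  hence "real_of_int a / of_int b > 0" using pos_Re[OF pt] by (simp only: zero_less_mult_iff) auto
  hence a: "a > 0" using ab(1) by (simp add: zero_less_divide_iff)
  \<comment> \<open>The fraction a / b and the integer a b differ by the square of b.\<close>
  define m where "m = squarefree_part (a * b)"
  define k where "k = square_part (a * b)"
  have mk: "a * b = m * k ^ 2" unfolding m_def k_def by (rule squarefree_decompose)
  have "m * k ^ 2 > 0" using a ab(1) unfolding mk[symmetric] by simp
  hence m: "m > 0" by (auto simp: zero_less_mult_iff)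
  define w where "w = of_int k * t / of_int b"
  have wK: "w \<in> Kp" using t by (simp add: w_def clKp)
  have "u * of_int b ^ 2 = of_int (a * b) * t ^ 2"
    unfolding t(3) ab(2) using ab(1) by (simp add: power2_eq_square)
  also have "of_int (a * b) = of_int m * (of_int k :: complex) ^ 2" unfolding mk by simp
  finally have uw: "u = of_int m * w ^ 2"
    using ab(1) by (simp add: w_def power_divide power_mult_distrib field_simps)
  hence w2: "(of_int m * w) ^ 2 = u * of_int m" by (simp add: power2_eq_square)
  have sf: "squarefree m" by (simp add: m_def)
  have "complex_of_real (sqrt (of_int m)) \<in> Kp"
  proof (rule sqrt_in_subfield[OF Kp(1) m])
    fix l assume l: "prime l" "l dvd m"
    have "l dvd 16 * p * q * 2"
      using unram_outside_dvd[OF Kp(1,4) l sf _ w2 pos_ne_0[OF u(2)] u(3), of 2] u(4) wK by (simp add: clKp)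
    also have "16 * p * q * 2 = 2 ^ 5 * (p * q)" by simp
    finally have "l dvd 2 ^ 5 \<or> l dvd p \<or> l dvd q" by (simp only: prime_dvd_mult_iff[OF l(1)])
    hence "l dvd 2 \<or> l dvd p \<or> l dvd q" using prime_dvd_power[OF l(1)] by blast
    moreover have "prime (2 :: int)" by simp
    ultimately have "l = 2 \<or> l = p \<or> l = q"
      using primes_dvd_imp_eq[OF l(1)] prime_p prime_q by blast
    thus "complex_of_real (sqrt (of_int l)) \<in> Kp" using gens_Kp by (auto simp: r2_def rp_def rq_def)
  qed
  moreover have "(complex_of_real (sqrt (of_int m)) * w) ^ 2 = u"
    using m by (simp add: power_mult_distrib uw flip: of_real_power)
  ultimately show ?thesis using psqrt_in[OF u(2) _ clKp(4)[OF _ wK]] by blast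
qed

text \<open>The norm from Q(sqrt 2) to Q, as a relation that carries membership in Q(sqrt 2) along
  and avoids naming coordinates.\<close>

definition nm :: "complex \<Rightarrow> complex \<Rightarrow> bool" where
  "nm z n \<longleftrightarrow> (\<exists>x\<in>\<rat>. \<exists>y\<in>\<rat>. z = x + y * r2 \<and> x ^ 2 - 2 * y ^ 2 = n)"

lemma nm_I: "x \<in> \<rat> \<Longrightarrow> y \<in> \<rat> \<Longrightarrow> x ^ 2 - 2 * y ^ 2 = n \<Longrightarrow> nm (x + y * r2) n"
  unfolding nm_def by blast

lemma nm_mult:
  assumes "nm z n" "nm w m"
  shows "nm (z * w) (n * m)"
proof -
  obtain x y x' y' where *: "x \<in> \<rat>" "y \<in> \<rat>" "z = x + y * r2" "x ^ 2 - 2 * y ^ 2 = n"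
    "x' \<in> \<rat>" "y' \<in> \<rat>" "w = x' + y' * r2" "x' ^ 2 - 2 * y' ^ 2 = m"
    using assms unfolding nm_def by blast
  have eq: "z * w = (x * x' + y * y' * r2 ^ 2) + (x * y' + x' * y) * r2"
    unfolding * by (simp add: algebra_simps power2_eq_square)
  have "nm ((x * x' + 2 * y * y') + (x * y' + x' * y) * r2) (n * m)"
  proof (rule nm_I)
    have "(x * x' + 2 * y * y') ^ 2 - 2 * (x * y' + x' * y) ^ 2 = (x ^ 2 - 2 * y ^ 2) * (x' ^ 2 - 2 * y' ^ 2)"
      by (simp add: algebra_simps power2_eq_square)
    thus "(x * x' + 2 * y * y') ^ 2 - 2 * (x * y' + x' * y) ^ 2 = n * m" by (simp only: *)
  qed (use * in simp_all)
  thus ?thesis unfolding eq r2_sq by (simp add: mult_ac)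
qed

text \<open>If the norm of \<open>z\<close> is a rational square, the trace identity over Q(sqrt 2)
  replaces \<open>z\<close> by a rational number, and \<open>sqc_rational\<close> applies.\<close>

lemma sqc_nm:
  assumes u: "u \<in> Kp" "pos u" "algebraic_int u" "algebraic_int (2 / u)"
    and z: "sqc u z" "nm z (r ^ 2)" and r: "r \<in> \<rat>"
  shows "psqrt u \<in> Kp"
proof -
  obtain x y where xy: "x \<in> \<rat>" "y \<in> \<rat>" "z = x + y * r2" "x ^ 2 - 2 * y ^ 2 = r ^ 2"
    using z unfolding nm_def by blast
  have z0: "z \<noteq> 0" using z(1) pos_ne_0[OF u(2)] by (auto simp: sqc_def)
  have "z * (x - y * r2) = x ^ 2 - y ^ 2 * r2 ^ 2" unfolding xy(3) by (simp add: algebra_simps power2_eq_square)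
  also have "\<dots> = r ^ 2" unfolding r2_sq using xy(4) by (simp add: mult_ac)
  finally have "x - y * r2 = r ^ 2 / z" using z0 by (simp add: field_simps)
  moreover have "z \<in> Kp" "r \<in> Kp" using xy r gens_Kp by (simp_all add: clKp subfield_Rats[OF Kp(1)])
  ultimately obtain k where k: "k = r \<or> k = - r" "sqc z (z + (x - y * r2) + 2 * k)"
    using sqc_trace[of z r "x - y * r2"] z0 by blast
  have "z + (x - y * r2) + 2 * k \<in> \<rat>" using k(1) xy r by auto
  thus ?thesis using sqc_rational[OF u sqc_trans[OF z(1) k(2)]] by blast
qed

end

section \<open>Explicit square roots of units\<close>

context pq_primes
begin

definition e2 :: complex where "e2 = fund_unit 2"
definition ep :: complex where "ep = fund_unit p"
definition e2p :: complex where "e2p = fund_unit (2 * p)"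
definition A :: complex where "A = psqrt (fund_unit q)"
definition B :: complex where "B = psqrt (fund_unit (2 * q))"
definition C :: complex where "C = psqrt (fund_unit (p * q))"
definition G :: complex where "G = psqrt (fund_unit (2 * p * q))"

lemma pos_fund_unit:
  assumes "real_quadratic d"
  shows "pos (fund_unit d)"
  unfolding pos_def
proof (intro exI conjI)
  show "0 < Re (fund_unit d)" using real_quadratic.fund_unit(3)[OF assms] by linarith
  show "fund_unit d = of_real (Re (fund_unit d))"
    by (rule real_quadratic.fund_unit_of_real[OF assms, symmetric])
qed

lemma pos_units: "pos e2" "pos ep" "pos e2p" "pos A" "pos B" "pos C" "pos G"
  unfolding e2_def ep_def e2p_def A_def B_def C_def G_def
  by (intro pos_psqrt pos_fund_unit real_quadratics)+

lemmas units_ne_0 = pos_units[THEN pos_ne_0]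

lemma units_sq: "A ^ 2 = fund_unit q" "B ^ 2 = fund_unit (2 * q)" "C ^ 2 = fund_unit (p * q)"
    "G ^ 2 = fund_unit (2 * p * q)"
  unfolding A_def B_def C_def G_def by (intro psqrt_sq pos_fund_unit real_quadratics)+

lemma e2_form: obtains x y :: int where "e2 = of_int x + of_int y * r2" "x ^ 2 - 2 * y ^ 2 = - 1"
  unfolding e2_def using fund_unit_2 by blast

lemma ep_form: obtains x y :: int where "ep = (of_int x + of_int y * rp) / 2" "x ^ 2 - p * y ^ 2 = - 4"
  unfolding ep_def using fund_unit_p by blast

lemma e2p_form:
  obtains x y :: int where "e2p = of_int x + of_int y * (r2 * rp)" "x ^ 2 - 2 * p * y ^ 2 = - 1"
  unfolding e2p_def using fund_unit_2p by blast

lemma r2_ne_0: "r2 \<noteq> 0" and rp_ne_0: "rp \<noteq> 0" and rq_ne_0: "rq \<noteq> 0"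
  using r2_sq rp_sq rq_sq p_gt_2 q_gt_2 by auto

lemma A_form: obtains x y :: int where "A * r2 = of_int x + of_int y * rq" "x ^ 2 - q * y ^ 2 = 2"
proof -
  obtain x y where xy: "(of_int x + of_int y * rq) ^ 2 = 2 * fund_unit q" "x ^ 2 - q * y ^ 2 = 2"
    by (rule fund_unit_q)
  have "(A * r2) ^ 2 = (of_int x + of_int y * rq) ^ 2"
    unfolding xy(1) by (simp add: power_mult_distrib units_sq r2_sq)
  hence "A * r2 = of_int x + of_int y * rq \<or> A * r2 = of_int (- x) + of_int (- y) * rq"
    by (simp add: power2_eq_iff)
  thus ?thesis using that[of x y] that[of "- x" "- y"] xy(2) by auto
qed

lemma B_form: obtains x y :: int where "B * r2 = of_int x + of_int y * (r2 * rq)" "x ^ 2 - 2 * q * y ^ 2 = 2"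
proof -
  obtain x y where xy: "(of_int x + of_int y * (r2 * rq)) ^ 2 = 2 * fund_unit (2 * q)" "x ^ 2 - 2 * q * y ^ 2 = 2"
    by (rule fund_unit_2q)
  have "(B * r2) ^ 2 = (of_int x + of_int y * (r2 * rq)) ^ 2"
    unfolding xy(1) by (simp add: power_mult_distrib units_sq r2_sq)
  hence "B * r2 = of_int x + of_int y * (r2 * rq) \<or> B * r2 = of_int (- x) + of_int (- y) * (r2 * rq)"
    by (simp add: power2_eq_iff)
  thus ?thesis using that[of x y] that[of "- x" "- y"] xy(2) by auto
qed

lemma C_form: obtains x y :: int where "C * r2 = of_int x * rp + of_int y * rq" "q * y ^ 2 - p * x ^ 2 = 2"
proof -
  obtain x y where xy: "(of_int x * rp + of_int y * rq) ^ 2 = 2 * fund_unit (p * q)" "q * y ^ 2 - p * x ^ 2 = 2"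
    by (rule fund_unit_pq)
  have "(C * r2) ^ 2 = (of_int x * rp + of_int y * rq) ^ 2"
    unfolding xy(1) by (simp add: power_mult_distrib units_sq r2_sq)
  hence "C * r2 = of_int x * rp + of_int y * rq \<or> C * r2 = of_int (- x) * rp + of_int (- y) * rq"
    by (simp add: power2_eq_iff)
  thus ?thesis using that[of x y] that[of "- x" "- y"] xy(2) by auto
qed

lemma G_form: obtains x y :: int where "G = of_int x * rp + of_int y * (r2 * rq)" "2 * q * y ^ 2 - p * x ^ 2 = 1"
proof -
  obtain x y where xy: "(of_int x * rp + of_int y * (r2 * rq)) ^ 2 = fund_unit (2 * p * q)" "2 * q * y ^ 2 - p * x ^ 2 = 1"
    by (rule fund_unit_2pq)
  have "G ^ 2 = (of_int x * rp + of_int y * (r2 * rq)) ^ 2"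
    unfolding xy(1) by (simp add: units_sq)
  hence "G = of_int x * rp + of_int y * (r2 * rq) \<or> G = of_int (- x) * rp + of_int (- y) * (r2 * rq)"
    by (simp add: power2_eq_iff)
  thus ?thesis using that[of x y] that[of "- x" "- y"] xy(2) by auto
qed

text \<open>In \<open>norm_A\<close>, \<open>norm_D\<close> and \<open>norm_E\<close> the left side
  is the norm from Q(sqrt 2) of an element produced by \<open>sqc_trace\<close>. Only its class
  modulo squares matters: Q, -1 and -Q respectively.\<close>

lemma norm_A:
  fixes X Y Q s :: complex
  assumes "X ^ 2 - Q * Y ^ 2 = 2" "s ^ 2 = 1"
  shows "(2 * X) ^ 2 - 2 * (2 * s) ^ 2 = 4 * Q * Y ^ 2"
proof -
  have "X ^ 2 = 2 + Q * Y ^ 2" using assms(1) by (simp add: algebra_simps)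
  thus ?thesis using assms(2) by (simp add: power_mult_distrib)
qed

lemma norm_D:
  fixes a b c d P k :: complex
  assumes "a ^ 2 - P * b ^ 2 = - 4" "c ^ 2 - 2 * P * d ^ 2 = - 1" "k ^ 2 = 1"
  shows "(a * c + 2 * k) ^ 2 - 2 * (b * d * P) ^ 2 = - ((a - 2 * k * c) ^ 2)"
proof -
  have eq: "P * b ^ 2 = a ^ 2 + 4" "2 * P * d ^ 2 = c ^ 2 + 1" using assms(1,2) by (simp_all add: algebra_simps)
  have "2 * (b * d * P) ^ 2 = (P * b ^ 2) * (2 * P * d ^ 2)" by (simp add: power_mult_distrib power2_eq_square)
  hence "2 * (b * d * P) ^ 2 = (a ^ 2 + 4) * (c ^ 2 + 1)" unfolding eq .
  hence "(a * c + 2 * k) ^ 2 - 2 * (b * d * P) ^ 2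
      = (a * c) ^ 2 + 4 * k * a * c + 4 * k ^ 2 - (a ^ 2 + 4) * (c ^ 2 + 1)"
    by (simp add: algebra_simps power2_eq_square)
  also have "\<dots> = - (a ^ 2 - 4 * k * a * c + 4 * k ^ 2 * c ^ 2)"
    unfolding assms(3) by (simp add: algebra_simps power2_eq_square)
  also have "\<dots> = - ((a - 2 * k * c) ^ 2)" by (simp add: algebra_simps power2_eq_square)
  finally show ?thesis .
qed

text \<open>A square on the right is what \<open>sqc_trace\<close> requires in order to descend from
  Q(sqrt 2, sqrt q) to Q(sqrt 2).\<close>

lemma norm_CG:
  fixes w z u v P Q :: complex
  assumes "Q * w ^ 2 - P * z ^ 2 = 2" "2 * Q * v ^ 2 - P * u ^ 2 = 1"
  shows "(2 - Q * w ^ 2) * (1 - 2 * Q * v ^ 2) = (P * z * u) ^ 2"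
proof -
  have "Q * w ^ 2 = 2 + P * z ^ 2" "2 * Q * v ^ 2 = 1 + P * u ^ 2" using assms by (simp_all add: algebra_simps)
  thus ?thesis by (simp add: power_mult_distrib power2_eq_square)
qed

lemma norm_E:
  fixes w z u v P Q s k m :: complex
  assumes "m ^ 2 = (P * z * u) ^ 2" "Q * w ^ 2 - P * z ^ 2 = 2" "2 * Q * v ^ 2 - P * u ^ 2 = 1"
    "s ^ 2 = 1" "k ^ 2 = 1"
  shows "(2 * m) ^ 2 - 2 * (2 * w * v * Q + 2 * s * k) ^ 2 = - (4 * Q * (w + 2 * (s * k) * v) ^ 2)"
proof -
  have sk: "(s * k) ^ 2 = 1" using assms(4,5) by (simp add: power_mult_distrib)
  have "m ^ 2 = (2 - Q * w ^ 2) * (1 - 2 * Q * v ^ 2)" using norm_CG[OF assms(2,3)] assms(1) by simp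
  hence "(2 * m) ^ 2 - 2 * (2 * w * v * Q + 2 * s * k) ^ 2
      = 4 * ((2 - Q * w ^ 2) * (1 - 2 * Q * v ^ 2)) - 8 * (w * v * Q + s * k) ^ 2"
    by (simp add: power_mult_distrib) (simp add: algebra_simps power2_eq_square)
  also have "\<dots> = 4 * ((2 - Q * w ^ 2) * (1 - 2 * Q * v ^ 2)) - 8 * (w * v * Q) ^ 2
      - 16 * w * v * Q * (s * k) - 8 * (s * k) ^ 2"
    by (simp add: algebra_simps power2_eq_square)
  also have "\<dots> = - (4 * Q * (w ^ 2 + 4 * w * v * (s * k) + 4 * (s * k) ^ 2 * v ^ 2))"
    unfolding sk by (simp add: algebra_simps power2_eq_square)
  also have "w ^ 2 + 4 * w * v * (s * k) + 4 * (s * k) ^ 2 * v ^ 2 = (w + 2 * (s * k) * v) ^ 2"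
    by (simp add: algebra_simps power2_eq_square)
  finally show ?thesis .
qed

lemma of_int_norm: "x ^ 2 - d * y ^ 2 = n \<Longrightarrow> complex_of_int x ^ 2 - of_int d * of_int y ^ 2 = of_int n"
  by (metis of_int_diff of_int_mult of_int_power)

lemma of_int_norm': "d * y ^ 2 - d' * x ^ 2 = n \<Longrightarrow> of_int d * complex_of_int y ^ 2 - of_int d' * of_int x ^ 2 = of_int n"
  by (metis of_int_diff of_int_mult of_int_power)

lemma inv_I: "a * b = (1 :: complex) \<Longrightarrow> b = inverse a"
  using inverse_unique by metis

lemmas gal_simps = homs2 homsp homsq s2_gens sp_gens sq_gens gens_K clK

section \<open>Galois action on the known units\<close>

text \<open>The norm equation says that a conjugate is the inverse up to sign. The signs collected
  here and for the other six units are the input of every later parity argument.\<close>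

lemma act_e2: "s2 e2 = - inverse e2" "sp e2 = e2" "sq e2 = e2" "e2 \<in> Kp"
proof -
  obtain x y where xy: "e2 = of_int x + of_int y * r2" "x ^ 2 - 2 * y ^ 2 = - 1" by (rule e2_form)
  have n: "complex_of_int x ^ 2 - 2 * of_int y ^ 2 = - 1" using of_int_norm[OF xy(2)] by simp
  show "sp e2 = e2" "sq e2 = e2" by (simp_all add: xy(1) gal_simps)
  show "e2 \<in> Kp" by (simp add: xy(1) gens_Kp clKp)
  have s: "s2 e2 = of_int x - of_int y * r2" by (simp add: xy(1) gal_simps)
  have "e2 * (- s2 e2) = - (of_int x ^ 2 - of_int y ^ 2 * r2 ^ 2)"
    unfolding s unfolding xy(1) by (simp add: algebra_simps power2_eq_square)
  also have "\<dots> = 1" using n by (simp add: r2_sq mult.commute)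
  finally have "- s2 e2 = inverse e2" by (rule inv_I)
  thus "s2 e2 = - inverse e2" by (metis minus_minus)
qed

lemma act_ep: "s2 ep = ep" "sp ep = - inverse ep" "sq ep = ep" "ep \<in> Kp"
proof -
  obtain x y where xy: "ep = (of_int x + of_int y * rp) / 2" "x ^ 2 - p * y ^ 2 = - 4" by (rule ep_form)
  have n: "complex_of_int x ^ 2 - of_int p * of_int y ^ 2 = - 4" using of_int_norm[OF xy(2)] by simp
  show "s2 ep = ep" "sq ep = ep" by (simp_all add: xy(1) gal_simps)
  show "ep \<in> Kp" by (simp add: xy(1) gens_Kp clKp)
  have s: "sp ep = (of_int x - of_int y * rp) / 2" by (simp add: xy(1) gal_simps)
  have "ep * (- sp ep) = - (of_int x ^ 2 - of_int y ^ 2 * rp ^ 2) / 4"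
    unfolding s unfolding xy(1) by (simp add: field_simps power2_eq_square)
  also have "\<dots> = 1" using n by (simp add: rp_sq mult.commute)
  finally have "- sp ep = inverse ep" by (rule inv_I)
  thus "sp ep = - inverse ep" by (metis minus_minus)
qed

lemma act_e2p: "s2 e2p = - inverse e2p" "sp e2p = - inverse e2p" "sq e2p = e2p" "e2p \<in> Kp"
proof -
  obtain x y where xy: "e2p = of_int x + of_int y * (r2 * rp)" "x ^ 2 - 2 * p * y ^ 2 = - 1" by (rule e2p_form)
  have n: "complex_of_int x ^ 2 - 2 * of_int p * of_int y ^ 2 = - 1" using of_int_norm[OF xy(2)] by simp
  show "sq e2p = e2p" by (simp add: xy(1) gal_simps)
  show "e2p \<in> Kp" by (simp add: xy(1) gens_Kp clKp)
  have s: "s2 e2p = of_int x - of_int y * (r2 * rp)" "sp e2p = of_int x - of_int y * (r2 * rp)"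
    by (simp_all add: xy(1) gal_simps)
  have "e2p * (- (of_int x - of_int y * (r2 * rp))) = - (of_int x ^ 2 - of_int y ^ 2 * (r2 ^ 2 * rp ^ 2))"
    unfolding xy(1) by (simp add: algebra_simps power2_eq_square)
  also have "\<dots> = 1" using n by (simp add: r2_sq rp_sq mult_ac)
  finally have "- (of_int x - of_int y * (r2 * rp)) = inverse e2p" by (rule inv_I)
  thus "s2 e2p = - inverse e2p" "sp e2p = - inverse e2p" unfolding s by (metis minus_minus)+
qed

text \<open>The sign under \<open>s2\<close> comes from the denominator \<open>r2\<close> of A; the
  inverse under \<open>sq\<close> comes from the norm equation.\<close>

lemma act_A: "s2 A = - A" "sp A = A" "sq A = inverse A" "A \<in> Kp"
proof -
  obtain x y where xy: "A * r2 = of_int x + of_int y * rq" "x ^ 2 - q * y ^ 2 = 2" by (rule A_form)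
  have n: "complex_of_int x ^ 2 - of_int q * of_int y ^ 2 = 2" using of_int_norm[OF xy(2)] by simp
  have A: "A = (of_int x + of_int y * rq) / r2" using xy(1) r2_ne_0 by (simp add: field_simps)
  show "s2 A = - A" "sp A = A" by (simp_all add: A gal_simps)
  show "A \<in> Kp" by (simp add: A gens_Kp clKp)
  have s: "sq A = (of_int x - of_int y * rq) / r2" by (simp add: A gal_simps)
  have "A * sq A = (of_int x ^ 2 - of_int y ^ 2 * rq ^ 2) / r2 ^ 2"
    unfolding s unfolding A by (simp add: algebra_simps power2_eq_square)
  also have "\<dots> = 1" using n by (simp add: r2_sq rq_sq mult.commute)
  finally show "sq A = inverse A" by (rule inv_I)
qed

lemma act_B: "s2 B = - inverse B" "sp B = B" "sq B = inverse B" "B \<in> Kp"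
proof -
  obtain x y where xy: "B * r2 = of_int x + of_int y * (r2 * rq)" "x ^ 2 - 2 * q * y ^ 2 = 2" by (rule B_form)
  have n: "complex_of_int x ^ 2 - 2 * of_int q * of_int y ^ 2 = 2" using of_int_norm[OF xy(2)] by simp
  have B: "B = (of_int x + of_int y * (r2 * rq)) / r2" using xy(1) r2_ne_0 by (simp add: field_simps)
  show "sp B = B" by (simp add: B gal_simps)
  show "B \<in> Kp" by (simp add: B gens_Kp clKp)
  have s: "sq B = (of_int x - of_int y * (r2 * rq)) / r2" "s2 B = - ((of_int x - of_int y * (r2 * rq)) / r2)"
    by (simp_all add: B gal_simps)
  have "B * ((of_int x - of_int y * (r2 * rq)) / r2) = (of_int x ^ 2 - of_int y ^ 2 * (r2 ^ 2 * rq ^ 2)) / r2 ^ 2"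
    unfolding B by (simp add: algebra_simps power2_eq_square)
  also have "\<dots> = 1" using n by (simp add: r2_sq rq_sq mult_ac)
  finally have "(of_int x - of_int y * (r2 * rq)) / r2 = inverse B" by (rule inv_I)
  thus "sq B = inverse B" "s2 B = - inverse B" unfolding s by simp_all
qed

lemma act_C: "s2 C = - C" "sp C = inverse C" "sq C = - inverse C" "C \<in> Kp"
proof -
  obtain x y where xy: "C * r2 = of_int x * rp + of_int y * rq" "q * y ^ 2 - p * x ^ 2 = 2" by (rule C_form)
  have n: "of_int q * complex_of_int y ^ 2 - of_int p * of_int x ^ 2 = 2" using of_int_norm'[OF xy(2)] by simp
  have C: "C = (of_int x * rp + of_int y * rq) / r2" using xy(1) r2_ne_0 by (simp add: field_simps)
  show "s2 C = - C" by (simp add: C gal_simps)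
  show "C \<in> Kp" by (simp add: C gens_Kp clKp)
  have s: "sp C = (of_int y * rq - of_int x * rp) / r2" "sq C = - ((of_int y * rq - of_int x * rp) / r2)"
    by (simp_all add: C gal_simps minus_divide_left)
  have "C * ((of_int y * rq - of_int x * rp) / r2) = (of_int y ^ 2 * rq ^ 2 - of_int x ^ 2 * rp ^ 2) / r2 ^ 2"
    unfolding C by (simp add: algebra_simps power2_eq_square)
  also have "\<dots> = 1" using n by (simp add: r2_sq rp_sq rq_sq mult.commute)
  finally have "(of_int y * rq - of_int x * rp) / r2 = inverse C" by (rule inv_I)
  thus "sp C = inverse C" "sq C = - inverse C" unfolding s by simp_all
qed

lemma act_G: "s2 G = - inverse G" "sp G = inverse G" "sq G = - inverse G" "G \<in> Kp"
proof -
  obtain x y where xy: "G = of_int x * rp + of_int y * (r2 * rq)" "2 * q * y ^ 2 - p * x ^ 2 = 1" by (rule G_form)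
  have n: "2 * of_int q * complex_of_int y ^ 2 - of_int p * of_int x ^ 2 = 1" using of_int_norm'[OF xy(2)] by simp
  show "G \<in> Kp" by (simp add: xy(1) gens_Kp clKp)
  have s: "s2 G = - (of_int y * (r2 * rq) - of_int x * rp)" "sp G = of_int y * (r2 * rq) - of_int x * rp"
    "sq G = - (of_int y * (r2 * rq) - of_int x * rp)"
    by (simp_all add: xy(1) gal_simps)
  have "G * (of_int y * (r2 * rq) - of_int x * rp) = of_int y ^ 2 * (r2 ^ 2 * rq ^ 2) - of_int x ^ 2 * rp ^ 2"
    unfolding xy(1) by (simp add: algebra_simps power2_eq_square)
  also have "\<dots> = 1" using n by (simp add: r2_sq rp_sq rq_sq mult_ac)
  finally have "of_int y * (r2 * rq) - of_int x * rp = inverse G" by (rule inv_I)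
  thus "s2 G = - inverse G" "sp G = inverse G" "sq G = - inverse G" unfolding s by simp_all
qed

lemma units_Kp: "e2 \<in> unit_group Kp" "ep \<in> unit_group Kp" "e2p \<in> unit_group Kp" "A \<in> unit_group Kp"
  "B \<in> unit_group Kp" "C \<in> unit_group Kp" "G \<in> unit_group Kp"
proof -
  note fu = real_quadratic.fund_unit(1)
  show "e2 \<in> unit_group Kp"
    by (rule unit_group_of_power[of e2 1]) (use fu[OF real_quadratics(1)] act_e2(4) in \<open>simp_all add: e2_def\<close>)
  show "ep \<in> unit_group Kp"
    by (rule unit_group_of_power[of ep 1]) (use fu[OF real_quadratics(2)] act_ep(4) in \<open>simp_all add: ep_def\<close>)
  show "e2p \<in> unit_group Kp"
    by (rule unit_group_of_power[of e2p 1]) (use fu[OF real_quadratics(4)] act_e2p(4) in \<open>simp_all add: e2p_def\<close>)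
  show "A \<in> unit_group Kp"
    by (rule unit_group_of_power[of A 2]) (use fu[OF real_quadratics(3)] act_A(4) in \<open>simp_all add: units_sq\<close>)
  show "B \<in> unit_group Kp"
    by (rule unit_group_of_power[of B 2]) (use fu[OF real_quadratics(5)] act_B(4) in \<open>simp_all add: units_sq\<close>)
  show "C \<in> unit_group Kp"
    by (rule unit_group_of_power[of C 2]) (use fu[OF real_quadratics(6)] act_C(4) in \<open>simp_all add: units_sq\<close>)
  show "G \<in> unit_group Kp"
    by (rule unit_group_of_power[of G 2]) (use fu[OF real_quadratics(7)] act_G(4) in \<open>simp_all add: units_sq\<close>)
qed

lemma unit_algebraic_int: "u \<in> unit_group F \<Longrightarrow> algebraic_int u \<and> algebraic_int (2 / u)"
proof -
  assume u: "u \<in> unit_group F"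
  hence "algebraic_int (2 * inverse u)" by (intro algebraic_int_times) (auto simp: unit_group_def)
  thus ?thesis using u by (simp add: unit_group_def field_class.field_divide_inverse)
qed

lemma nm_e2: "nm e2 (- 1)"
proof -
  obtain x y where xy: "e2 = of_int x + of_int y * r2" "x ^ 2 - 2 * y ^ 2 = - 1" by (rule e2_form)
  have n: "complex_of_int x ^ 2 - 2 * of_int y ^ 2 = - 1" using of_int_norm[OF xy(2)] by simp
  show ?thesis unfolding xy(1) by (rule nm_I[OF _ _ n]) simp_all
qed

lemma nm_of_int: "nm (of_int c) (of_int c ^ 2)"
  using nm_I[of "of_int c" 0] by simp

section \<open>Square classes of A, B, C and G\<close>

lemma sqc_half: "w \<in> Kp \<Longrightarrow> sqc w (w * r2 * r2)"
  unfolding sqc_def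
proof (intro bexI[of _ "inverse r2"] conjI)
  assume "w \<in> Kp"
  have "w * r2 * r2 * (inverse r2) ^ 2 = w * (r2 * inverse r2) ^ 2" by (simp only: power2_eq_square mult_ac)
  thus "w = w * r2 * r2 * (inverse r2) ^ 2" using r2_ne_0 by simp
qed (use r2_ne_0 gens_Kp in \<open>simp_all add: clKp(6)\<close>)

lemma sqc_ne_0: "sqc x y \<Longrightarrow> x \<noteq> 0 \<Longrightarrow> y \<noteq> 0"
  by (auto simp: sqc_def)

text \<open>The trace identity is applied to A r2, whose product with its conjugate under
  \<open>sq\<close> is 2 = r2^2 and whose trace is 2 x; the result lies in Q(sqrt 2).\<close>

lemma sqc_A:
  obtains s x y where "s = 1 \<or> s = - 1" "sqc A ((2 * of_int x + 2 * s * r2) * r2)"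
    "complex_of_int x ^ 2 - of_int q * of_int y ^ 2 = 2"
proof -
  obtain x y where xy: "A * r2 = of_int x + of_int y * rq" "x ^ 2 - q * y ^ 2 = 2" by (rule A_form)
  have n: "complex_of_int x ^ 2 - of_int q * of_int y ^ 2 = 2" using of_int_norm[OF xy(2)] by simp
  have "A * r2 * (of_int x - of_int y * rq) = of_int x ^ 2 - of_int y ^ 2 * rq ^ 2"
    unfolding xy(1) by (simp add: algebra_simps power2_eq_square)
  hence "A * r2 * (of_int x - of_int y * rq) = r2 ^ 2" using n by (simp add: r2_sq rq_sq mult.commute)
  hence "of_int x - of_int y * rq = r2 ^ 2 / (A * r2)" using units_ne_0 r2_ne_0 by (simp add: field_simps)
  then obtain k where k: "k = r2 \<or> k = - r2" "sqc (A * r2) (A * r2 + (of_int x - of_int y * rq) + 2 * k)"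
    by (rule sqc_trace[rotated 2]) (use units_ne_0 r2_ne_0 act_A(4) gens_Kp in \<open>simp_all add: clKp(4)\<close>)
  obtain s where s: "s = 1 \<or> s = - 1" "k = s * r2" using k(1) by force
  have eq: "A * r2 + (of_int x - of_int y * rq) + 2 * k = 2 * of_int x + 2 * s * r2"
    unfolding xy(1) s(2) by simp
  have "sqc (A * r2 * r2) ((2 * of_int x + 2 * s * r2) * r2)" using sqc_mult[OF k(2) sqc_refl[of r2]] unfolding eq .
  with sqc_half[OF act_A(4)] have "sqc A ((2 * of_int x + 2 * s * r2) * r2)" by (rule sqc_trans)
  thus ?thesis using s(1) n that by blast
qed

lemma sqc_B:
  obtains s x y where "s = 1 \<or> s = - 1" "sqc B ((2 * of_int x + 2 * s * r2) * r2)"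
    "complex_of_int x ^ 2 - 2 * of_int q * of_int y ^ 2 = 2"
proof -
  obtain x y where xy: "B * r2 = of_int x + of_int y * (r2 * rq)" "x ^ 2 - 2 * q * y ^ 2 = 2" by (rule B_form)
  have n: "complex_of_int x ^ 2 - 2 * of_int q * of_int y ^ 2 = 2" using of_int_norm[OF xy(2)] by simp
  have "B * r2 * (of_int x - of_int y * (r2 * rq)) = of_int x ^ 2 - of_int y ^ 2 * (r2 ^ 2 * rq ^ 2)"
    unfolding xy(1) by (simp add: algebra_simps power2_eq_square)
  hence "B * r2 * (of_int x - of_int y * (r2 * rq)) = r2 ^ 2" using n by (simp add: r2_sq rq_sq mult_ac)
  hence "of_int x - of_int y * (r2 * rq) = r2 ^ 2 / (B * r2)" using units_ne_0 r2_ne_0 by (simp add: field_simps)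
  then obtain k where k: "k = r2 \<or> k = - r2" "sqc (B * r2) (B * r2 + (of_int x - of_int y * (r2 * rq)) + 2 * k)"
    by (rule sqc_trace[rotated 2]) (use units_ne_0 r2_ne_0 act_B(4) gens_Kp in \<open>simp_all add: clKp(4)\<close>)
  obtain s where s: "s = 1 \<or> s = - 1" "k = s * r2" using k(1) by force
  have eq: "B * r2 + (of_int x - of_int y * (r2 * rq)) + 2 * k = 2 * of_int x + 2 * s * r2"
    unfolding xy(1) s(2) by simp
  have "sqc (B * r2 * r2) ((2 * of_int x + 2 * s * r2) * r2)" using sqc_mult[OF k(2) sqc_refl[of r2]] unfolding eq .
  with sqc_half[OF act_B(4)] have "sqc B ((2 * of_int x + 2 * s * r2) * r2)" by (rule sqc_trans)
  thus ?thesis using s(1) n that by blast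
qed

text \<open>The conjugate is taken under \<open>sp\<close>, which eliminates \<open>rp\<close> and
  leaves an element of Q(sqrt 2, sqrt q). One more descent follows, after C is combined with
  G.\<close>

lemma sqc_C:
  obtains s x y where "s = 1 \<or> s = - 1" "sqc C ((2 * of_int y * rq + 2 * s * r2) * r2)"
    "of_int q * complex_of_int y ^ 2 - of_int p * of_int x ^ 2 = 2"
proof -
  obtain x y where xy: "C * r2 = of_int x * rp + of_int y * rq" "q * y ^ 2 - p * x ^ 2 = 2" by (rule C_form)
  have n: "of_int q * complex_of_int y ^ 2 - of_int p * of_int x ^ 2 = 2" using of_int_norm'[OF xy(2)] by simp
  have "C * r2 * (of_int y * rq - of_int x * rp) = of_int y ^ 2 * rq ^ 2 - of_int x ^ 2 * rp ^ 2"
    unfolding xy(1) by (simp add: algebra_simps power2_eq_square)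
  hence "C * r2 * (of_int y * rq - of_int x * rp) = r2 ^ 2" using n by (simp add: r2_sq rq_sq rp_sq mult.commute)
  hence "of_int y * rq - of_int x * rp = r2 ^ 2 / (C * r2)" using units_ne_0 r2_ne_0 by (simp add: field_simps)
  then obtain k where k: "k = r2 \<or> k = - r2" "sqc (C * r2) (C * r2 + (of_int y * rq - of_int x * rp) + 2 * k)"
    by (rule sqc_trace[rotated 2]) (use units_ne_0 r2_ne_0 act_C(4) gens_Kp in \<open>simp_all add: clKp(4)\<close>)
  obtain s where s: "s = 1 \<or> s = - 1" "k = s * r2" using k(1) by force
  have eq: "C * r2 + (of_int y * rq - of_int x * rp) + 2 * k = 2 * of_int y * rq + 2 * s * r2"
    unfolding xy(1) s(2) by simp
  have "sqc (C * r2 * r2) ((2 * of_int y * rq + 2 * s * r2) * r2)" using sqc_mult[OF k(2) sqc_refl[of r2]] unfolding eq .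
  with sqc_half[OF act_C(4)] have "sqc C ((2 * of_int y * rq + 2 * s * r2) * r2)" by (rule sqc_trans)
  thus ?thesis using s(1) n that by blast
qed

lemma sqc_G:
  obtains s x y where "s = 1 \<or> s = - 1" "sqc G (2 * of_int y * (r2 * rq) + 2 * s)"
    "2 * of_int q * complex_of_int y ^ 2 - of_int p * of_int x ^ 2 = 1"
proof -
  obtain x y where xy: "G = of_int x * rp + of_int y * (r2 * rq)" "2 * q * y ^ 2 - p * x ^ 2 = 1" by (rule G_form)
  have n: "2 * of_int q * complex_of_int y ^ 2 - of_int p * of_int x ^ 2 = 1" using of_int_norm'[OF xy(2)] by simp
  have "G * (of_int y * (r2 * rq) - of_int x * rp) = of_int y ^ 2 * (r2 ^ 2 * rq ^ 2) - of_int x ^ 2 * rp ^ 2"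
    unfolding xy(1) by (simp add: algebra_simps power2_eq_square)
  hence "G * (of_int y * (r2 * rq) - of_int x * rp) = 1 ^ 2" using n by (simp add: r2_sq rq_sq rp_sq mult_ac)
  hence "of_int y * (r2 * rq) - of_int x * rp = 1 ^ 2 / G" using units_ne_0 by (simp add: field_simps)
  then obtain k where k: "k = 1 \<or> k = - 1" "sqc G (G + (of_int y * (r2 * rq) - of_int x * rp) + 2 * k)"
    by (rule sqc_trace[rotated 2]) (use units_ne_0 act_G(4) in \<open>simp_all add: clKp(2)\<close>)
  have "G + (of_int y * (r2 * rq) - of_int x * rp) + 2 * k = 2 * of_int y * (r2 * rq) + 2 * k"
    unfolding xy(1) by simp
  thus ?thesis using k n that by metis
qed

definition D :: complex where "D = psqrt (e2 * ep * e2p)"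
definition E :: complex where "E = psqrt (e2 * A * C * G)"
text \<open>If zeta8 A B is to be a square in K, then (1 + zeta8)^2 = zeta8 (2 + r2) translates this
  into a square root inside the real field.\<close>

definition S :: complex where "S = psqrt ((2 + r2) * (A * B))"

text \<open>Both factors of t = ep e2p change into minus their inverses under \<open>sp\<close>, so
  t' = 1 / t and the trace lies in Q(sqrt 2). Its shifted norm is minus a square, and the factor
  \<open>e2\<close> of norm -1 corrects the sign.\<close>

lemma D_in: "D \<in> Kp"
proof -
  obtain a b where ab: "ep = (of_int a + of_int b * rp) / 2" "a ^ 2 - p * b ^ 2 = - 4" by (rule ep_form)
  obtain c d where cd: "e2p = of_int c + of_int d * (r2 * rp)" "c ^ 2 - 2 * p * d ^ 2 = - 1" by (rule e2p_form)
  have n1: "complex_of_int a ^ 2 - of_int p * of_int b ^ 2 = - 4" using of_int_norm[OF ab(2)] by simp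
  have n2: "complex_of_int c ^ 2 - 2 * of_int p * of_int d ^ 2 = - 1" using of_int_norm[OF cd(2)] by simp
  define t where "t = ep * e2p"
  define t' where "t' = sp ep * sp e2p"
  have t0: "t \<noteq> 0" using units_ne_0 by (simp add: t_def)
  have "t' = 1 ^ 2 / t" using units_ne_0 by (simp add: t_def t'_def act_ep act_e2p field_simps)
  then obtain k where k: "k = 1 \<or> k = - 1" "sqc t (t + t' + 2 * k)"
    by (rule sqc_trace[rotated 2]) (use t0 act_ep(4) act_e2p(4) in \<open>simp_all add: t_def clKp(2,4)\<close>)
  have "sp ep = (of_int a - of_int b * rp) / 2" "sp e2p = of_int c - of_int d * (r2 * rp)"
    by (simp_all add: ab(1) cd(1) gal_simps)
  hence "t + t' = of_int a * of_int c + of_int b * of_int d * r2 * rp ^ 2"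
    unfolding t_def t'_def by (simp only:) (simp add: ab(1) cd(1) field_simps power2_eq_square)
  hence eq: "t + t' + 2 * k = (of_int a * of_int c + 2 * k) + (of_int b * of_int d * of_int p) * r2"
    unfolding rp_sq by (simp add: algebra_simps)
  have k2: "k ^ 2 = 1" using k(1) by auto
  have "(of_int a * of_int c + 2 * k) ^ 2 - 2 * (of_int b * of_int d * of_int p) ^ 2
      = - ((of_int a - 2 * k * of_int c) ^ 2)"
    by (rule norm_D[OF n1 n2 k2])
  hence "nm (t + t' + 2 * k) (- ((of_int a - 2 * k * of_int c) ^ 2))"
    unfolding eq using k(1) by (intro nm_I) auto
  from nm_mult[OF nm_e2 this] have nm: "nm (e2 * (t + t' + 2 * k)) ((of_int a - 2 * k * of_int c) ^ 2)" by simp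
  have "sqc (e2 * t) (e2 * (t + t' + 2 * k))" by (rule sqc_mult[OF sqc_refl k(2)])
  hence sq: "sqc (e2 * ep * e2p) (e2 * (t + t' + 2 * k))" by (simp add: t_def mult.assoc)
  have u: "e2 * ep * e2p \<in> unit_group Kp" by (intro unit_group_mult[OF Kp(1)] units_Kp)
  show ?thesis unfolding D_def
    by (rule sqc_nm[OF _ _ _ _ sq nm])
      (use u unit_algebraic_int[OF u] k(1) in \<open>auto intro!: pos_mult pos_units simp: unit_group_def\<close>)
qed

text \<open>After the first descent C G has the class of r2 t with t in Q(sqrt 2, sqrt q), and a
  second descent along \<open>sq\<close> reaches Q(sqrt 2). Modulo squares the norms of
  \<open>e2\<close>, A and C G are then -1, q and -q, with product a square.\<close>

lemma E_in: "E \<in> Kp"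
proof -
  obtain s0 x y where A: "s0 = 1 \<or> s0 = - 1" "sqc A ((2 * of_int x + 2 * s0 * r2) * r2)"
    "complex_of_int x ^ 2 - of_int q * of_int y ^ 2 = 2" by (rule sqc_A)
  obtain s1 z w where C: "s1 = 1 \<or> s1 = - 1" "sqc C ((2 * of_int w * rq + 2 * s1 * r2) * r2)"
    "of_int q * complex_of_int w ^ 2 - of_int p * of_int z ^ 2 = 2" by (rule sqc_C)
  obtain k u v where G: "k = 1 \<or> k = - 1" "sqc G (2 * of_int v * (r2 * rq) + 2 * k)"
    "2 * of_int q * complex_of_int v ^ 2 - of_int p * of_int u ^ 2 = 1" by (rule sqc_G)
  have s2': "s0 ^ 2 = 1" "s1 ^ 2 = 1" "k ^ 2 = 1" using A(1) C(1) G(1) by auto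
  have rats: "s0 \<in> \<rat>" "s1 \<in> \<rat>" "k \<in> \<rat>" using A(1) C(1) G(1) by auto
  have inKp: "s1 \<in> Kp" "k \<in> Kp" using rats subfield_Rats[OF Kp(1)] by auto
  define t where "t = (of_int w * rq + s1 * r2) * (of_int v * (r2 * rq) + k)"
  \<comment> \<open>This is the conjugate of \<open>t\<close> under \<open>sq\<close>, written
    out.\<close>
  define t' where "t' = (s1 * r2 - of_int w * rq) * (k - of_int v * (r2 * rq))"
  define n where "n = complex_of_int (p * z * u)"
  have CG: "sqc (C * G) (4 * r2 * t)"
    using sqc_mult[OF C(2) G(2)] by (simp add: t_def algebra_simps)
  hence t0: "t \<noteq> 0" using sqc_ne_0[OF CG] units_ne_0 by auto
  have "t * t' = (s1 ^ 2 * r2 ^ 2 - of_int w ^ 2 * rq ^ 2) * (k ^ 2 - of_int v ^ 2 * r2 ^ 2 * rq ^ 2)"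
    unfolding t_def t'_def by (simp add: algebra_simps power2_eq_square)
  also have "\<dots> = (2 - of_int q * of_int w ^ 2) * (1 - 2 * of_int q * of_int v ^ 2)"
    unfolding s2' r2_sq rq_sq by (simp add: mult_ac)
  also have "\<dots> = n ^ 2" unfolding n_def of_int_mult by (rule norm_CG[OF C(3) G(3)])
  finally have "t' = n ^ 2 / t" using t0 by (simp add: field_simps)
  then obtain m where m: "m = n \<or> m = - n" "sqc t (t + t' + 2 * m)"
    by (rule sqc_trace[rotated 2]) (use t0 gens_Kp inKp in \<open>simp_all add: t_def n_def clKp\<close>)
  have m2: "m ^ 2 = (of_int p * of_int z * of_int u) ^ 2" using m(1) by (auto simp: n_def)
  have "t + t' = 2 * of_int w * of_int v * r2 * rq ^ 2 + 2 * s1 * k * r2"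
    unfolding t_def t'_def by (simp add: algebra_simps power2_eq_square)
  hence eq: "t + t' + 2 * m = 2 * m + (2 * of_int w * of_int v * of_int q + 2 * s1 * k) * r2"
    unfolding rq_sq by (simp add: algebra_simps)
  let ?h = "of_int w + 2 * (s1 * k) * of_int v"
  have "(2 * m) ^ 2 - 2 * (2 * of_int w * of_int v * of_int q + 2 * s1 * k) ^ 2 = - (4 * of_int q * ?h ^ 2)"
    by (rule norm_E[OF m2 C(3) G(3) s2'(2,3)])
  hence nm1: "nm (t + t' + 2 * m) (- (4 * of_int q * ?h ^ 2))"
    unfolding eq using m(1) rats by (intro nm_I) (auto simp: n_def)
  have "(2 * complex_of_int x) ^ 2 - 2 * (2 * s0) ^ 2 = 4 * of_int q * of_int y ^ 2"
    by (rule norm_A[OF A(3) s2'(1)])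
  hence nm2: "nm (2 * of_int x + 2 * s0 * r2) (4 * of_int q * of_int y ^ 2)"
    using rats by (intro nm_I) auto
  have "nm (of_int 8 * (e2 * ((2 * of_int x + 2 * s0 * r2) * (t + t' + 2 * m))))
     (of_int 8 ^ 2 * (- 1 * ((4 * of_int q * of_int y ^ 2) * (- (4 * of_int q * ?h ^ 2)))))"
    by (intro nm_mult nm_of_int nm_e2 nm1 nm2)
  also have "of_int 8 ^ 2 * (- 1 * ((4 * of_int q * of_int y ^ 2) * (- (4 * of_int q * ?h ^ 2))))
     = (32 * of_int q * of_int y * ?h) ^ 2"
    by (simp add: power_mult_distrib power2_eq_square)
  finally have nm: "nm (of_int 8 * (e2 * ((2 * of_int x + 2 * s0 * r2) * (t + t' + 2 * m))))
     ((32 * of_int q * of_int y * ?h) ^ 2)" .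
  have "sqc (e2 * A * (C * G)) (e2 * ((2 * of_int x + 2 * s0 * r2) * r2) * (4 * r2 * (t + t' + 2 * m)))"
    by (intro sqc_mult sqc_refl A(2) sqc_trans[OF CG] m(2))
  also have "e2 * ((2 * of_int x + 2 * s0 * r2) * r2) * (4 * r2 * (t + t' + 2 * m))
     = 4 * r2 ^ 2 * (e2 * ((2 * of_int x + 2 * s0 * r2) * (t + t' + 2 * m)))"
    by (simp add: power2_eq_square mult_ac)
  finally have sq: "sqc (e2 * A * C * G) (of_int 8 * (e2 * ((2 * of_int x + 2 * s0 * r2) * (t + t' + 2 * m))))"
    unfolding r2_sq by (simp add: mult.assoc)
  have u: "e2 * A * C * G \<in> unit_group Kp" by (intro unit_group_mult[OF Kp(1)] units_Kp)
  show ?thesis unfolding E_def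
    by (rule sqc_nm[OF _ _ _ _ sq nm])
      (use u unit_algebraic_int[OF u] rats in \<open>auto intro!: pos_mult pos_units simp: unit_group_def\<close>)
qed

lemma pos_2_r2: "pos (2 + r2)"
  unfolding pos_def r2_def by (intro exI[of _ "2 + sqrt 2"]) (simp add: add_pos_pos)

text \<open>The norms of 2 + r2 and of the classes of A and B are 2, q and 2 q modulo squares, so
  their product is a square. The element under the root is not a unit but divides 2, which is all
  that \<open>sqc_nm\<close> asks.\<close>

lemma S_in: "S \<in> Kp"
proof -
  obtain s0 x y where A: "s0 = 1 \<or> s0 = - 1" "sqc A ((2 * of_int x + 2 * s0 * r2) * r2)"
    "complex_of_int x ^ 2 - of_int q * of_int y ^ 2 = 2" by (rule sqc_A)
  obtain s1 a b where B: "s1 = 1 \<or> s1 = - 1" "sqc B ((2 * of_int a + 2 * s1 * r2) * r2)"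
    "complex_of_int a ^ 2 - 2 * of_int q * of_int b ^ 2 = 2" by (rule sqc_B)
  have s2': "s0 ^ 2 = 1" "s1 ^ 2 = 1" using A(1) B(1) by auto
  have rats: "s0 \<in> \<rat>" "s1 \<in> \<rat>" using A(1) B(1) by auto
  have "(2 * complex_of_int x) ^ 2 - 2 * (2 * s0) ^ 2 = 4 * of_int q * of_int y ^ 2"
    by (rule norm_A[OF A(3) s2'(1)])
  hence nm1: "nm (2 * of_int x + 2 * s0 * r2) (4 * of_int q * of_int y ^ 2)"
    using rats by (intro nm_I) auto
  have "(2 * complex_of_int a) ^ 2 - 2 * (2 * s1) ^ 2 = 8 * of_int q * of_int b ^ 2"
    using norm_A[OF B(3) s2'(2)] by simp
  hence nm2: "nm (2 * of_int a + 2 * s1 * r2) (8 * of_int q * of_int b ^ 2)"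
    using rats by (intro nm_I) auto
  have nm3: "nm (2 + r2) 2" using nm_I[of 2 1 2] by simp
  have "nm (of_int 2 * ((2 + r2) * ((2 * of_int x + 2 * s0 * r2) * (2 * of_int a + 2 * s1 * r2))))
     (of_int 2 ^ 2 * (2 * ((4 * of_int q * of_int y ^ 2) * (8 * of_int q * of_int b ^ 2))))"
    by (intro nm_mult nm_of_int nm1 nm2 nm3)
  also have "of_int 2 ^ 2 * (2 * ((4 * of_int q * of_int y ^ 2) * (8 * of_int q * of_int b ^ 2)))
     = (16 * of_int q * of_int y * complex_of_int b) ^ 2"
    by (simp add: power_mult_distrib power2_eq_square)
  finally have nm: "nm (of_int 2 * ((2 + r2) * ((2 * of_int x + 2 * s0 * r2) * (2 * of_int a + 2 * s1 * r2))))
     ((16 * of_int q * of_int y * of_int b) ^ 2)" .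
  have "sqc ((2 + r2) * (A * B)) ((2 + r2) * (((2 * of_int x + 2 * s0 * r2) * r2) * ((2 * of_int a + 2 * s1 * r2) * r2)))"
    by (intro sqc_mult sqc_refl A(2) B(2))
  also have "(2 + r2) * (((2 * of_int x + 2 * s0 * r2) * r2) * ((2 * of_int a + 2 * s1 * r2) * r2))
     = r2 ^ 2 * ((2 + r2) * ((2 * of_int x + 2 * s0 * r2) * (2 * of_int a + 2 * s1 * r2)))"
    by (simp only: power2_eq_square mult_ac)
  finally have sq: "sqc ((2 + r2) * (A * B)) (of_int 2 * ((2 + r2) * ((2 * of_int x + 2 * s0 * r2) * (2 * of_int a + 2 * s1 * r2))))"
    unfolding r2_sq by simp
  have AB: "A * B \<in> unit_group Kp" by (intro unit_group_mult[OF Kp(1)] units_Kp)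
  have alg_r2: "algebraic_int r2" using algebraic_int_of_power[of r2 2] by (simp add: r2_sq)
  have "algebraic_int (2 + r2)" "algebraic_int (2 + - r2)"
    using alg_r2 by (intro algebraic_int_plus; simp)+
  moreover have "algebraic_int (A * B)" "algebraic_int (inverse (A * B))"
    using AB by (simp_all only: unit_group_def mem_Collect_eq)
  ultimately have alg: "algebraic_int ((2 + r2) * (A * B))" "algebraic_int ((2 + - r2) * inverse (A * B))"
    using algebraic_int_times[of "2 + r2" "A * B"] algebraic_int_times[of "2 + - r2" "inverse (A * B)"] by blast+
  \<comment> \<open>The conjugate 2 - r2 is the integral quotient of 2 by 2 + r2.\<close>
  have m: "(2 + r2) * (2 + - r2) = 2" using r2_sq by (simp add: algebra_simps power2_eq_square)
  have "2 / ((2 + r2) * (A * B)) = ((2 + r2) * (2 + - r2)) / ((2 + r2) * (A * B))" unfolding m ..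
  also have "\<dots> = (2 + - r2) / (A * B)" by (rule mult_divide_mult_cancel_left[OF pos_ne_0[OF pos_2_r2]])
  finally have eq: "2 / ((2 + r2) * (A * B)) = (2 + - r2) * inverse (A * B)"
    by (simp only: field_class.field_divide_inverse)
  show ?thesis unfolding S_def
  proof (rule sqc_nm[OF _ _ alg(1) _ sq nm])
    show "(2 + r2) * (A * B) \<in> Kp" using gens_Kp(1) act_A(4) act_B(4) by (intro clKp(3,4,12))
    show "pos ((2 + r2) * (A * B))" by (intro pos_mult pos_units pos_2_r2)
    show "algebraic_int (2 / ((2 + r2) * (A * B)))" unfolding eq by (rule alg(2))
  qed simp
qed

lemma D_sq: "D ^ 2 = e2 * ep * e2p"
  unfolding D_def by (intro psqrt_sq pos_mult pos_units)

lemma E_sq: "E ^ 2 = e2 * A * C * G"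
  unfolding E_def by (intro psqrt_sq pos_mult pos_units)

lemma S_sq: "S ^ 2 = (2 + r2) * (A * B)"
  unfolding S_def by (intro psqrt_sq pos_mult pos_units pos_2_r2)

end

section \<open>Fourth powers of units\<close>

lemma unit_group_uminus_one: "is_subfield F \<Longrightarrow> - 1 \<in> unit_group F"
  by (rule unit_group_minus[OF _ unit_group_1])

lemma power_int_even_split:
  fixes x :: complex
  assumes "x \<noteq> 0"
  shows "x powi (k + 2 * i) = x powi k * (x powi i) ^ 2"
proof -
  have "x powi (k + 2 * i) = x powi k * x powi (i * 2)"
    using assms by (simp add: power_int_add mult.commute)
  also have "x powi (i * 2) = (x powi i) powi 2" by (rule power_int_mult)
  finally show ?thesis by simp
qed

lemma minus_one_powi: "(- 1 :: complex) powi k = (if even k then 1 else - 1)"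
  by (simp add: power_int_minus_left)

text \<open>The identity element lies in all seven index-two subgroups of the group of order 8,
  every other element in exactly three: x1^7 times the cubes of the others is x1^4 times the cube of
  the full product.\<close>

lemma prod_seven_norms:
  fixes x1 x2 x3 x4 x5 x6 x7 x8 :: complex
  shows "(x1*x3*x4*x7) * (x1*x2*x4*x6) * (x1*x2*x3*x5) * (x1*x5*x4*x8) * (x1*x6*x3*x8) * (x1*x7*x2*x8) * (x1*x5*x6*x7)
    = x1 ^ 4 * (x1*x2*x3*x4*x5*x6*x7*x8) ^ 3"
  by (simp only: power_mult_distrib power3_eq_cube power4_eq_xxxx mult_ac)

context pq_primes
begin

lemma pos_powi:
  assumes "pos x"
  shows "pos (x powi k)"
proof -
  obtain a where a: "a > 0" "x = of_real a" using assms unfolding pos_def by blast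
  have "x powi k = of_real (a powi k)" unfolding a(2) by (rule of_real_power_int[symmetric])
  thus ?thesis using a(1) unfolding pos_def by (meson zero_less_power_int)
qed

lemma pos_inverse: "pos x \<Longrightarrow> pos (inverse x)"
  using pos_powi[of x "- 1"] by (simp add: power_int_minus)

lemma pos_1: "pos 1"
  unfolding pos_def by (intro exI[of _ 1]) simp

lemma not_pos_minus: "pos x \<Longrightarrow> \<not> pos (- x)"
  using pos_Re[of x] pos_Re[of "- x"] by auto

text \<open>Every parity condition derived from the sign of a conjugate has this form.\<close>

lemma pos_sign: "pos z \<Longrightarrow> pos M \<Longrightarrow> z = (- 1) powi k * M \<Longrightarrow> even k"
  using not_pos_minus[of M] by (auto simp: minus_one_powi split: if_splits)

lemma Kp_K: "x \<in> Kp \<Longrightarrow> x \<in> K"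
  using Kp_subset by auto

lemma pos_Kp_square: "x \<in> Kp \<Longrightarrow> x \<noteq> 0 \<Longrightarrow> pos (x ^ 2)"
  using pos_square Kp_real by blast

lemma unit_gal:
  assumes "u \<in> unit_group Kp"
  shows "s2 u \<in> unit_group Kp" "sp u \<in> unit_group Kp" "sq u \<in> unit_group Kp"
proof -
  have u: "u \<in> Kp" "u \<in> K" "u \<noteq> 0" "algebraic_int u" "algebraic_int (inverse u)"
    using assms Kp_K by (auto simp: unit_group_def)
  have *: "f u \<in> unit_group Kp" if f: "hom_on K f" "f u \<in> Kp" for f
    using that u hom_algebraic_int[OF K(1) f(1) u(2,4)]
      hom_algebraic_int[OF K(1) f(1) clK(6)[OF u(2)] u(5)] hom_inverse[OF K(1) f(1) u(2)]
      hom_eq_0_iff[OF K(1) f(1) u(2)]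
    by (simp add: unit_group_def)
  show "s2 u \<in> unit_group Kp" "sp u \<in> unit_group Kp" "sq u \<in> unit_group Kp"
    using * hom_s2 hom_sp hom_sq gal_Kp[OF u(1)] by blast+
qed

text \<open>Each automorphism either fixes \<open>r\<close>, \<open>w\<close>, \<open>w'\<close> or
  negates \<open>r\<close> and swaps the other two; hence w + w' and (w - w') r are rational and
  express \<open>w\<close> through \<open>r\<close>.\<close>

lemma quadratic_subfield:
  assumes w: "w \<in> Kp" "w' \<in> Kp" and r: "r \<in> Kp" "r \<noteq> 0" "r ^ 2 \<in> \<rat>"
    and act: "\<And>f. f \<in> {s2, sp, sq} \<Longrightarrow> (f r = r \<and> f w = w \<and> f w' = w') \<or> (f r = - r \<and> f w = w' \<and> f w' = w)"
  shows "w \<in> gen_field {r}"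
proof -
  note inK = w[THEN Kp_K] r(1)[THEN Kp_K]
  have fixd: "f (w + w') = w + w' \<and> f ((w - w') * r) = (w - w') * r" if f: "f \<in> {s2, sp, sq}" for f
  proof -
    have hf: "hom_on K f" using f hom_s2 hom_sp hom_sq by auto
    have "f (w + w') = f w + f w'" "f ((w - w') * r) = (f w - f w') * f r"
      using inK by (simp_all add: hom_add[OF K(1) hf] hom_mult[OF K(1) hf] hom_diff[OF K(1) hf] clK(7))
    thus ?thesis using act[OF f] by (auto simp: algebra_simps)
  qed
  have "w + w' \<in> \<rat>" using fixd w by (intro fixed_Rats) (auto simp: clKp(3))
  moreover have "(w - w') * r \<in> \<rat>" using fixd w r(1) by (intro fixed_Rats) (auto simp: clKp(4,7))
  ultimately have ab: "(w + w') / 2 \<in> \<rat>" "(w - w') * r / (2 * r ^ 2) \<in> \<rat>"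
    using r(3) by (auto intro: Rats_divide Rats_mult)
  have "(w - w') * r / (2 * r ^ 2) * r = (w - w') / 2"
    using r(2) by (simp add: power2_eq_square)
  hence "w = (w + w') / 2 + (w - w') * r / (2 * r ^ 2) * r"
    by (simp add: add_divide_distrib diff_divide_distrib)
  also have "(w + w') / 2 + (w - w') * r / (2 * r ^ 2) * r \<in> gen_field {r}"
    using gen_field_superset[of "{r}"] is_subfield_gen_field[of "{r}"] ab
    by (intro subfield_add subfield_mult) (simp_all add: subfield_Rats)
  finally show ?thesis .
qed

lemma norm_is_fund_unit_power:
  assumes u: "w \<in> unit_group Kp" and w': "w' \<in> Kp" and d: "real_quadratic d"
    and r: "r = complex_of_real (sqrt (of_int d))" "r \<in> Kp"
    and act: "\<And>f. f \<in> {s2, sp, sq} \<Longrightarrow> (f r = r \<and> f w = w \<and> f w' = w') \<or> (f r = - r \<and> f w = w' \<and> f w' = w)"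
  shows "\<exists>k. w = fund_unit d powi k \<or> w = - (fund_unit d powi k)"
proof -
  interpret Q: real_quadratic d by (rule d)
  have rs: "r = Q.s" by (simp add: r(1) Q.s_def)
  have "w \<in> gen_field {r}"
    by (rule quadratic_subfield[OF _ w' r(2)])
      (use u act Q.s_ne_0 Q.s2_Rats in \<open>simp_all add: rs unit_group_def\<close>)
  hence "w \<in> unit_group Q.Q" using u by (simp add: unit_group_def rs Q.Q_def)
  thus ?thesis by (rule Q.fund_unit_generates)
qed

lemma sqrt_products: "r2 * rp = of_real (sqrt (of_int (2 * p)))" "r2 * rq = of_real (sqrt (of_int (2 * q)))"
  "rp * rq = of_real (sqrt (of_int (p * q)))" "r2 * rp * rq = of_real (sqrt (of_int (2 * p * q)))"
  by (simp_all add: r2_def rp_def rq_def real_sqrt_mult)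

lemma unit_pow_4:
  assumes u: "u \<in> unit_group Kp"
  obtains k1 k2 k3 k4 k5 k6 k7 :: int and \<delta> where "\<delta> = 1 \<or> \<delta> = - 1"
    "u ^ 4 = \<delta> * (e2 powi k1 * ep powi k2 * e2p powi k3 * (A ^ 2) powi k4 * (B ^ 2) powi k5
      * (C ^ 2) powi k6 * (G ^ 2) powi k7)"
proof -
  define x2 xp xq x2p x2q xpq x2pq where x: "x2 = s2 u" "xp = sp u" "xq = sq u" "x2p = s2 (sp u)"
    "x2q = s2 (sq u)" "xpq = sp (sq u)" "x2pq = s2 (sp (sq u))"
  have U: "x2 \<in> unit_group Kp" "xp \<in> unit_group Kp" "xq \<in> unit_group Kp" "x2p \<in> unit_group Kp"
    "x2q \<in> unit_group Kp" "xpq \<in> unit_group Kp" "x2pq \<in> unit_group Kp"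
    unfolding x by (intro unit_gal u)+
  have inKp: "y \<in> Kp" if "y \<in> unit_group Kp" for y using that by (simp add: unit_group_def)
  have K8: "u \<in> Kp" "x2 \<in> Kp" "xp \<in> Kp" "xq \<in> Kp" "x2p \<in> Kp" "x2q \<in> Kp" "xpq \<in> Kp" "x2pq \<in> Kp"
    using u U inKp by blast+
  note K8' = K8[THEN Kp_K]
  have c: "sp (s2 y) = s2 (sp y)" "sq (s2 y) = s2 (sq y)" "sq (sp y) = sp (sq y)"
    "s2 (s2 y) = y" "sp (sp y) = y" "sq (sq y) = y" if "y \<in> K" for y
    using gal_commute(1-3)[OF that] gal_invol[OF that] by simp_all
  have a2: "s2 u = x2" "s2 x2 = u" "s2 xp = x2p" "s2 xq = x2q" "s2 x2p = xp" "s2 x2q = xq" "s2 xpq = x2pq" "s2 x2pq = xpq"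
    unfolding x using K8'(1) by (simp_all add: c gal_K)
  have ap: "sp u = xp" "sp x2 = x2p" "sp xp = u" "sp xq = xpq" "sp x2p = x2" "sp x2q = x2pq" "sp xpq = xq" "sp x2pq = x2q"
    unfolding x using K8'(1) by (simp_all add: c gal_K)
  have aq: "sq u = xq" "sq x2 = x2q" "sq xp = xpq" "sq xq = u" "sq x2p = x2pq" "sq x2q = x2" "sq xpq = xp" "sq x2pq = x2p"
    unfolding x using K8'(1) by (simp_all add: c gal_K)
  \<comment> \<open>The full norm is a rational unit, so it equals 1 or -1 and drops out of the
    product formula.\<close>
  define N where "N = u*x2*xp*xq*x2p*x2q*xpq*x2pq"
  have mult: "f (y * z) = f y * f z" if "f \<in> {s2, sp, sq}" "y \<in> Kp" "z \<in> Kp" for f y z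
    using that hom_mult[OF K(1) hom_s2] hom_mult[OF K(1) hom_sp] hom_mult[OF K(1) hom_sq] Kp_K by auto
  have mult4: "f (y1*y2*y3*y4) = f y1 * f y2 * f y3 * f y4"
    if "f \<in> {s2, sp, sq}" "y1 \<in> Kp" "y2 \<in> Kp" "y3 \<in> Kp" "y4 \<in> Kp" for f y1 y2 y3 y4
    using that mult[OF that(1)] by (simp add: clKp(4))
  have N_eq: "N = (u*x2*xp*xq) * (x2p*x2q*xpq*x2pq)" by (simp add: N_def)
  have Nu: "N \<in> unit_group Kp" unfolding N_def by (intro unit_group_mult[OF Kp(1)] u U)
  have "f N = N" if f: "f \<in> {s2, sp, sq}" for f
    unfolding N_eq using f K8 by (subst mult[OF f]) (auto simp: clKp(4) mult4 a2 ap aq)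
  hence "N \<in> \<rat>" using inKp[OF Nu] by (intro fixed_Rats) auto
  then obtain n where n: "N = of_int n"
    using rational_algebraic_int_is_int[of N] Nu by (auto simp: unit_group_def elim: Ints_cases)
  have "inverse N \<in> \<rat>" using \<open>N \<in> \<rat>\<close> by simp
  then obtain n' where n': "inverse N = of_int n'"
    using rational_algebraic_int_is_int[of "inverse N"] Nu by (auto simp: unit_group_def elim: Ints_cases)
  have "N * inverse N = 1" using Nu by (simp add: unit_group_def)
  hence "N * of_int n' = 1" unfolding n' .
  hence "of_int n * of_int n' = (1 :: complex)" unfolding n .
  hence "complex_of_int (n * n') = 1" by simp
  hence "n * n' = 1" by (simp only: of_int_eq_1_iff)
  hence N1: "N = 1 \<or> N = - 1" by (auto simp: zmult_eq_1_iff n)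
  have in4: "y1*y2*y3*y4 \<in> unit_group Kp"
    if "y1 \<in> unit_group Kp" "y2 \<in> unit_group Kp" "y3 \<in> unit_group Kp" "y4 \<in> unit_group Kp" for y1 y2 y3 y4
    by (intro unit_group_mult[OF Kp(1)] that)
  have step: "\<exists>k. y1*y2*y3*y4 = fund_unit d powi k \<or> y1*y2*y3*y4 = - (fund_unit d powi k)"
    if y: "y1 \<in> unit_group Kp" "y2 \<in> unit_group Kp" "y3 \<in> unit_group Kp" "y4 \<in> unit_group Kp"
      and z: "z1 \<in> Kp" "z2 \<in> Kp" "z3 \<in> Kp" "z4 \<in> Kp" and d: "real_quadratic d"
      and r: "r = complex_of_real (sqrt (of_int d))" "r \<in> Kp"
      and act: "\<And>f. f \<in> {s2, sp, sq} \<Longrightarrow>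
        (f r = r \<and> f y1*f y2*f y3*f y4 = y1*y2*y3*y4 \<and> f z1*f z2*f z3*f z4 = z1*z2*z3*z4)
        \<or> (f r = - r \<and> f y1*f y2*f y3*f y4 = z1*z2*z3*z4 \<and> f z1*f z2*f z3*f z4 = y1*y2*y3*y4)"
    for y1 y2 y3 y4 z1 z2 z3 z4 d r
  proof (rule norm_is_fund_unit_power[OF in4[OF y] _ d r])
    show "z1*z2*z3*z4 \<in> Kp" using z by (simp add: clKp(4))
    show "(f r = r \<and> f (y1*y2*y3*y4) = y1*y2*y3*y4 \<and> f (z1*z2*z3*z4) = z1*z2*z3*z4)
        \<or> (f r = - r \<and> f (y1*y2*y3*y4) = z1*z2*z3*z4 \<and> f (z1*z2*z3*z4) = y1*y2*y3*y4)"
      if f: "f \<in> {s2, sp, sq}" for f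
      using act[OF f] mult4[OF f] y[THEN inKp] z by simp
  qed
  have gm: "s2 (y * z) = s2 y * s2 z" "sp (y * z) = sp y * sp z" "sq (y * z) = sq y * sq z" if "y \<in> Kp" "z \<in> Kp" for y z
    using mult that by auto
  note rr = gm[OF gens_Kp(1,2)] gm[OF gens_Kp(1,3)] gm[OF gens_Kp(2,3)] gm[OF gens_Kp(1) clKp(4)[OF gens_Kp(2,3)]]
    s2_gens(1-3) sp_gens(1-3) sq_gens(1-3)
  \<comment> \<open>For each square root \<open>r\<close>, the first four conjugates come from the
    automorphisms fixing \<open>r\<close>, and the other four from the complementary coset.\<close>
  have h1: "\<exists>k. u*xp*xq*xpq = fund_unit 2 powi k \<or> u*xp*xq*xpq = - (fund_unit 2 powi k)"
    by (rule step[OF u U(2,3,6) K8(2,5,6,8) real_quadratics(1) _ gens_Kp(1)])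
      (auto simp: r2_def[symmetric] a2 ap aq rr mult_ac) 
  have h2: "\<exists>k. u*x2*xq*x2q = fund_unit p powi k \<or> u*x2*xq*x2q = - (fund_unit p powi k)"
    by (rule step[OF u U(1,3,5) K8(3,5,7,8) real_quadratics(2) _ gens_Kp(2)])
      (auto simp: rp_def[symmetric] a2 ap aq rr mult_ac)
  have h3: "\<exists>k. u*x2*xp*x2p = fund_unit q powi k \<or> u*x2*xp*x2p = - (fund_unit q powi k)"
    by (rule step[OF u U(1,2,4) K8(4,6,7,8) real_quadratics(3) _ gens_Kp(3)])
      (auto simp: rq_def[symmetric] a2 ap aq rr mult_ac)
  have h4: "\<exists>k. u*x2p*xq*x2pq = fund_unit (2*p) powi k \<or> u*x2p*xq*x2pq = - (fund_unit (2*p) powi k)"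
    by (rule step[OF u U(4,3,7) K8(2,3,6,7) real_quadratics(4) sqrt_products(1) clKp(4)[OF gens_Kp(1,2)]])
      (auto simp: a2 ap aq rr mult_ac)
  have h5: "\<exists>k. u*x2q*xp*x2pq = fund_unit (2*q) powi k \<or> u*x2q*xp*x2pq = - (fund_unit (2*q) powi k)"
    by (rule step[OF u U(5,2,7) K8(2,4,5,7) real_quadratics(5) sqrt_products(2) clKp(4)[OF gens_Kp(1,3)]])
      (auto simp: a2 ap aq rr mult_ac)
  have h6: "\<exists>k. u*xpq*x2*x2pq = fund_unit (p*q) powi k \<or> u*xpq*x2*x2pq = - (fund_unit (p*q) powi k)"
    by (rule step[OF u U(6,1,7) K8(3,4,5,6) real_quadratics(6) sqrt_products(3) clKp(4)[OF gens_Kp(2,3)]])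
      (auto simp: a2 ap aq rr mult_ac)
  have h7: "\<exists>k. u*x2p*x2q*xpq = fund_unit (2*p*q) powi k \<or> u*x2p*x2q*xpq = - (fund_unit (2*p*q) powi k)"
    by (rule step[OF u U(4,5,6) K8(2,3,4,8) real_quadratics(7) sqrt_products(4) clKp(4)[OF clKp(4)[OF gens_Kp(1,2)] gens_Kp(3)]])
      (auto simp: a2 ap aq rr mult_ac)
  obtain k1 where f1: "u*xp*xq*xpq = e2 powi k1 \<or> u*xp*xq*xpq = - (e2 powi k1)"
    using h1 unfolding e2_def by (elim exE)
  obtain k2 where f2: "u*x2*xq*x2q = ep powi k2 \<or> u*x2*xq*x2q = - (ep powi k2)"
    using h2 unfolding ep_def by (elim exE)
  obtain k4 where f3: "u*x2*xp*x2p = (A ^ 2) powi k4 \<or> u*x2*xp*x2p = - ((A ^ 2) powi k4)"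
    using h3 unfolding units_sq by (elim exE)
  obtain k3 where f4: "u*x2p*xq*x2pq = e2p powi k3 \<or> u*x2p*xq*x2pq = - (e2p powi k3)"
    using h4 unfolding e2p_def by (elim exE)
  obtain k5 where f5: "u*x2q*xp*x2pq = (B ^ 2) powi k5 \<or> u*x2q*xp*x2pq = - ((B ^ 2) powi k5)"
    using h5 unfolding units_sq by (elim exE)
  obtain k6 where f6: "u*xpq*x2*x2pq = (C ^ 2) powi k6 \<or> u*xpq*x2*x2pq = - ((C ^ 2) powi k6)"
    using h6 unfolding units_sq by (elim exE)
  obtain k7 where f7: "u*x2p*x2q*xpq = (G ^ 2) powi k7 \<or> u*x2p*x2q*xpq = - ((G ^ 2) powi k7)"
    using h7 unfolding units_sq by (elim exE)
  have ex: "\<exists>\<delta>. (\<delta> = 1 \<or> \<delta> = - 1) \<and> y = \<delta> * z" if "y = z \<or> y = - z" for y z :: complex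
    using that by (elim disjE) (rule exI[of _ 1], simp, rule exI[of _ "- 1"], simp)
  obtain d1 where dd1: "d1 = 1 \<or> d1 = - 1" "u*xp*xq*xpq = d1 * e2 powi k1"
    using ex[OF f1] by (elim exE conjE)
  obtain d2 where dd2: "d2 = 1 \<or> d2 = - 1" "u*x2*xq*x2q = d2 * ep powi k2"
    using ex[OF f2] by (elim exE conjE)
  obtain d3 where dd3: "d3 = 1 \<or> d3 = - 1" "u*x2*xp*x2p = d3 * (A ^ 2) powi k4"
    using ex[OF f3] by (elim exE conjE)
  obtain d4 where dd4: "d4 = 1 \<or> d4 = - 1" "u*x2p*xq*x2pq = d4 * e2p powi k3"
    using ex[OF f4] by (elim exE conjE)
  obtain d5 where dd5: "d5 = 1 \<or> d5 = - 1" "u*x2q*xp*x2pq = d5 * (B ^ 2) powi k5"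
    using ex[OF f5] by (elim exE conjE)
  obtain d6 where dd6: "d6 = 1 \<or> d6 = - 1" "u*xpq*x2*x2pq = d6 * (C ^ 2) powi k6"
    using ex[OF f6] by (elim exE conjE)
  obtain d7 where dd7: "d7 = 1 \<or> d7 = - 1" "u*x2p*x2q*xpq = d7 * (G ^ 2) powi k7"
    using ex[OF f7] by (elim exE conjE)
  have "u ^ 4 * N ^ 3 = (u*xp*xq*xpq) * (u*x2*xq*x2q) * (u*x2*xp*x2p) * (u*x2p*xq*x2pq) * (u*x2q*xp*x2pq)
      * (u*xpq*x2*x2pq) * (u*x2p*x2q*xpq)"
    unfolding N_def by (rule prod_seven_norms[symmetric])
  also have "\<dots> = (d1*d2*d3*d4*d5*d6*d7) * (e2 powi k1 * ep powi k2 * e2p powi k3 * (A ^ 2) powi k4 * (B ^ 2) powi k5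
      * (C ^ 2) powi k6 * (G ^ 2) powi k7)"
    unfolding dd1(2) dd2(2) dd3(2) dd4(2) dd5(2) dd6(2) dd7(2) by (simp only: mult_ac)
  finally have eq: "u ^ 4 * N ^ 3 = (d1*d2*d3*d4*d5*d6*d7) * (e2 powi k1 * ep powi k2 * e2p powi k3 * (A ^ 2) powi k4 * (B ^ 2) powi k5
      * (C ^ 2) powi k6 * (G ^ 2) powi k7)" .
  have sgn: "x * y = 1 \<or> x * y = - 1" if "x = 1 \<or> x = - 1" "y = 1 \<or> y = - 1" for x y :: complex
    using that by auto
  have N3: "N ^ 3 = N" using N1 by auto
  have "u ^ 4 = u ^ 4 * N ^ 3 * N" unfolding N3 using N1 by auto
  also have "\<dots> = (d1*d2*d3*d4*d5*d6*d7*N) * (e2 powi k1 * ep powi k2 * e2p powi k3 * (A ^ 2) powi k4 * (B ^ 2) powi k5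
      * (C ^ 2) powi k6 * (G ^ 2) powi k7)"
    unfolding eq by (simp only: mult_ac)
  finally show ?thesis
    by (rule that[rotated]) (intro sgn dd1(1) dd2(1) dd3(1) dd4(1) dd5(1) dd6(1) dd7(1) N1)
qed

end

section \<open>The units of the real field\<close>

text \<open>The bases are parameters so that automorphisms act on them while the exponents stay put;
  signs then split off by \<open>mon7_mult\<close> as a monomial in 1 and -1.\<close>

definition mon7 :: "complex \<Rightarrow> complex \<Rightarrow> complex \<Rightarrow> complex \<Rightarrow> complex \<Rightarrow> complex \<Rightarrow> complex \<Rightarrow>
    int \<Rightarrow> int \<Rightarrow> int \<Rightarrow> int \<Rightarrow> int \<Rightarrow> int \<Rightarrow> int \<Rightarrow> complex" where
  "mon7 a b c d e f g i j k l m n r =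
    a powi i * b powi j * c powi k * d powi l * e powi m * f powi n * g powi r"

lemma mon7_mult: "mon7 a b c d e f g i j k l m n r * mon7 a' b' c' d' e' f' g' i j k l m n r
    = mon7 (a * a') (b * b') (c * c') (d * d') (e * e') (f * f') (g * g') i j k l m n r"
  unfolding mon7_def by (simp only: power_int_mult_distrib mult_ac)

lemma mon7_square: "mon7 a b c d e f g i j k l m n r ^ 2
    = mon7 (a ^ 2) (b ^ 2) (c ^ 2) (d ^ 2) (e ^ 2) (f ^ 2) (g ^ 2) i j k l m n r"
  by (simp only: power2_eq_square mon7_mult)

lemma cancel4: "x \<noteq> 0 \<Longrightarrow> x * x * inverse x * inverse x = (1 :: complex)"
  by (simp add: field_simps)

context pq_primes
begin

lemma pos_mon7: "pos a \<Longrightarrow> pos b \<Longrightarrow> pos c \<Longrightarrow> pos d \<Longrightarrow> pos e \<Longrightarrow> pos f \<Longrightarrow> pos g \<Longrightarrow>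
    pos (mon7 a b c d e f g i j k l m n r)"
  unfolding mon7_def by (intro pos_mult pos_powi)

lemma hom_mon7:
  assumes f: "hom_on K f" and in_K: "a \<in> K" "b \<in> K" "c \<in> K" "d \<in> K" "e \<in> K" "h \<in> K" "g \<in> K"
  shows "f (mon7 a b c d e h g i j k l m n r) = mon7 (f a) (f b) (f c) (f d) (f e) (f h) (f g) i j k l m n r"
  unfolding mon7_def using in_K by (simp add: hom_mult[OF K(1) f] hom_powi[OF K(1) f] clK(4,10))

lemma pos_unit_square: "u \<in> unit_group Kp \<Longrightarrow> pos (u ^ 2)"
  using pos_Kp_square by (auto simp: unit_group_def)

lemma units_K: "e2 \<in> K" "ep \<in> K" "e2p \<in> K" "A \<in> K" "B \<in> K" "C \<in> K" "G \<in> K" "D \<in> K"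
  using act_e2(4) act_ep(4) act_e2p(4) act_A(4) act_B(4) act_C(4) act_G(4) D_in Kp_K by blast+

lemma pos_D: "pos D"
  unfolding D_def by (intro pos_psqrt pos_mult pos_units)

lemma square_eqD: "x ^ 2 = y ^ 2 \<Longrightarrow> \<exists>\<delta>. (\<delta> = 1 \<or> \<delta> = - 1) \<and> x = \<delta> * (y :: complex)"
proof -
  assume "x ^ 2 = y ^ 2"
  hence "x = y \<or> x = - y" by (simp add: power2_eq_iff)
  thus ?thesis by (elim disjE) (rule exI[of _ 1], simp, rule exI[of _ "- 1"], simp)
qed

text \<open>The conjugates of u^4 are positive; under \<open>s2\<close> and \<open>sp\<close> this
  makes \<open>k1\<close>, \<open>k2\<close>, \<open>k3\<close> congruent modulo 2. The common odd
  part is a power of e2 ep e2p = D^2, so the monomial is a square and its root can be taken.\<close>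

lemma unit_square:
  assumes u: "u \<in> unit_group Kp"
  obtains i j c k l m n where "u ^ 2 = mon7 e2 ep D A B C G i j c k l m n"
proof -
  obtain k1 k2 k3 k4 k5 k6 k7 \<delta> where \<delta>: "\<delta> = 1 \<or> \<delta> = - 1"
    and eq: "u ^ 4 = \<delta> * mon7 e2 ep e2p (A ^ 2) (B ^ 2) (C ^ 2) (G ^ 2) k1 k2 k3 k4 k5 k6 k7"
    using unit_pow_4[OF u] unfolding mon7_def by metis
  let ?M = "mon7 e2 ep e2p (A ^ 2) (B ^ 2) (C ^ 2) (G ^ 2) k1 k2 k3 k4 k5 k6 k7"
  have uK: "u \<in> K" using u Kp_K by (auto simp: unit_group_def)
  have pos4: "pos (x ^ 4)" if "x \<in> unit_group Kp" for x
    using pos_mult[OF pos_unit_square[OF that] pos_unit_square[OF that]] by (simp flip: power_add)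
  have p2: "pos (x ^ 2)" if "pos x" for x using pos_mult[OF that that] by (simp add: power2_eq_square)
  have posM: "pos ?M" by (intro pos_mon7 p2 pos_units)
  have "\<delta> = 1"
  proof (rule ccontr)
    assume "\<delta> \<noteq> 1"
    hence "u ^ 4 = - ?M" using \<delta> eq by simp
    thus False using pos4[OF u] not_pos_minus[OF posM] by simp
  qed
  hence eq: "u ^ 4 = ?M" using eq by simp
  have "s2 u ^ 4 = s2 ?M" unfolding eq[symmetric] by (rule hom_power[OF K(1) hom_s2 uK, symmetric])
  also have "\<dots> = mon7 (- 1 * inverse e2) (1 * ep) (- 1 * inverse e2p) (1 * A ^ 2) (1 * (inverse B) ^ 2)
      (1 * C ^ 2) (1 * (inverse G) ^ 2) k1 k2 k3 k4 k5 k6 k7"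
    by (subst hom_mon7[OF hom_s2]) (simp_all add: units_K clK(9) hom_power[OF K(1) hom_s2] act_e2 act_ep act_e2p act_A act_B act_C act_G)
  also have "\<dots> = mon7 (- 1) 1 (- 1) 1 1 1 1 k1 k2 k3 k4 k5 k6 k7 *
      mon7 (inverse e2) ep (inverse e2p) (A ^ 2) ((inverse B) ^ 2) (C ^ 2) ((inverse G) ^ 2) k1 k2 k3 k4 k5 k6 k7"
    by (rule mon7_mult[symmetric])
  also have "mon7 (- 1) 1 (- 1) 1 1 1 1 k1 k2 k3 k4 k5 k6 k7 = (- 1) powi (k1 + k3)"
    by (simp add: mon7_def power_int_add)
  finally have "even (k1 + k3)"
    by (rule pos_sign[rotated 2]) (intro pos4 unit_gal u pos_mon7 pos_inverse p2 pos_units)+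
  have "sp u ^ 4 = sp ?M" unfolding eq[symmetric] by (rule hom_power[OF K(1) hom_sp uK, symmetric])
  also have "\<dots> = mon7 (1 * e2) (- 1 * inverse ep) (- 1 * inverse e2p) (1 * A ^ 2) (1 * B ^ 2)
      (1 * (inverse C) ^ 2) (1 * (inverse G) ^ 2) k1 k2 k3 k4 k5 k6 k7"
    by (subst hom_mon7[OF hom_sp]) (simp_all add: units_K clK(9) hom_power[OF K(1) hom_sp] act_e2 act_ep act_e2p act_A act_B act_C act_G)
  also have "\<dots> = mon7 1 (- 1) (- 1) 1 1 1 1 k1 k2 k3 k4 k5 k6 k7 *
      mon7 e2 (inverse ep) (inverse e2p) (A ^ 2) (B ^ 2) ((inverse C) ^ 2) ((inverse G) ^ 2) k1 k2 k3 k4 k5 k6 k7"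
    by (rule mon7_mult[symmetric])
  also have "mon7 1 (- 1) (- 1) 1 1 1 1 k1 k2 k3 k4 k5 k6 k7 = (- 1) powi (k2 + k3)"
    by (simp add: mon7_def power_int_add)
  finally have "even (k2 + k3)"
    by (rule pos_sign[rotated 2]) (intro pos4 unit_gal u pos_mon7 pos_inverse p2 pos_units)+
  from \<open>even (k1 + k3)\<close> \<open>even (k2 + k3)\<close> have "even (k1 - k3)" "even (k2 - k3)" by presburger+
  then obtain i j where ij: "k1 = k3 + 2 * i" "k2 = k3 + 2 * j" by (elim evenE) (metis diff_add_cancel add.commute)
  have sq: "(x ^ 2) powi k = (x powi k) ^ 2" for x :: complex and k
    by (simp add: power2_eq_square power_int_mult_distrib)
  have "(u ^ 2) ^ 2 = u ^ 4" by (simp flip: power_mult)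
  also have "\<dots> = (e2 * ep * e2p) powi k3 * (e2 powi i) ^ 2 * (ep powi j) ^ 2 * (A powi k4) ^ 2 * (B powi k5) ^ 2
      * (C powi k6) ^ 2 * (G powi k7) ^ 2"
    unfolding eq mon7_def ij sq power_int_even_split[OF units_ne_0(1)] power_int_even_split[OF units_ne_0(2)]
      power_int_mult_distrib by (simp only: mult_ac)
  also have "\<dots> = (mon7 e2 ep D A B C G i j k3 k4 k5 k6 k7) ^ 2"
    unfolding D_sq[symmetric] sq mon7_def power_mult_distrib by (simp only: mult_ac)
  finally obtain \<delta> where \<delta>: "\<delta> = 1 \<or> \<delta> = - 1" "u ^ 2 = \<delta> * mon7 e2 ep D A B C G i j k3 k4 k5 k6 k7"
    using square_eqD by blast
  have "\<delta> = 1"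
  proof (rule ccontr)
    assume "\<delta> \<noteq> 1"
    hence "u ^ 2 = - mon7 e2 ep D A B C G i j k3 k4 k5 k6 k7" using \<delta> by simp
    moreover have "pos (mon7 e2 ep D A B C G i j k3 k4 k5 k6 k7)" by (intro pos_mon7 pos_units pos_D)
    ultimately show False using pos_unit_square[OF u] not_pos_minus by metis
  qed
  thus ?thesis using that \<delta>(2) by simp
qed

text \<open>The norm to the field \<open>\<rat>(\<surd>q)\<close>; it takes the value \<open>-1\<close> at \<open>D\<close>, which therefore enters
  every square of a unit with an even exponent.\<close>

definition N4 :: "complex \<Rightarrow> complex" where
  "N4 x = x * s2 x * sp x * s2 (sp x)"

text \<open>The sign is left undetermined: it enters \<open>N4 D\<close> squared.\<close>

lemma s2_D: "\<exists>\<delta>. (\<delta> = 1 \<or> \<delta> = - 1) \<and> D * s2 D = \<delta> * ep"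
proof (rule square_eqD)
  have "(D * s2 D) ^ 2 = D ^ 2 * s2 (D ^ 2)"
    by (simp add: power_mult_distrib hom_power[OF K(1) hom_s2] units_K)
  also have "s2 (D ^ 2) = ep * inverse e2 * inverse e2p"
    unfolding D_sq by (simp add: hom_mult[OF K(1) hom_s2] units_K clK(4) act_e2 act_ep act_e2p)
  also have "D ^ 2 * (ep * inverse e2 * inverse e2p) = ep ^ 2"
    unfolding D_sq using units_ne_0 by (simp add: field_simps power2_eq_square)
  finally show "(D * s2 D) ^ 2 = ep ^ 2" .
qed

lemma N4_values: "N4 e2 = 1" "N4 ep = 1" "N4 D = - 1" "N4 A = A ^ 4" "N4 B = 1" "N4 C = 1" "N4 G = 1"
proof -
  note h = hom_inverse[OF K(1) hom_s2] hom_inverse[OF K(1) hom_sp] hom_minus[OF K(1) hom_s2] hom_minus[OF K(1) hom_sp]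
    units_K clK(5,6) act_e2 act_ep act_e2p act_A act_B act_C act_G
  show "N4 e2 = 1" "N4 ep = 1" "N4 A = A ^ 4" "N4 B = 1" "N4 C = 1" "N4 G = 1"
    unfolding N4_def using units_ne_0 cancel4[OF units_ne_0(2)] cancel4[OF units_ne_0(6)]
    by (simp_all add: h power4_eq_xxxx)
  obtain \<delta> where \<delta>: "\<delta> = 1 \<or> \<delta> = - 1" "D * s2 D = \<delta> * ep" using s2_D by blast
  have "N4 D = D * s2 D * sp (D * s2 D)"
    unfolding N4_def using gal_commute(1)[OF units_K(8)] gal_K(1)[OF units_K(8)]
    by (simp add: hom_mult[OF K(1) hom_sp] units_K mult_ac)
  also have "sp (D * s2 D) = - (\<delta> * inverse ep)"
    unfolding \<delta>(2) using \<delta>(1) by (auto simp: h)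
  finally show "N4 D = - 1" unfolding \<delta>(2) using \<delta>(1) units_ne_0 by auto
qed

lemma N4_mon7:
  "N4 (mon7 e2 ep D A B C G i j c k l m n) = mon7 1 1 (- 1) (A ^ 4) 1 1 1 i j c k l m n"
proof -
  have "N4 (mon7 e2 ep D A B C G i j c k l m n)
      = mon7 (N4 e2) (N4 ep) (N4 D) (N4 A) (N4 B) (N4 C) (N4 G) i j c k l m n"
    unfolding N4_def by (simp only: hom_mon7[OF hom_s2] hom_mon7[OF hom_sp] units_K gal_K mon7_mult)
  thus ?thesis by (simp only: N4_values)
qed

text \<open>An element known only up to sign still detects whether \<open>f\<close> negates it,
  because the unknown sign is the same on both sides.\<close>

lemma fixed_sign:
  assumes "y = f y" "y = \<delta> * z" "\<delta> = 1 \<or> \<delta> = - (1 :: complex)" "f z = (- 1) powi k * z" "z \<noteq> 0"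
    "f (- z) = - f z"
  shows "even k"
proof (rule ccontr)
  assume "odd k"
  hence "f z = - z" using assms(4) by (simp add: minus_one_powi)
  hence "f y = - y" using assms(2,3,6) by auto
  hence "y = - y" using assms(1) by simp
  hence "2 * y = 0" by simp
  thus False using assms(2,3,5) by auto
qed

lemma gal_s2q: "hom_on K (\<lambda>x. s2 (sq x))"
  by (rule comp_hom[OF hom_sq hom_s2]) (rule gal_K)

text \<open>The six parity conditions found below leave \<open>j\<close>, \<open>c\<close>,
  \<open>l\<close> even and \<open>i\<close>, \<open>k\<close>, \<open>m\<close>, \<open>n\<close>
  congruent modulo 2. This is a square times a power of e2 A C G, which is E^2.\<close>

theorem unit_Kp_form:
  assumes u: "u \<in> unit_group Kp"
  obtains i j c k l m n and \<delta> :: complex where "\<delta> = 1 \<or> \<delta> = - 1" "u = \<delta> * mon7 e2 ep D E B C G i j c k l m n"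
proof -
  obtain i j c k l m n where eq: "u ^ 2 = mon7 e2 ep D A B C G i j c k l m n"
    using unit_square[OF u] by metis
  have uK: "u \<in> K" and uKp: "u \<in> Kp" and u0: "u \<noteq> 0" using u Kp_K by (auto simp: unit_group_def)
  have hs2: "s2 (u ^ 2) = (s2 u) ^ 2" and hsp: "sp (u ^ 2) = (sp u) ^ 2" and hsq: "sq (u ^ 2) = (sq u) ^ 2"
    and hs2sp: "s2 ((sp u) ^ 2) = (s2 (sp u)) ^ 2"
    using uK gal_K by (simp_all add: hom_power[OF K(1) hom_s2] hom_power[OF K(1) hom_sp] hom_power[OF K(1) hom_sq])
  note sim = units_K clK(4-6,9) hom_inverse[OF K(1) hom_s2] hom_inverse[OF K(1) hom_sp] hom_inverse[OF K(1) hom_sq]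
    hom_minus[OF K(1) hom_s2] hom_minus[OF K(1) hom_sp] hom_minus[OF K(1) hom_sq]
    hom_mult[OF K(1) hom_s2] hom_mult[OF K(1) hom_sp] hom_mult[OF K(1) hom_sq]
    act_e2 act_ep act_e2p act_A act_B act_C act_G
  have "(N4 u) ^ 2 = N4 (u ^ 2)"
    unfolding N4_def hs2 hsp hs2sp by (simp add: power_mult_distrib)
  also have "\<dots> = (- 1) powi c * (A ^ 4) powi k" unfolding eq N4_mon7 by (simp add: mon7_def)
  finally have "even c"
  proof (rule pos_sign[rotated 2])
    have "N4 u \<in> unit_group Kp" unfolding N4_def by (intro unit_group_mult[OF Kp(1)] unit_gal u)
    thus "pos (N4 u ^ 2)" by (rule pos_unit_square)
    have "A ^ 4 = (A * A) * (A * A)" by (simp add: power4_eq_xxxx mult_ac)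
    thus "pos ((A ^ 4) powi k)" by (simp only:) (intro pos_powi pos_mult pos_units)
  qed
  then obtain c' where c: "c = 2 * c'" by (rule evenE)
  \<comment> \<open>The action on D is known only up to sign, so the even power of D is rewritten
    through D^2, on which it is explicit.\<close>
  define D2 where "D2 = e2 * ep * e2p"
  have D2K: "D2 \<in> K" unfolding D2_def by (intro clK(4) units_K)
  have "D powi c = (D powi c') ^ 2"
    unfolding c by (subst mult.commute) (simp add: power_int_mult)
  also have "\<dots> = D2 powi c'"
    unfolding D2_def D_sq[symmetric] by (simp add: power2_eq_square power_int_mult_distrib)
  finally have eq': "u ^ 2 = mon7 e2 ep D2 A B C G i j c' k l m n" unfolding eq mon7_def by simp
  have posD2: "pos D2" unfolding D2_def by (intro pos_mult pos_units)
  have D2_act: "s2 D2 = ep * (inverse e2 * inverse e2p)" "sp D2 = e2 * (inverse ep * inverse e2p)" "sq D2 = D2"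
    unfolding D2_def by (simp_all add: sim)
  have "(sp u) ^ 2 = mon7 (1 * e2) (- 1 * inverse ep) (1 * (e2 * (inverse ep * inverse e2p))) (1 * A) (1 * B)
      (1 * inverse C) (1 * inverse G) i j c' k l m n"
    unfolding hsp[symmetric] eq' by (subst hom_mon7[OF hom_sp]) (simp_all add: sim D2_act D2K)
  also have "\<dots> = mon7 1 (- 1) 1 1 1 1 1 i j c' k l m n *
      mon7 e2 (inverse ep) (e2 * (inverse ep * inverse e2p)) A B (inverse C) (inverse G) i j c' k l m n"
    by (rule mon7_mult[symmetric])
  also have "mon7 1 (- 1) 1 1 1 1 1 i j c' k l m n = (- 1) powi j" by (simp add: mon7_def)
  finally have "even j"
    by (rule pos_sign[rotated 2]) (intro pos_unit_square unit_gal u pos_mon7 pos_inverse pos_mult pos_units)+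
  have "(sq u) ^ 2 = mon7 (1 * e2) (1 * ep) (1 * D2) (1 * inverse A) (1 * inverse B)
      (- 1 * inverse C) (- 1 * inverse G) i j c' k l m n"
    unfolding hsq[symmetric] eq' by (subst hom_mon7[OF hom_sq]) (simp_all add: sim D2_act D2K)
  also have "\<dots> = mon7 1 1 1 1 1 (- 1) (- 1) i j c' k l m n *
      mon7 e2 ep D2 (inverse A) (inverse B) (inverse C) (inverse G) i j c' k l m n"
    by (rule mon7_mult[symmetric])
  also have "mon7 1 1 1 1 1 (- 1) (- 1) i j c' k l m n = (- 1) powi (m + n)" by (simp add: mon7_def power_int_add)
  finally have mn: "even (m + n)"
    by (rule pos_sign[rotated 2]) (intro pos_unit_square unit_gal u pos_mon7 pos_inverse pos_units posD2)+
  have s2u: "(s2 u) ^ 2 = mon7 (- 1 * inverse e2) (1 * ep) (1 * (ep * (inverse e2 * inverse e2p))) (- 1 * A) (- 1 * inverse B)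
      (- 1 * C) (- 1 * inverse G) i j c' k l m n"
    unfolding hs2[symmetric] eq' by (subst hom_mon7[OF hom_s2]) (simp_all add: sim D2_act D2K)
  also have "\<dots> = mon7 (- 1) 1 1 (- 1) (- 1) (- 1) (- 1) i j c' k l m n *
      mon7 (inverse e2) ep (ep * (inverse e2 * inverse e2p)) A (inverse B) C (inverse G) i j c' k l m n"
    by (rule mon7_mult[symmetric])
  also have sgn: "mon7 (- 1) 1 1 (- 1) (- 1) (- 1) (- 1) i j c' k l m n = (- 1) powi (i + k + l + m + n)"
    by (simp add: mon7_def power_int_add)
  finally have ik: "even (i + k + l + m + n)"
    by (rule pos_sign[rotated 2]) (intro pos_unit_square unit_gal u pos_mon7 pos_inverse pos_mult pos_units)+
  have ep2: "D2 * (ep * (inverse e2 * inverse e2p)) = ep ^ 2"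
    unfolding D2_def using units_ne_0 by (simp add: field_simps power2_eq_square)
  \<comment> \<open>In u s2(u) the inverses cancel, and its square is that of \<open>?z\<close>. The
    product is fixed by \<open>s2\<close>, while \<open>s2\<close> multiplies \<open>?z\<close> by
    -1 to the power k + m.\<close>
  have km: "even (k + m)"
  proof -
    let ?z = "mon7 1 ep ep A 1 C 1 i j c' k l m n"
    have "(u * s2 u) ^ 2 = mon7 (- 1 * 1) (1 * ep ^ 2) (1 * ep ^ 2) (- 1 * A ^ 2) (- 1 * 1) (- 1 * C ^ 2) (- 1 * 1) i j c' k l m n"
      unfolding power_mult_distrib s2u eq' mon7_mult
      using units_ne_0 by (simp add: ep2 power2_eq_square)
    also have "\<dots> = mon7 (- 1) 1 1 (- 1) (- 1) (- 1) (- 1) i j c' k l m n * mon7 1 (ep ^ 2) (ep ^ 2) (A ^ 2) 1 (C ^ 2) 1 i j c' k l m n"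
      by (rule mon7_mult[symmetric])
    also have "\<dots> = ?z ^ 2" unfolding sgn mon7_square using ik by (simp add: minus_one_powi)
    finally obtain \<delta> where \<delta>: "\<delta> = 1 \<or> \<delta> = - 1" "u * s2 u = \<delta> * ?z" using square_eqD by blast
    have zK: "?z \<in> K" unfolding mon7_def by (intro clK(2,4,10) units_K)
    have fx: "u * s2 u = s2 (u * s2 u)"
      using uK gal_K gal_invol by (simp add: hom_mult[OF K(1) hom_s2] mult.commute)
    have "s2 ?z = mon7 (1 * 1) (1 * ep) (1 * ep) (- 1 * A) (1 * 1) (- 1 * C) (1 * 1) i j c' k l m n"
      by (subst hom_mon7[OF hom_s2]) (simp_all add: sim clK(2) hom_1[OF K(1) hom_s2])
    also have "\<dots> = mon7 1 1 1 (- 1) 1 (- 1) 1 i j c' k l m n * ?z" by (rule mon7_mult[symmetric])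
    also have "mon7 1 1 1 (- 1) 1 (- 1) 1 i j c' k l m n = (- 1) powi (k + m)" by (simp add: mon7_def power_int_add)
    finally show ?thesis
      by (rule fixed_sign[where f = s2 and y = "u * s2 u" and z = ?z and \<delta> = \<delta>, OF fx \<delta>(2,1)])
        (use pos_ne_0[OF pos_mon7[OF pos_1 pos_units(2,2,4) pos_1 pos_units(6) pos_1]] hom_minus[OF K(1) hom_s2 zK] in simp_all)
  qed
  \<comment> \<open>For s2 composed with sq, the bases A and C cancel against their inverses while B
    and G survive; of these only B changes sign.\<close>
  have l: "even l"
  proof -
    let ?t = "\<lambda>x. s2 (sq x)"
    let ?z = "mon7 1 ep ep 1 B 1 G i j c' k l m n"
    have "(?t u) ^ 2 = ?t (u ^ 2)" by (rule hom_power[OF K(1) gal_s2q uK, symmetric])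
    also have "\<dots> = mon7 (- 1 * inverse e2) (1 * ep) (1 * (ep * (inverse e2 * inverse e2p))) (- 1 * inverse A) (- 1 * B)
      (1 * inverse C) (1 * G) i j c' k l m n"
      unfolding eq' by (subst hom_mon7[OF gal_s2q]) (simp_all add: sim D2_act D2K)
    finally have tu: "(?t u) ^ 2 = mon7 (- 1 * inverse e2) (1 * ep) (1 * (ep * (inverse e2 * inverse e2p))) (- 1 * inverse A) (- 1 * B)
      (1 * inverse C) (1 * G) i j c' k l m n" .
    have "(u * ?t u) ^ 2 = mon7 (- 1 * 1) (1 * ep ^ 2) (1 * ep ^ 2) (- 1 * 1) (- 1 * B ^ 2) (1 * 1) (1 * G ^ 2) i j c' k l m n"
      unfolding power_mult_distrib tu eq' mon7_mult
      using units_ne_0 by (simp add: ep2 power2_eq_square)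
    also have "\<dots> = mon7 (- 1) 1 1 (- 1) (- 1) 1 1 i j c' k l m n * mon7 1 (ep ^ 2) (ep ^ 2) 1 (B ^ 2) 1 (G ^ 2) i j c' k l m n"
      by (rule mon7_mult[symmetric])
    also have "mon7 (- 1) 1 1 (- 1) (- 1) 1 1 i j c' k l m n = (- 1) powi (i + k + l)" by (simp add: mon7_def power_int_add)
    also have "even (i + k + l)" using ik mn by presburger
    hence "(- 1) powi (i + k + l) = (1 :: complex)" by (simp add: minus_one_powi)
    also have "1 * mon7 1 (ep ^ 2) (ep ^ 2) 1 (B ^ 2) 1 (G ^ 2) i j c' k l m n = ?z ^ 2" unfolding mon7_square by simp
    finally obtain \<delta> where \<delta>: "\<delta> = 1 \<or> \<delta> = - 1" "u * ?t u = \<delta> * ?z" using square_eqD by blast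
    have zK: "?z \<in> K" unfolding mon7_def by (intro clK(2,4,10) units_K)
    have fx: "u * ?t u = ?t (u * ?t u)"
      using uK gal_K gal_invol gal_commute by (simp add: hom_mult[OF K(1) gal_s2q] mult.commute)
    have "?t ?z = mon7 (1 * 1) (1 * ep) (1 * ep) (1 * 1) (- 1 * B) (1 * 1) (1 * G) i j c' k l m n"
      by (subst hom_mon7[OF gal_s2q]) (simp_all add: sim clK(2) hom_1[OF K(1) hom_s2] hom_1[OF K(1) hom_sq])
    also have "\<dots> = mon7 1 1 1 1 (- 1) 1 1 i j c' k l m n * ?z" by (rule mon7_mult[symmetric])
    also have "mon7 1 1 1 1 (- 1) 1 1 i j c' k l m n = (- 1) powi l" by (simp add: mon7_def)
    finally show ?thesis
      by (rule fixed_sign[where f = ?t and y = "u * ?t u" and z = ?z and \<delta> = \<delta>, OF fx \<delta>(2,1)])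
        (use pos_ne_0[OF pos_mon7[OF pos_1 pos_units(2,2) pos_1 pos_units(5) pos_1 pos_units(7)]] hom_minus[OF K(1) gal_s2q zK] in simp_all)
  qed
  from \<open>even j\<close> obtain j' where j: "j = 0 + 2 * j'" by (auto elim: evenE)
  from l obtain l' where l: "l = 0 + 2 * l'" by (auto elim: evenE)
  have "even (i - k)" "even (m - k)" "even (n - k)" using ik km mn \<open>even l\<close> by presburger+
  then obtain i' m' n' where imn: "i = k + 2 * i'" "m = k + 2 * m'" "n = k + 2 * n'"
    by (elim evenE) (metis diff_add_cancel add.commute)
  have sq: "(x ^ 2) powi k = (x powi k) ^ 2" for x :: complex and k
    by (simp add: power2_eq_square power_int_mult_distrib)
  \<comment> \<open>The fourth base is 1 because the whole power of A is absorbed in the first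
    factor; E takes this place once the root is drawn.\<close>
  have "u ^ 2 = (e2 * A * C * G) powi k * (mon7 e2 ep D 1 B C G i' j' c' k l' m' n') ^ 2"
    unfolding eq unfolding mon7_def imn j l c power_int_even_split[OF units_ne_0(1)] power_int_even_split[OF units_ne_0(2)]
      power_int_even_split[OF units_ne_0(5)] power_int_even_split[OF units_ne_0(6)] power_int_even_split[OF units_ne_0(7)]
      power_int_mult_distrib power_mult_distrib mult.commute[of 2 c'] power_int_mult by (simp add: mult_ac)
  also have "\<dots> = (mon7 e2 ep D E B C G i' j' c' k l' m' n') ^ 2"
    unfolding E_sq[symmetric] sq by (simp add: mon7_def power_mult_distrib mult_ac)
  finally obtain \<delta> where "\<delta> = 1 \<or> \<delta> = - 1" "u = \<delta> * mon7 e2 ep D E B C G i' j' c' k l' m' n'"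
    using square_eqD by blast
  thus ?thesis by (rule that)
qed

end

section \<open>Roots of unity and the units of the full field\<close>

text \<open>The five polynomials X^2 - t X + 1 have only roots of unity of order 1, 2, 3, 4 or 6 as
  zeros.\<close>

lemma root_of_unity_12:
  fixes w w' :: complex and t :: int
  assumes ww: "w * w' = 1" and t: "w + w' = of_int t" "\<bar>t\<bar> \<le> 2"
  shows "w ^ 12 = 1"
proof -
  have w0: "w \<noteq> 0" using ww by auto
  have "w ^ 2 - of_int t * w + 1 = w ^ 2 - (w + w') * w + w * w'" unfolding t(1) ww ..
  also have "\<dots> = 0" by (simp add: algebra_simps power2_eq_square)
  finally have eq: "w ^ 2 - of_int t * w + 1 = 0" .
  have "t = 2 \<or> t = - 2 \<or> t = 0 \<or> t = 1 \<or> t = - 1" using t(2) by presburger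
  thus ?thesis
  proof (elim disjE)
    assume "t = 2"
    hence "(w - 1) ^ 2 = 0" using eq by (simp add: algebra_simps power2_eq_square)
    thus ?thesis by simp
  next
    assume "t = - 2"
    hence "(w + 1) ^ 2 = 0" using eq by (simp add: algebra_simps power2_eq_square)
    hence "w = - 1" by (simp add: add_eq_0_iff2)
    thus ?thesis by simp
  next
    assume "t = 0"
    hence "w ^ 2 = - 1" using eq by (simp add: add_eq_0_iff2)
    moreover have "w ^ 12 = (w ^ 2) ^ 6" by (simp flip: power_mult)
    ultimately show ?thesis by simp
  next
    assume "t = 1"
    hence "w ^ 2 - w + 1 = 0" using eq by simp
    moreover have "w ^ 3 + 1 = (w + 1) * (w ^ 2 - w + 1)"
      by (simp add: algebra_simps power2_eq_square power3_eq_cube)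
    ultimately have "w ^ 3 = - 1" by (simp add: add_eq_0_iff2)
    moreover have "w ^ 12 = (w ^ 3) ^ 4" by (simp flip: power_mult)
    ultimately show ?thesis by simp
  next
    assume "t = - 1"
    hence "w ^ 2 + w + 1 = 0" using eq by simp
    moreover have "w ^ 3 - 1 = (w - 1) * (w ^ 2 + w + 1)"
      by (simp add: algebra_simps power2_eq_square power3_eq_cube)
    ultimately have "w ^ 3 = 1" by simp
    moreover have "w ^ 12 = (w ^ 3) ^ 4" by (simp flip: power_mult)
    ultimately show ?thesis by simp
  qed
qed

lemma zeta8_eq: "zeta8 = (1 + \<i>) / of_real (sqrt 2)"
  by (simp add: zeta8_def complex_eq_iff cos_45 sin_45 Re_divide_of_real Im_divide_of_real field_simps)

lemma zeta8_2: "zeta8 ^ 2 = \<i>"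
  unfolding zeta8_eq power_divide by (simp add: power2_eq_square algebra_simps flip: of_real_mult)

lemma zeta8_4: "zeta8 ^ 4 = - 1"
proof -
  have "zeta8 ^ 4 = (zeta8 ^ 2) ^ 2" by (simp flip: power_mult)
  thus ?thesis by (simp add: zeta8_2)
qed

lemma zeta8_ne_0: "zeta8 \<noteq> 0"
  using zeta8_2 by auto

lemma fourth_root_of_unity:
  fixes z :: complex
  assumes "z ^ 4 = 1"
  shows "\<exists>k. z = zeta8 ^ (2 * k)"
proof -
  have "(z ^ 2 - 1) * (z ^ 2 + 1) = z ^ 4 - 1"
    by (simp add: algebra_simps flip: power_add)
  hence "(z ^ 2 - 1) * (z ^ 2 + 1) = 0" using assms by simp
  hence "z ^ 2 = 1 ^ 2 \<or> z ^ 2 = \<i> ^ 2" by (auto simp: add_eq_0_iff2)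
  hence "z = 1 \<or> z = - 1 \<or> z = \<i> \<or> z = - \<i>" unfolding power2_eq_iff by blast
  hence "z = \<i> ^ 0 \<or> z = \<i> ^ 2 \<or> z = \<i> ^ 1 \<or> z = \<i> ^ 3" by (simp add: power3_eq_cube)
  hence "\<exists>k. z = \<i> ^ k" by blast
  thus ?thesis by (simp add: power_mult zeta8_2)
qed

lemma eighth_root_of_unity:
  fixes z :: complex
  assumes "z ^ 8 = 1"
  obtains k where "z = zeta8 ^ (2 * k) \<or> z = zeta8 ^ (2 * k) * zeta8"
proof -
  have "(z ^ 4) ^ 2 = 1" using assms by (simp flip: power_mult)
  hence "z ^ 4 = 1 \<or> z ^ 4 = - 1" by (simp only: power2_eq_1_iff)
  thus ?thesis
  proof
    assume "z ^ 4 = - 1"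
    hence "(z / zeta8) ^ 4 = 1" by (simp add: power_divide zeta8_4)
    then obtain k where "z / zeta8 = zeta8 ^ (2 * k)" using fourth_root_of_unity by blast
    hence "z = zeta8 ^ (2 * k) * zeta8" using zeta8_ne_0 by (simp add: field_simps)
    thus ?thesis using that by blast
  qed (use fourth_root_of_unity that in blast)
qed

lemma cnj_zeta8: "cnj zeta8 = inverse zeta8"
  by (simp add: zeta8_def cis_inverse cis_cnj)

context pq_primes
begin

lemma zeta8_K: "zeta8 \<in> K"
proof -
  have eq: "zeta8 = (1 + \<i>) / r2" by (simp add: zeta8_eq r2_def)
  show ?thesis unfolding eq by (intro clK(2,3,8) gens_K)
qed

lemma zeta8_unit: "zeta8 \<in> unit_group K"
proof (rule unit_group_of_power[of zeta8 4 K])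
  show "zeta8 ^ 4 \<in> unit_group K" unfolding zeta8_4 by (rule unit_group_uminus_one[OF K(1)])
qed (simp_all add: zeta8_K)

lemma unit_gal_K:
  assumes "u \<in> unit_group K" and f: "hom_on K f" "\<And>x. x \<in> K \<Longrightarrow> f x \<in> K"
  shows "f u \<in> unit_group K"
proof -
  have u: "u \<in> K" "u \<noteq> 0" "algebraic_int u" "algebraic_int (inverse u)"
    using assms(1) by (simp_all add: unit_group_def)
  show ?thesis
    using f(2)[OF u(1)] hom_algebraic_int[OF K(1) f(1) u(1,3)]
      hom_algebraic_int[OF K(1) f(1) clK(6)[OF u(1)] u(4)] hom_inverse[OF K(1) f(1) u(1)]
      hom_eq_0_iff[OF K(1) f(1) u(1)] u(2)
    by (simp add: unit_group_def)
qed

section \<open>Roots of unity in K\<close>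

text \<open>On the unit circle w + cnj w is real of absolute value at most 2; invariance and
  integrality make it a rational integer.\<close>

lemma real_fixed_root:
  assumes w: "w \<in> unit_group K" "w * cnj w = 1"
    and fixd: "\<And>f. f \<in> {s2, sp, sq} \<Longrightarrow> f (w + cnj w) = w + cnj w"
  shows "w ^ 12 = 1"
proof -
  have wK: "w \<in> K" and wa: "algebraic_int w" using w by (simp_all add: unit_group_def)
  let ?t = "w + cnj w"
  have tK: "?t \<in> K" using wK gal_K(4) by (intro clK(3))
  have "cnj ?t = ?t" by (simp add: add.commute)
  hence tKp: "?t \<in> Kp" by (rule K_real[OF tK])
  have "?t \<in> \<rat>" using fixd by (intro fixed_Rats[OF tKp]) simp_all
  moreover have "algebraic_int ?t" using wa by (intro algebraic_int_plus) simp_all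
  ultimately have "?t \<in> \<int>" using rational_algebraic_int_is_int by blast
  then obtain t where t: "?t = of_int t" by (rule Ints_cases)
  have "cmod w * cmod (cnj w) = 1" using w(2) by (metis norm_mult norm_one)
  hence "cmod w ^ 2 = 1" by (simp add: power2_eq_square)
  hence n1: "cmod w = 1" using norm_ge_zero[of w] by (auto simp: power2_eq_1_iff)
  have "cmod ?t \<le> cmod w + cmod (cnj w)" by (rule norm_triangle_ineq)
  hence "\<bar>real_of_int t\<bar> \<le> 2" unfolding t using n1 by simp
  hence "\<bar>t\<bar> \<le> 2" by linarith
  thus ?thesis by (rule root_of_unity_12[OF w(2) t])
qed

text \<open>Complex conjugation commutes with the other automorphisms, so all conjugates of
  \<open>z\<close> lie on the unit circle. Each of the seven norms then has order dividing 24, and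
  the product formula for z^4 gives 4 * 24 = 96.\<close>

lemma torsion_96:
  assumes z: "z \<in> unit_group K" "z * cnj z = 1"
  shows "z ^ 96 = 1"
proof -
  define x2 xp xq x2p x2q xpq x2pq where x: "x2 = s2 z" "xp = sp z" "xq = sq z" "x2p = s2 (sp z)"
    "x2q = s2 (sq z)" "xpq = sp (sq z)" "x2pq = s2 (sp (sq z))"
  have ug: "f u \<in> unit_group K" if "f \<in> {s2, sp, sq, cnj}" "u \<in> unit_group K" for f u
    using that unit_gal_K[OF that(2)] hom_s2 hom_sp hom_sq hom_on_cnj gal_K by blast
  have U: "z \<in> unit_group K" "x2 \<in> unit_group K" "xp \<in> unit_group K" "xq \<in> unit_group K" "x2p \<in> unit_group K"
    "x2q \<in> unit_group K" "xpq \<in> unit_group K" "x2pq \<in> unit_group K"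
    unfolding x by (intro z(1) ug[of s2] ug[of sp] ug[of sq]; simp)+
  have inK: "y \<in> K" and nz: "y \<noteq> 0" if "y \<in> unit_group K" for y using that by (simp_all add: unit_group_def)
  note K8 = U[THEN inK]
  have c: "sp (s2 y) = s2 (sp y)" "sq (s2 y) = s2 (sq y)" "sq (sp y) = sp (sq y)"
    "s2 (s2 y) = y" "sp (sp y) = y" "sq (sq y) = y" if "y \<in> K" for y
    using gal_commute(1-3)[OF that] gal_invol[OF that] by simp_all
  have a2: "s2 z = x2" "s2 x2 = z" "s2 xp = x2p" "s2 xq = x2q" "s2 x2p = xp" "s2 x2q = xq" "s2 xpq = x2pq" "s2 x2pq = xpq"
    unfolding x using K8(1) by (simp_all add: c gal_K)
  have ap: "sp z = xp" "sp x2 = x2p" "sp xp = z" "sp xq = xpq" "sp x2p = x2" "sp x2q = x2pq" "sp xpq = xq" "sp x2pq = x2q"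
    unfolding x using K8(1) by (simp_all add: c gal_K)
  have aq: "sq z = xq" "sq x2 = x2q" "sq xp = xpq" "sq xq = z" "sq x2p = x2pq" "sq x2q = x2" "sq xpq = xp" "sq x2pq = x2p"
    unfolding x using K8(1) by (simp_all add: c gal_K)
  have gh: "hom_on K f" if "f \<in> {s2, sp, sq}" for f using that hom_s2 hom_sp hom_sq by auto
  have gc: "f (cnj y) = cnj (f y)" if "f \<in> {s2, sp, sq}" "y \<in> K" for f y
    using that gal_commute(4-6)[of y] by auto
  have mult: "f (y * z) = f y * f z" if "f \<in> {s2, sp, sq}" "y \<in> K" "z \<in> K" for f y z
    using hom_mult[OF K(1) gh[OF that(1)] that(2,3)] .
  have mult4: "f (y1*y2*y3*y4) = f y1 * f y2 * f y3 * f y4"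
    if "f \<in> {s2, sp, sq}" "y1 \<in> K" "y2 \<in> K" "y3 \<in> K" "y4 \<in> K" for f y1 y2 y3 y4
    using that mult[OF that(1)] by (simp add: clK(4))
  have unim: "f y * cnj (f y) = 1" if "f \<in> {s2, sp, sq}" "y \<in> K" "y * cnj y = 1" for f y
    using mult[OF that(1,2) gal_K(4)[OF that(2)]] that(3) gc[OF that(1,2)] hom_1[OF K(1) gh[OF that(1)]] by simp
  have O1: "x2 * cnj x2 = 1" "xp * cnj xp = 1" "xq * cnj xq = 1"
    unfolding x using unim[of s2 z] unim[of sp z] unim[of sq z] K8(1) z(2) by simp_all
  have O2: "xpq * cnj xpq = 1" "x2p * cnj x2p = 1" "x2q * cnj x2q = 1"
    using unim[of sp xq] unim[of s2 xp] unim[of s2 xq] O1 K8(3,4) a2 ap aq by simp_all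
  have O3: "x2pq * cnj x2pq = 1" using unim[of s2 xpq] O2(1) K8(7) a2(7) by simp
  note O = z(2) O1 O2 O3
  have un4: "y1*y2*y3*y4 * cnj (y1*y2*y3*y4) = 1" if "y1 * cnj y1 = 1" "y2 * cnj y2 = 1" "y3 * cnj y3 = 1" "y4 * cnj y4 = 1"
    for y1 y2 y3 y4
  proof -
    have "y1*y2*y3*y4 * cnj (y1*y2*y3*y4) = (y1 * cnj y1) * (y2 * cnj y2) * (y3 * cnj y3) * (y4 * cnj y4)"
      by (simp only: complex_cnj_mult mult_ac)
    thus ?thesis by (simp only: that mult_1)
  qed
  define N where "N = z*x2*xp*xq*x2p*x2q*xpq*x2pq"
  have N_eq: "N = (z*x2*xp*xq) * (x2p*x2q*xpq*x2pq)" by (simp add: N_def)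
  have Nu: "N \<in> unit_group K" unfolding N_def by (intro unit_group_mult[OF K(1)] U)
  have fN: "f N = N" if f: "f \<in> {s2, sp, sq}" for f
    unfolding N_eq using f K8 by (subst mult[OF f]) (auto simp: clK(4) mult4 a2 ap aq)
  have N1: "N * cnj N = 1"
  proof -
    have "N * cnj N = (z*x2*xp*xq * cnj (z*x2*xp*xq)) * (x2p*x2q*xpq*x2pq * cnj (x2p*x2q*xpq*x2pq))"
      unfolding N_eq by (simp only: complex_cnj_mult mult_ac)
    thus ?thesis by (simp only: un4[OF O(1,2,3,4)] un4[OF O(6,7,5,8)] mult_1)
  qed
  have N12: "N ^ 12 = 1"
  proof (rule real_fixed_root[OF Nu N1])
    fix f assume f: "f \<in> {s2, sp, sq}"
    show "f (N + cnj N) = N + cnj N"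
      using hom_add[OF K(1) gh[OF f] inK[OF Nu] gal_K(4)[OF inK[OF Nu]]] gc[OF f inK[OF Nu]] fN[OF f] by simp
  qed
  have step: "(y1*y2*y3*y4) ^ 24 = 1"
    if y: "y1 \<in> unit_group K" "y2 \<in> unit_group K" "y3 \<in> unit_group K" "y4 \<in> unit_group K"
      and z: "z1 \<in> unit_group K" "z2 \<in> unit_group K" "z3 \<in> unit_group K" "z4 \<in> unit_group K"
      and oy: "y1 * cnj y1 = 1" "y2 * cnj y2 = 1" "y3 * cnj y3 = 1" "y4 * cnj y4 = 1"
      and oz: "z1 * cnj z1 = 1" "z2 * cnj z2 = 1" "z3 * cnj z3 = 1" "z4 * cnj z4 = 1"
      and prod: "(y1*y2*y3*y4) * (z1*z2*z3*z4) = N"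
      and act: "\<And>f. f \<in> {s2, sp, sq} \<Longrightarrow>
        (f y1*f y2*f y3*f y4 = y1*y2*y3*y4 \<and> f z1*f z2*f z3*f z4 = z1*z2*z3*z4)
        \<or> (f y1*f y2*f y3*f y4 = z1*z2*z3*z4 \<and> f z1*f z2*f z3*f z4 = y1*y2*y3*y4)"
    for y1 y2 y3 y4 z1 z2 z3 z4
  proof -
    define W where "W = y1*y2*y3*y4"
    define W' where "W' = z1*z2*z3*z4"
    have Wu: "W \<in> unit_group K" "W' \<in> unit_group K"
      unfolding W_def W'_def by (intro unit_group_mult[OF K(1)] y z)+
    have W1: "W * cnj W = 1" "W' * cnj W' = 1"
      unfolding W_def W'_def by (rule un4[OF oy], rule un4[OF oz])
    have inv: "inverse W = cnj W" "inverse W' = cnj W'" using W1 by (metis inverse_unique)+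
    have act': "(f W = W \<and> f W' = W') \<or> (f W = W' \<and> f W' = W)" if f: "f \<in> {s2, sp, sq}" for f
      using act[OF f] mult4[OF f] y[THEN inK] z[THEN inK] unfolding W_def W'_def by simp
    \<comment> \<open>On the unit circle this is W / W'. Every automorphism fixes it or swaps it
      with its conjugate, so its trace is invariant; the norm itself is recovered from W^2 = N
      Y.\<close>
    define Y where "Y = W * cnj W'"
    have Yu: "Y \<in> unit_group K" unfolding Y_def
      by (rule unit_group_mult[OF K(1) Wu(1) ug[of cnj, OF _ Wu(2)]]) simp
    have cY: "cnj Y = W' * cnj W" by (simp add: Y_def mult.commute)
    have "Y * cnj Y = (W * cnj W) * (W' * cnj W')" unfolding cY unfolding Y_def by (simp only: mult_ac)
    hence Y1: "Y * cnj Y = 1" by (simp only: W1 mult_1)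
    have Y12: "Y ^ 12 = 1"
    proof (rule real_fixed_root[OF Yu Y1])
      fix f assume f: "f \<in> {s2, sp, sq}"
      have "f Y = f W * cnj (f W')" "f (cnj Y) = f W' * cnj (f W)"
        unfolding cY unfolding Y_def
        using mult[OF f inK[OF Wu(1)] gal_K(4)[OF inK[OF Wu(2)]]] mult[OF f inK[OF Wu(2)] gal_K(4)[OF inK[OF Wu(1)]]]
          gc[OF f inK[OF Wu(1)]] gc[OF f inK[OF Wu(2)]] by simp_all
      moreover have "f (Y + cnj Y) = f Y + f (cnj Y)"
        by (rule hom_add[OF K(1) gh[OF f] inK[OF Yu] gal_K(4)[OF inK[OF Yu]]])
      ultimately show "f (Y + cnj Y) = Y + cnj Y"
        using act'[OF f] unfolding cY unfolding Y_def by (auto simp: add.commute)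
    qed
    have "W ^ 2 = W * W * (W' * cnj W')" by (simp only: W1 power2_eq_square mult_1_right)
    also have "\<dots> = N * Y" unfolding prod[symmetric] Y_def W_def[symmetric] W'_def[symmetric] by (simp only: mult_ac)
    finally have "(W ^ 2) ^ 12 = N ^ 12 * Y ^ 12" by (simp only: power_mult_distrib)
    hence "W ^ 24 = 1" unfolding N12 Y12 by (simp flip: power_mult)
    thus ?thesis unfolding W_def .
  qed
  have w1: "(z*xp*xq*xpq) ^ 24 = 1"
    by (rule step[OF U(1,3,4,7) U(2,5,6,8) O(1,3,4,5) O(2,6,7,8)])
      (auto simp: a2 ap aq N_def mult_ac)
  have w2: "(z*x2*xq*x2q) ^ 24 = 1"
    by (rule step[OF U(1,2,4,6) U(3,5,7,8) O(1,2,4,7) O(3,6,5,8)])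
      (auto simp: a2 ap aq N_def mult_ac)
  have w3: "(z*x2*xp*x2p) ^ 24 = 1"
    by (rule step[OF U(1,2,3,5) U(4,6,7,8) O(1,2,3,6) O(4,7,5,8)])
      (auto simp: a2 ap aq N_def mult_ac)
  have w4: "(z*x2p*xq*x2pq) ^ 24 = 1"
    by (rule step[OF U(1,5,4,8) U(2,3,6,7) O(1,6,4,8) O(2,3,7,5)])
      (auto simp: a2 ap aq N_def mult_ac)
  have w5: "(z*x2q*xp*x2pq) ^ 24 = 1"
    by (rule step[OF U(1,6,3,8) U(2,4,5,7) O(1,7,3,8) O(2,4,6,5)])
      (auto simp: a2 ap aq N_def mult_ac)
  have w6: "(z*xpq*x2*x2pq) ^ 24 = 1"
    by (rule step[OF U(1,7,2,8) U(3,4,5,6) O(1,5,2,8) O(3,4,6,7)])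
      (auto simp: a2 ap aq N_def mult_ac)
  have w7: "(z*x2p*x2q*xpq) ^ 24 = 1"
    by (rule step[OF U(1,5,6,7) U(2,3,4,8) O(1,6,7,5) O(2,3,4,8)])
      (auto simp: a2 ap aq N_def mult_ac)
  have "z ^ 4 * N ^ 3 = (z*xp*xq*xpq) * (z*x2*xq*x2q) * (z*x2*xp*x2p) * (z*x2p*xq*x2pq) * (z*x2q*xp*x2pq)
      * (z*xpq*x2*x2pq) * (z*x2p*x2q*xpq)"
    unfolding N_def by (rule prod_seven_norms[symmetric])
  hence "(z ^ 4 * N ^ 3) ^ 24 = (z*xp*xq*xpq) ^ 24 * (z*x2*xq*x2q) ^ 24 * (z*x2*xp*x2p) ^ 24 * (z*x2p*xq*x2pq) ^ 24
      * (z*x2q*xp*x2pq) ^ 24 * (z*xpq*x2*x2pq) ^ 24 * (z*x2p*x2q*xpq) ^ 24"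
    by (simp only: power_mult_distrib)
  also have "\<dots> = 1" unfolding w1 w2 w3 w4 w5 w6 w7 by simp
  finally have "z ^ 96 * (N ^ 12) ^ 6 = 1" by (simp add: power_mult_distrib flip: power_mult)
  thus ?thesis unfolding N12 by simp
qed

lemma q_ne_3: "q \<noteq> 3"
proof
  assume q: "q = 3"
  have "QuadRes q 2" using Legendre_2_q by (auto simp: Legendre_def split: if_splits)
  then obtain y where "y ^ 2 mod 3 = (2 :: int)" unfolding QuadRes_def q by (auto simp: cong_def)
  moreover have "y mod 3 = 0 \<or> y mod 3 = 1 \<or> y mod 3 = 2" by presburger
  moreover have "y ^ 2 mod 3 = (y mod 3) ^ 2 mod 3" by (simp add: power_mod)
  ultimately show False by auto
qed

text \<open>A primitive cube root of unity gives (2 w + 1) times the imaginary unit, a real element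
  of K with square 3; but 3 is unramified in K+ since neither \<open>p\<close> nor \<open>q\<close>
  is 3.\<close>

lemma cube_root_of_unity:
  assumes w: "w \<in> K" "w ^ 3 = 1"
  shows "w = 1"
proof (rule ccontr)
  assume "w \<noteq> 1"
  have "(w - 1) * (w ^ 2 + w + 1) = w ^ 3 - 1"
    by (simp add: algebra_simps power2_eq_square power3_eq_cube)
  hence w2: "w ^ 2 + w + 1 = 0" using w(2) \<open>w \<noteq> 1\<close> by simp
  define x where "x = (2 * w + 1) * \<i>"
  have "x ^ 2 = 3 - 4 * (w ^ 2 + w + 1)"
    unfolding x_def by (simp add: power_mult_distrib) (simp add: algebra_simps power2_eq_square)
  hence x2: "x ^ 2 = of_int 3" unfolding w2 by simp
  have "x ^ 2 = (of_real (sqrt 3)) ^ 2" unfolding x2 by (simp flip: of_real_power)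
  hence "x = of_real (sqrt 3) \<or> x = - of_real (sqrt 3)" by (simp add: power2_eq_iff)
  hence "cnj x = x" by auto
  moreover have "x \<in> K" unfolding x_def using w(1) gens_K by (intro clK(2,3,4,12))
  ultimately have "x \<in> Kp" by (intro K_real)
  moreover have "x \<notin> Kp"
  proof (rule sqrt_notin[OF Kp(1) Kp(4) _ dvd_refl _ x2])
    show 3: "prime (3 :: int)" by simp
    thus "squarefree (3 :: int)" by (intro squarefree_prime)
    have "\<not> 3 dvd p" "\<not> 3 dvd q"
      using primes_dvd_imp_eq[OF 3 prime_p] primes_dvd_imp_eq[OF 3 prime_q] q_ne_3 p_mod_4 by auto
    moreover have "\<not> (3 :: int) dvd 16" by simp
    ultimately show "\<not> 3 dvd 16 * p * q" using prime_dvd_mult_iff[OF 3] by blast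
  qed
  ultimately show False by simp
qed

text \<open>Such a root has t = y + cnj y with t^2 = 2 + r2 or 2 - r2. Then t s2(t) has square 2, so
  it is r2 up to sign; yet it is fixed by \<open>s2\<close>, which negates
  \<open>r2\<close>.\<close>

lemma no_primitive_16th_root:
  assumes y: "y \<in> K" "y ^ 8 = - 1"
  shows False
proof -
  have "cmod y ^ 8 = 1" using y(2) by (metis norm_minus_cancel norm_one norm_power)
  hence "cmod y = 1" using power_eq_iff_eq_base[of 8 "cmod y" 1] by simp
  hence yc: "y * cnj y = 1" by (simp add: complex_norm_square[symmetric] mult.commute)
  define t where "t = y + cnj y"
  have tK: "t \<in> K" unfolding t_def using y(1) gal_K(4) by (intro clK(3))
  have "cnj t = t" by (simp add: t_def add.commute)
  hence tKp: "t \<in> Kp" by (rule K_real[OF tK])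
  have "(y ^ 4 + cnj y ^ 4) ^ 2 = y ^ 8 + cnj y ^ 8 + 2 * (y * cnj y) ^ 4"
    by (simp add: power2_sum power_mult_distrib flip: power_mult)
  also have "cnj y ^ 8 = - 1" using arg_cong[OF y(2), of cnj] by simp
  finally have y4: "y ^ 4 + cnj y ^ 4 = 0" unfolding yc y(2) by simp
  have "(y ^ 2 + cnj y ^ 2) ^ 2 = y ^ 4 + cnj y ^ 4 + 2 * (y * cnj y) ^ 2"
    by (simp add: power2_sum power_mult_distrib flip: power_mult)
  hence y2: "(y ^ 2 + cnj y ^ 2) ^ 2 = r2 ^ 2" unfolding y4 yc r2_sq by simp
  have "t ^ 2 = y ^ 2 + cnj y ^ 2 + 2 * (y * cnj y)"
    by (simp add: t_def power2_sum)
  hence t2: "t ^ 2 = y ^ 2 + cnj y ^ 2 + 2" unfolding yc by simp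
  from y2 have "y ^ 2 + cnj y ^ 2 = r2 \<or> y ^ 2 + cnj y ^ 2 = - r2" by (simp add: power2_eq_iff)
  then obtain \<delta> where \<delta>: "\<delta> = 1 \<or> \<delta> = (- 1 :: complex)" "t ^ 2 = \<delta> * r2 + 2"
    using t2 by (elim disjE) (rule that[of 1], simp_all, rule that[of "- 1"], simp_all)
  have "s2 t ^ 2 = s2 (\<delta> * r2 + 2)" unfolding \<delta>(2)[symmetric] by (rule hom_power[OF K(1) hom_s2 tK, symmetric])
  also have "\<dots> = 2 - \<delta> * r2"
    using \<delta>(1) gens_K by (auto simp: hom_add[OF K(1) hom_s2] hom_minus[OF K(1) hom_s2] hom_numeral[OF K(1) hom_s2]
        hom_diff[OF K(1) hom_s2] clK s2_gens)
  finally have "(t * s2 t) ^ 2 = (\<delta> * r2 + 2) * (2 - \<delta> * r2)" unfolding power_mult_distrib \<delta>(2) by simp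
  also have "\<dots> = r2 ^ 2" using \<delta>(1) by (auto simp: algebra_simps power2_eq_square r2_sq[unfolded power2_eq_square])
  finally have v: "t * s2 t = r2 \<or> t * s2 t = - r2" by (simp add: power2_eq_iff)
  have "s2 (t * s2 t) = t * s2 t"
    using hom_mult[OF K(1) hom_s2 tK gal_K(1)[OF tK]] gal_invol(1)[OF tK] by (simp add: mult.commute)
  moreover have "s2 r2 = - r2" "s2 (- r2) = r2" using s2_gens(1) hom_minus[OF K(1) hom_s2 gens_K(1)] by simp_all
  ultimately have "r2 = - r2" using v by auto
  hence "2 * r2 = 0" by simp
  thus False using r2_ne_0 by simp
qed

text \<open>Of 96 = 3 * 32 the factor 3 goes by \<open>cube_root_of_unity\<close>; excluding the
  value -1 for an eighth power of z^2 and of z lowers 32 to 8.\<close>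

lemma torsion_8:
  assumes z: "z \<in> unit_group K" "z * cnj z = 1"
  shows "z ^ 8 = 1"
proof -
  have zK: "z \<in> K" using z by (simp add: unit_group_def)
  have "(z ^ 32) ^ 3 = 1" using torsion_96[OF z] by (simp flip: power_mult)
  hence "z ^ 32 = 1" by (rule cube_root_of_unity[OF clK(9)[OF zK]])
  hence "(z ^ 16) ^ 2 = 1" by (simp flip: power_mult)
  hence "z ^ 16 = 1 \<or> z ^ 16 = - 1" by (simp only: power2_eq_1_iff)
  moreover have "z ^ 16 \<noteq> - 1"
  proof
    assume "z ^ 16 = - 1"
    hence "(z ^ 2) ^ 8 = - 1" by (simp flip: power_mult)
    thus False by (rule no_primitive_16th_root[OF clK(9)[OF zK]])
  qed
  ultimately have "(z ^ 8) ^ 2 = 1" by (simp flip: power_mult)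
  hence "z ^ 8 = 1 \<or> z ^ 8 = - 1" by (simp only: power2_eq_1_iff)
  thus ?thesis using no_primitive_16th_root[OF zK] by blast
qed

section \<open>The additional unit of K and the index over the real units\<close>

definition H :: complex where "H = (1 + zeta8) * S / (2 + r2)"

lemma zeta8_square: "(1 + zeta8) ^ 2 = zeta8 * (2 + r2)"
proof -
  have "r2 * zeta8 = 1 + \<i>" by (simp add: zeta8_eq r2_def)
  thus ?thesis by (simp add: algebra_simps power2_sum zeta8_2)
qed

lemma H_K: "H \<in> K"
  unfolding H_def using S_in[THEN Kp_K] zeta8_K gens_K by (intro clK(2,3,4,8,12))

lemma H_sq: "H ^ 2 = zeta8 * A * B"
proof -
  have "H ^ 2 = zeta8 * (2 + r2) * ((2 + r2) * (A * B)) / (2 + r2) ^ 2"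
    unfolding H_def power_divide power_mult_distrib zeta8_square S_sq ..
  thus ?thesis using pos_ne_0[OF pos_2_r2] by (simp add: power2_eq_square)
qed

lemma H_unit: "H \<in> unit_group K"
proof (rule unit_group_of_power[of H 2 K])
  have sub: "x \<in> unit_group Kp \<Longrightarrow> x \<in> unit_group K" for x using Kp_K by (simp add: unit_group_def)
  show "H ^ 2 \<in> unit_group K" unfolding H_sq
    by (intro unit_group_mult[OF K(1)] zeta8_unit sub units_Kp)
qed (simp_all add: H_K)

text \<open>H cnj(H) is positive with square (A B)^2, so it is A B, and the quotient is H^2 / (A
  B).\<close>

lemma H_cnj: "H / cnj H = zeta8"
proof -
  have c: "cnj A = A" "cnj B = B" using act_A(4) act_B(4) Kp_cnj by auto
  have "(H * cnj H) ^ 2 = H ^ 2 * cnj (H ^ 2)" by (simp add: power_mult_distrib)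
  also have "\<dots> = (A * B) ^ 2" unfolding H_sq using zeta8_ne_0
    by (simp add: c cnj_zeta8 power2_eq_square field_simps)
  finally have "H * cnj H = A * B \<or> H * cnj H = - (A * B)" by (simp add: power2_eq_iff)
  moreover have H0: "H \<noteq> 0" using H_unit by (simp add: unit_group_def)
  have "pos (H * cnj H)" unfolding pos_def
  proof (intro exI conjI)
    show "H * cnj H = of_real (cmod H ^ 2)" by (rule complex_norm_square[symmetric])
    show "cmod H ^ 2 > 0" using H0 by simp
  qed
  ultimately have HH: "H * cnj H = A * B" using not_pos_minus[OF pos_mult[OF pos_units(4,5)]] by auto
  have "H / cnj H = H ^ 2 / (H * cnj H)" using H0 by (simp add: power2_eq_square)
  also have "\<dots> = zeta8" unfolding H_sq HH using units_ne_0 by simp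
  finally show ?thesis .
qed

text \<open>The quotient of \<open>u\<close> by its conjugate is a power of zeta8. An even power is
  matched by a power of zeta8 itself, an odd one by an additional factor H; dividing by these leaves
  a unit equal to its conjugate.\<close>

theorem unit_K_form:
  assumes u: "u \<in> unit_group K"
  obtains v m where "v \<in> unit_group Kp" "u = zeta8 ^ m * v \<or> u = zeta8 ^ m * H * v"
proof -
  have u0: "u \<noteq> 0" using u by (simp add: unit_group_def)
  have cu: "cnj u \<in> unit_group K" by (rule unit_gal_K[OF u hom_on_cnj gal_K(4)])
  define z where "z = u / cnj u"
  have zu: "z \<in> unit_group K" unfolding z_def field_class.field_divide_inverse
    by (intro unit_group_mult[OF K(1)] u unit_group_inverse[OF K(1)] cu)
  have "z * cnj z = 1" unfolding z_def using u0 by simp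
  then obtain k where k: "z = zeta8 ^ (2 * k) \<or> z = zeta8 ^ (2 * k) * zeta8"
    using eighth_root_of_unity[OF torsion_8[OF zu]] by blast
  have real: "x \<in> unit_group Kp" if "x \<in> unit_group K" "x / cnj x = 1" for x
  proof -
    have "x = cnj x" using that by (simp add: unit_group_def)
    hence "x \<in> Kp" using that K_real[of x] by (simp add: unit_group_def)
    thus ?thesis using that by (simp add: unit_group_def)
  qed
  have zk: "zeta8 ^ k / cnj (zeta8 ^ k) = zeta8 ^ (2 * k)"
  proof -
    have c: "cnj (zeta8 ^ k) = inverse (zeta8 ^ k)" by (simp add: cnj_zeta8 power_inverse)
    show ?thesis unfolding c mult_2 power_add
      by (simp only: field_class.field_divide_inverse inverse_inverse_eq)
  qed
  have zku: "zeta8 ^ k \<in> unit_group K" by (rule unit_group_power[OF K(1) zeta8_unit])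
  from k show ?thesis
  proof
    assume z: "z = zeta8 ^ (2 * k)"
    define v where "v = u / zeta8 ^ k"
    have "v / cnj v = z / (zeta8 ^ k / cnj (zeta8 ^ k))" by (simp add: v_def z_def)
    also have "\<dots> = 1" unfolding zk z using zeta8_ne_0 by simp
    finally have "v \<in> unit_group Kp"
      unfolding v_def field_class.field_divide_inverse[of u]
      by (intro real unit_group_mult[OF K(1)] u unit_group_inverse[OF K(1)] zku)
    moreover have "u = zeta8 ^ k * v" using zeta8_ne_0 by (simp add: v_def)
    ultimately show ?thesis using that by blast
  next
    assume z: "z = zeta8 ^ (2 * k) * zeta8"
    have H0: "H \<noteq> 0" using H_unit by (simp add: unit_group_def)
    define v where "v = u / (zeta8 ^ k * H)"
    have "v / cnj v = z / ((zeta8 ^ k / cnj (zeta8 ^ k)) * (H / cnj H))" by (simp add: v_def z_def)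
    also have "\<dots> = 1" unfolding zk z H_cnj using zeta8_ne_0 by simp
    finally have "v \<in> unit_group Kp"
      unfolding v_def field_class.field_divide_inverse[of u]
      by (intro real unit_group_mult[OF K(1)] u unit_group_inverse[OF K(1)] zku H_unit)
    moreover have "u = zeta8 ^ k * H * v" using zeta8_ne_0 H0 by (simp add: v_def)
    ultimately show ?thesis using that by blast
  qed
qed

end

section \<open>Generators of the unit groups\<close>

lemma gen_group_I: "(\<Prod>i<length gs. (gs ! i) powi (k i)) \<in> gen_group gs"
  unfolding gen_group_def by auto

lemma gen_group_nth:
  assumes "i < length gs"
  shows "gs ! i \<in> gen_group gs"
proof -
  have "(\<Prod>j<length gs. (gs ! j) powi (if j = i then 1 else 0)) = (\<Prod>j<length gs. if j = i then gs ! j else 1)"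
    by (rule prod.cong) auto
  also have "\<dots> = gs ! i" using assms by simp
  finally show ?thesis using gen_group_I[of gs "\<lambda>j. if j = i then 1 else 0"] by simp
qed

text \<open>Integer exponents add only for nonzero bases, hence the condition on
  \<open>gs\<close>.\<close>

lemma gen_group_mult:
  assumes gs: "0 \<notin> set gs" and "x \<in> gen_group gs" "y \<in> gen_group gs"
  shows "x * y \<in> gen_group gs"
proof -
  obtain k l where kl: "x = (\<Prod>i<length gs. (gs ! i) powi (k i))" "y = (\<Prod>i<length gs. (gs ! i) powi (l i))"
    using assms(2,3) unfolding gen_group_def by blast
  have "x * y = (\<Prod>i<length gs. (gs ! i) powi (k i + l i))"
    unfolding kl prod.distrib[symmetric]
  proof (rule prod.cong[OF refl])
    fix i assume "i \<in> {..<length gs}"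
    hence "gs ! i \<in> set gs" by simp
    hence "gs ! i \<noteq> 0" using gs by metis
    thus "(gs ! i) powi (k i) * (gs ! i) powi (l i) = (gs ! i) powi (k i + l i)" by (simp add: power_int_add)
  qed
  thus ?thesis by (simp only: gen_group_I)
qed

lemma gen_group_inverse:
  assumes "x \<in> gen_group gs"
  shows "inverse x \<in> gen_group gs"
proof -
  obtain k where k: "x = (\<Prod>i<length gs. (gs ! i) powi (k i))"
    using assms unfolding gen_group_def by blast
  have "inverse x = (\<Prod>i<length gs. (gs ! i) powi (- k i))"
    unfolding k prod_inversef[symmetric] by (simp add: power_int_minus o_def)
  thus ?thesis by (simp only: gen_group_I)
qed

lemma gen_group_1: "1 \<in> gen_group gs"
  using gen_group_I[of gs "\<lambda>_. 0"] by simp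

lemma gen_group_powi:
  assumes gs: "0 \<notin> set gs" and x: "x \<in> gen_group gs"
  shows "x powi k \<in> gen_group gs"
proof -
  have "y ^ n \<in> gen_group gs" if "y \<in> gen_group gs" for y n
    by (induction n) (auto intro: gen_group_1 gen_group_mult[OF gs that])
  thus ?thesis using x gen_group_inverse by (auto simp: power_int_def)
qed

lemma gen_group_subset_unit_group:
  assumes F: "is_subfield F" and gs: "set gs \<subseteq> unit_group F"
  shows "gen_group gs \<subseteq> unit_group F"
proof
  fix x assume "x \<in> gen_group gs"
  then obtain k where k: "x = (\<Prod>i<length gs. (gs ! i) powi (k i))"
    unfolding gen_group_def by blast
  have "(\<Prod>i\<in>I. (gs ! i) powi (k i)) \<in> unit_group F" if "finite I" "I \<subseteq> {..<length gs}" for I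
    using that
  proof (induction I rule: finite_induct)
    case (insert i I)
    hence "gs ! i \<in> unit_group F" using gs by auto
    thus ?case using insert by (simp add: unit_group_mult[OF F] unit_group_powi[OF F])
  qed (simp add: unit_group_1[OF F])
  thus "x \<in> unit_group F" unfolding k by simp
qed

lemma fourth_power_cases:
  fixes x y :: complex
  assumes "x ^ 4 = y ^ 4"
  shows "x = y \<or> x = - y \<or> x = \<i> * y \<or> x = - (\<i> * y)"
proof -
  have "(x ^ 2) ^ 2 = (y ^ 2) ^ 2" using assms by (simp flip: power_mult)
  hence "x ^ 2 = y ^ 2 \<or> x ^ 2 = - (y ^ 2)" by (simp only: power2_eq_iff)
  hence "x ^ 2 = y ^ 2 \<or> x ^ 2 = (\<i> * y) ^ 2" by (simp add: power_mult_distrib)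
  thus ?thesis unfolding power2_eq_iff by blast
qed

section \<open>The two unit groups\<close>

context pq_primes
begin

lemma E_pow_4: "E ^ 4 = fund_unit 2 ^ 2 * fund_unit q * fund_unit (p * q) * fund_unit (2 * p * q)"
proof -
  have "E ^ 4 = (E ^ 2) ^ 2" by (simp flip: power_mult)
  thus ?thesis unfolding E_sq power_mult_distrib units_sq e2_def .
qed

lemma D_sq': "D ^ 2 = fund_unit 2 * fund_unit p * fund_unit (2 * p)"
  unfolding D_sq e2_def ep_def e2p_def ..

lemma H_pow_4: "H ^ 4 = zeta8 ^ 2 * fund_unit q * fund_unit (2 * q)"
proof -
  have "H ^ 4 = (H ^ 2) ^ 2" by (simp flip: power_mult)
  thus ?thesis unfolding H_sq power_mult_distrib units_sq .
qed

lemma DE_units: "D \<in> unit_group Kp" "E \<in> unit_group Kp"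
proof -
  show "D \<in> unit_group Kp"
    by (rule unit_group_of_power[of D 2 Kp, OF _ _ D_in]) (simp_all add: D_sq unit_group_mult[OF Kp(1)] units_Kp)
  show "E \<in> unit_group Kp"
    by (rule unit_group_of_power[of E 2 Kp, OF _ _ E_in]) (simp_all add: E_sq unit_group_mult[OF Kp(1)] units_Kp)
qed

lemma unit_Kp_K: "x \<in> unit_group Kp \<Longrightarrow> x \<in> unit_group K"
  using Kp_K by (simp add: unit_group_def)

text \<open>G is recovered from E^2 = e2 A C G. The generator list is arbitrary so that the same
  lemma serves K+ and K.\<close>

lemma unit_group_Kp_subset:
  assumes gs: "0 \<notin> set gs"
    and mem: "- 1 \<in> gen_group gs" "e2 \<in> gen_group gs" "ep \<in> gen_group gs" "A \<in> gen_group gs" "B \<in> gen_group gs"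
      "C \<in> gen_group gs" "D \<in> gen_group gs" "E \<in> gen_group gs"
  shows "unit_group Kp \<subseteq> gen_group gs"
proof
  fix u assume "u \<in> unit_group Kp"
  then obtain i j c k l m n \<delta> where u: "\<delta> = 1 \<or> \<delta> = - 1" "u = \<delta> * mon7 e2 ep D E B C G i j c k l m n"
    by (rule unit_Kp_form)
  note cl = gen_group_mult[OF gs] gen_group_powi[OF gs] gen_group_inverse
  have "G = E ^ 2 * inverse (e2 * A * C)" unfolding E_sq using units_ne_0 by (simp add: field_simps)
  also have "\<dots> = E * E * inverse (e2 * A * C)" by (simp only: power2_eq_square)
  also have "\<dots> \<in> gen_group gs" by (intro cl mem)
  finally have G: "G \<in> gen_group gs" .
  have "mon7 e2 ep D E B C G i j c k l m n \<in> gen_group gs" unfolding mon7_def by (intro cl mem G)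
  moreover have "\<delta> \<in> gen_group gs" using u(1) mem(1) gen_group_1 by auto
  ultimately show "u \<in> gen_group gs" unfolding u(2) by (intro cl(1))
qed

text \<open>Any other choice of the radicals in K+ differs from A, B, C, D, E by signs, which the
  generator -1 absorbs.\<close>

theorem unit_group_Kp:
  assumes in_Kp: "a \<in> Kp" "b \<in> Kp" "c \<in> Kp" "d \<in> Kp" "e \<in> Kp"
    and eqs: "a ^ 2 = A ^ 2" "b ^ 2 = B ^ 2" "c ^ 2 = C ^ 2" "d ^ 2 = D ^ 2" "e ^ 4 = E ^ 4"
  shows "unit_group Kp = gen_group [- 1, e2, ep, a, b, c, d, e]"
proof
  let ?gs = "[- 1, e2, ep, a, b, c, d, e]"
  have "(e ^ 2) ^ 2 = (E ^ 2) ^ 2" using eqs(5) by (simp flip: power_mult)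
  hence "e ^ 2 = E ^ 2 \<or> e ^ 2 = - (E ^ 2)" by (simp only: power2_eq_iff)
  moreover have E0: "E \<noteq> 0" using DE_units(2) by (simp add: unit_group_def)
  moreover have "e \<noteq> 0" using eqs(5) E0 by auto
  \<comment> \<open>Both fourth roots are real and nonzero, so their squares are positive and cannot
    be opposite.\<close>
  ultimately have e2': "e ^ 2 = E ^ 2"
    using not_pos_minus[OF pos_Kp_square[OF E_in E0]] pos_Kp_square[OF in_Kp(5)] by auto
  have pm: "a = A \<or> a = - A" "b = B \<or> b = - B" "c = C \<or> c = - C" "d = D \<or> d = - D" "e = E \<or> e = - E"
    using eqs(1-4) e2' by (simp_all only: power2_eq_iff)
  note U = units_Kp DE_units unit_group_uminus_one[OF Kp(1)]
  have sub: "set ?gs \<subseteq> unit_group Kp"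
    using pm U unit_group_minus[OF Kp(1)] by auto
  thus "gen_group ?gs \<subseteq> unit_group Kp" by (rule gen_group_subset_unit_group[OF Kp(1)])
  have gs: "0 \<notin> set ?gs" using subsetD[OF sub, of 0] by (auto simp: unit_group_def)
  have nth: "?gs ! i \<in> gen_group ?gs" if "i < 8" for i by (rule gen_group_nth) (use that in simp)
  have mem: "- 1 \<in> gen_group ?gs" "e2 \<in> gen_group ?gs" "ep \<in> gen_group ?gs" "a \<in> gen_group ?gs" "b \<in> gen_group ?gs"
    "c \<in> gen_group ?gs" "d \<in> gen_group ?gs" "e \<in> gen_group ?gs"
    using nth[of 0] nth[of 1] nth[of 2] nth[of 3] nth[of 4] nth[of 5] nth[of 6] nth[of 7] by (simp_all add: eval_nat_numeral)
  have neg: "- x \<in> gen_group ?gs" if "x \<in> gen_group ?gs" for x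
    using gen_group_mult[OF gs mem(1) that] by simp
  have "y \<in> gen_group ?gs" if "x = y \<or> x = - y" "x \<in> gen_group ?gs" for x y
    using that neg[OF that(2)] by auto
  note pm' = this[OF pm(1) mem(4)] this[OF pm(2) mem(5)] this[OF pm(3) mem(6)] this[OF pm(4) mem(7)] this[OF pm(5) mem(8)]
  show "unit_group Kp \<subseteq> gen_group ?gs"
    by (rule unit_group_Kp_subset[OF gs mem(1-3) pm'])
qed

text \<open>In K a fourth root is determined up to a power of the imaginary unit, which is zeta8^2.
  B is missing from the list and returns as H^2 / (zeta8 A).\<close>

theorem unit_group_K:
  assumes eqs: "a ^ 2 = A ^ 2" "c ^ 2 = C ^ 2" "d ^ 2 = D ^ 2" "e ^ 4 = E ^ 4" "f ^ 4 = H ^ 4"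
  shows "unit_group K = gen_group [zeta8, e2, ep, a, c, d, e, f]"
proof
  let ?gs = "[zeta8, e2, ep, a, c, d, e, f]"
  have pm: "a = A \<or> a = - A" "c = C \<or> c = - C" "d = D \<or> d = - D"
    using eqs(1-3) by (simp_all only: power2_eq_iff)
  note pm4 = fourth_power_cases[OF eqs(4)] fourth_power_cases[OF eqs(5)]
  note U = units_Kp[THEN unit_Kp_K] DE_units[THEN unit_Kp_K] H_unit zeta8_unit
  have iU: "\<i> \<in> unit_group K" using unit_group_power[OF K(1) zeta8_unit, of 2] by (simp add: zeta8_2)
  have sub: "set ?gs \<subseteq> unit_group K"
    using pm pm4 U unit_group_minus[OF K(1)] unit_group_mult[OF K(1) iU] by auto
  thus "gen_group ?gs \<subseteq> unit_group K" by (rule gen_group_subset_unit_group[OF K(1)])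
  have gs: "0 \<notin> set ?gs" using subsetD[OF sub, of 0] by (auto simp: unit_group_def)
  have nth: "?gs ! i \<in> gen_group ?gs" if "i < 8" for i by (rule gen_group_nth) (use that in simp)
  have mem: "zeta8 \<in> gen_group ?gs" "e2 \<in> gen_group ?gs" "ep \<in> gen_group ?gs" "a \<in> gen_group ?gs" "c \<in> gen_group ?gs"
    "d \<in> gen_group ?gs" "e \<in> gen_group ?gs" "f \<in> gen_group ?gs"
    using nth[of 0] nth[of 1] nth[of 2] nth[of 3] nth[of 4] nth[of 5] nth[of 6] nth[of 7] by (simp_all add: eval_nat_numeral)
  note mult = gen_group_mult[OF gs]
  have "zeta8 * zeta8 \<in> gen_group ?gs" by (rule mult[OF mem(1,1)])
  hence i: "\<i> \<in> gen_group ?gs" using zeta8_2 by (simp add: power2_eq_square)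
  have m1: "- 1 \<in> gen_group ?gs" using mult[OF i i] by simp
  have neg: "- x \<in> gen_group ?gs" if "x \<in> gen_group ?gs" for x
    using mult[OF m1 that] by simp
  have pmD: "y \<in> gen_group ?gs" if "x = y \<or> x = - y" "x \<in> gen_group ?gs" for x y
    using that neg[OF that(2)] by auto
  have pm4D: "y \<in> gen_group ?gs" if xy: "x = y \<or> x = - y \<or> x = \<i> * y \<or> x = - (\<i> * y)" and x: "x \<in> gen_group ?gs" for x y
  proof -
    have "\<i> * x \<in> gen_group ?gs" by (rule mult[OF i x])
    moreover have "- (\<i> * x) \<in> gen_group ?gs" by (rule neg) (rule mult[OF i x])
    moreover have "y = x \<or> y = - x \<or> y = \<i> * x \<or> y = - (\<i> * x)" using xy by (auto simp flip: mult.assoc)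
    ultimately show ?thesis using x neg[OF x] by auto
  qed
  have ACD: "A \<in> gen_group ?gs" "C \<in> gen_group ?gs" "D \<in> gen_group ?gs"
    by (rule pmD[OF pm(1) mem(4)], rule pmD[OF pm(2) mem(5)], rule pmD[OF pm(3) mem(6)])
  have EH: "E \<in> gen_group ?gs" "H \<in> gen_group ?gs"
    by (rule pm4D[OF pm4(1) mem(7)], rule pm4D[OF pm4(2) mem(8)])
  have "B = H ^ 2 * inverse (zeta8 * A)" unfolding H_sq using units_ne_0 zeta8_ne_0 by (simp add: field_simps)
  also have "\<dots> = H * H * inverse (zeta8 * A)" by (simp only: power2_eq_square)
  also have "\<dots> \<in> gen_group ?gs" by (intro mult gen_group_inverse EH mem ACD)
  finally have B: "B \<in> gen_group ?gs" .
  have Kp: "unit_group Kp \<subseteq> gen_group ?gs"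
    by (rule unit_group_Kp_subset[OF gs m1 mem(2,3) ACD(1) B ACD(2,3) EH(1)])
  show "unit_group K \<subseteq> gen_group ?gs"
  proof
    fix u assume "u \<in> unit_group K"
    then obtain v m where v: "v \<in> unit_group Kp" "u = zeta8 ^ m * v \<or> u = zeta8 ^ m * H * v"
      by (rule unit_K_form)
    have vg: "v \<in> gen_group ?gs" using v(1) Kp by auto
    have zm: "zeta8 ^ m \<in> gen_group ?gs" using gen_group_powi[OF gs mem(1), of "int m"] by simp
    from v(2) show "u \<in> gen_group ?gs"
      using mult[OF zm vg] mult[OF mult[OF zm EH(2)] vg] by auto
  qed
qed

end

text \<open>The existence parts keep the universally quantified parts from being vacuous; these in
  turn make the result independent of the choice of radicals.\<close>

theorem theorem4p4:
  fixes p q :: int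
  assumes "prime p" "prime q"
    and "p mod 4 = 1" "q mod 4 = 3"
    and "Legendre 2 p = -1" "Legendre 2 q = 1" "Legendre p q = -1"
  defines "Kp \<equiv> gen_field {complex_of_real (sqrt 2), complex_of_real (sqrt (real_of_int p)),
                            complex_of_real (sqrt (real_of_int q))}"
    and "K \<equiv> gen_field {complex_of_real (sqrt 2), complex_of_real (sqrt (real_of_int p)),
                            complex_of_real (sqrt (real_of_int q)), \<i>}"
  shows
   "(\<exists>a b c d e. a \<in> Kp \<and> b \<in> Kp \<and> c \<in> Kp \<and> d \<in> Kp \<and> e \<in> Kp \<and>
       a ^ 2 = fund_unit q \<and> b ^ 2 = fund_unit (2 * q) \<and> c ^ 2 = fund_unit (p * q) \<and>
       d ^ 2 = fund_unit 2 * fund_unit p * fund_unit (2 * p) \<and>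
       e ^ 4 = fund_unit 2 ^ 2 * fund_unit q * fund_unit (p * q) * fund_unit (2 * p * q))
    \<and> (\<forall>a b c d e. a \<in> Kp \<and> b \<in> Kp \<and> c \<in> Kp \<and> d \<in> Kp \<and> e \<in> Kp \<and>
       a ^ 2 = fund_unit q \<and> b ^ 2 = fund_unit (2 * q) \<and> c ^ 2 = fund_unit (p * q) \<and>
       d ^ 2 = fund_unit 2 * fund_unit p * fund_unit (2 * p) \<and>
       e ^ 4 = fund_unit 2 ^ 2 * fund_unit q * fund_unit (p * q) * fund_unit (2 * p * q) \<longrightarrow>
       unit_group Kp = gen_group [-1, fund_unit 2, fund_unit p, a, b, c, d, e])
    \<and> (\<exists>a c d e f. a \<in> K \<and> c \<in> K \<and> d \<in> K \<and> e \<in> K \<and> f \<in> K \<and>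
       a ^ 2 = fund_unit q \<and> c ^ 2 = fund_unit (p * q) \<and>
       d ^ 2 = fund_unit 2 * fund_unit p * fund_unit (2 * p) \<and>
       e ^ 4 = fund_unit 2 ^ 2 * fund_unit q * fund_unit (p * q) * fund_unit (2 * p * q) \<and>
       f ^ 4 = zeta8 ^ 2 * fund_unit q * fund_unit (2 * q))
    \<and> (\<forall>a c d e f. a \<in> K \<and> c \<in> K \<and> d \<in> K \<and> e \<in> K \<and> f \<in> K \<and>
       a ^ 2 = fund_unit q \<and> c ^ 2 = fund_unit (p * q) \<and>
       d ^ 2 = fund_unit 2 * fund_unit p * fund_unit (2 * p) \<and>
       e ^ 4 = fund_unit 2 ^ 2 * fund_unit q * fund_unit (p * q) * fund_unit (2 * p * q) \<and>
       f ^ 4 = zeta8 ^ 2 * fund_unit q * fund_unit (2 * q) \<longrightarrow>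
       unit_group K = gen_group [zeta8, fund_unit 2, fund_unit p, a, c, d, e, f])"
proof -
  interpret P: pq_primes p q using assms(1-7) by unfold_locales
  have Kp_eq: "Kp = P.Kp"
    unfolding Kp_def P.Kp(5)[symmetric] P.r2_def P.rp_def P.rq_def by (simp only: insert_commute)
  have K_eq: "K = P.K"
    unfolding K_def P.K(4)[symmetric] P.r2_def P.rp_def P.rq_def by (simp only: insert_commute)
  note eqs = P.units_sq(1-3) P.D_sq' P.E_pow_4 P.H_pow_4
  note in_Kp = P.act_A(4) P.act_B(4) P.act_C(4) P.D_in P.E_in
  note in_K = in_Kp[THEN P.Kp_K] P.H_K
  show ?thesis
  proof (intro conjI allI impI)
    show "\<exists>a b c d e. a \<in> Kp \<and> b \<in> Kp \<and> c \<in> Kp \<and> d \<in> Kp \<and> e \<in> Kp \<and>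
       a ^ 2 = fund_unit q \<and> b ^ 2 = fund_unit (2 * q) \<and> c ^ 2 = fund_unit (p * q) \<and>
       d ^ 2 = fund_unit 2 * fund_unit p * fund_unit (2 * p) \<and>
       e ^ 4 = fund_unit 2 ^ 2 * fund_unit q * fund_unit (p * q) * fund_unit (2 * p * q)"
      unfolding Kp_eq
      by (rule exI[of _ P.A], rule exI[of _ P.B], rule exI[of _ P.C], rule exI[of _ P.D], rule exI[of _ P.E])
        (intro conjI in_Kp eqs)
    show "\<exists>a c d e f. a \<in> K \<and> c \<in> K \<and> d \<in> K \<and> e \<in> K \<and> f \<in> K \<and>
       a ^ 2 = fund_unit q \<and> c ^ 2 = fund_unit (p * q) \<and>
       d ^ 2 = fund_unit 2 * fund_unit p * fund_unit (2 * p) \<and>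
       e ^ 4 = fund_unit 2 ^ 2 * fund_unit q * fund_unit (p * q) * fund_unit (2 * p * q) \<and>
       f ^ 4 = zeta8 ^ 2 * fund_unit q * fund_unit (2 * q)"
      unfolding K_eq
      by (rule exI[of _ P.A], rule exI[of _ P.C], rule exI[of _ P.D], rule exI[of _ P.E], rule exI[of _ P.H])
        (intro conjI in_K eqs)
  next
    fix a b c d e
    assume *: "a \<in> Kp \<and> b \<in> Kp \<and> c \<in> Kp \<and> d \<in> Kp \<and> e \<in> Kp \<and>
       a ^ 2 = fund_unit q \<and> b ^ 2 = fund_unit (2 * q) \<and> c ^ 2 = fund_unit (p * q) \<and>
       d ^ 2 = fund_unit 2 * fund_unit p * fund_unit (2 * p) \<and>
       e ^ 4 = fund_unit 2 ^ 2 * fund_unit q * fund_unit (p * q) * fund_unit (2 * p * q)"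
    show "unit_group Kp = gen_group [- 1, fund_unit 2, fund_unit p, a, b, c, d, e]"
      unfolding Kp_eq P.e2_def[symmetric] P.ep_def[symmetric]
      by (rule P.unit_group_Kp) (use * in \<open>simp_all only: Kp_eq eqs\<close>)
  next
    fix a c d e f
    assume *: "a \<in> K \<and> c \<in> K \<and> d \<in> K \<and> e \<in> K \<and> f \<in> K \<and>
       a ^ 2 = fund_unit q \<and> c ^ 2 = fund_unit (p * q) \<and>
       d ^ 2 = fund_unit 2 * fund_unit p * fund_unit (2 * p) \<and>
       e ^ 4 = fund_unit 2 ^ 2 * fund_unit q * fund_unit (p * q) * fund_unit (2 * p * q) \<and>
       f ^ 4 = zeta8 ^ 2 * fund_unit q * fund_unit (2 * q)"
    show "unit_group K = gen_group [zeta8, fund_unit 2, fund_unit p, a, c, d, e, f]"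
      unfolding K_eq P.e2_def[symmetric] P.ep_def[symmetric]
      by (rule P.unit_group_K) (use * in \<open>simp_all only: eqs\<close>)
  qed
qed

end
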